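(* Let $\lambda>0$ and let $F$ be a real entire function of exponential type at most $2\pi$ such that $F(x)\le G_\lambda(x)$ for all real $x$. Then $$\int_{-\infty}^{\infty}F(x)\,dx\ \le\ \lambda^{-1/2}\,\theta_2\bigl(0,i\lambda^{-1}\bigr),$$ and there is equality if and only if $F(z)=L_\lambda(z)$.
   Context: An entire function $F$ is of exponential type at most $2\pi\delta$ if for every $\epsilon>0$ there is a constant $C>0$ with $|F(z)|\le C e^{(2\pi\delta+\epsilon)|z|}$ for all $z\in\mathbb{C}$. A real entire function is an entire function whose restriction to $\mathbb{R}$ is real valued. For $\lambda>0$, $G_\lambda(z)=e^{-\pi\lambda z^2}$, and $L_\lambda$ is the entire function (of exponential type $2\pi$) $$L_\lambda(z)=\Bigl(\frac{\cos\pi z}{\pi}\Bigr)^2\Bigl\{\sum_{m=-\infty}^{\infty}\frac{G_\lambda(m+\frac12)}{(z-m-\frac12)^2}+\sum_{n=-\infty}^{\infty}\frac{G_\lambda'(n+\frac12)}{z-n-\frac12}\Bigr\}$$ (with removable singularities filled in). With $e(z)=e^{2\pi i z}$, $\Im\tau>0$ and $q=e^{\pi i\tau}$, $\theta_2(v,\tau)=\sum_{n=-\infty}^{\infty}(-1)^nq^{n^2}e(nv)$. Since $F\le G_\lambda$ with $G_\lambda$ integrable, $\int F$ is well defined in $[-\infty,\infty)$. *)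

theory Defs
  imports "HOL-Complex_Analysis.Complex_Analysis"
begin

definition exponential_type_at_most :: "real \<Rightarrow> (complex \<Rightarrow> complex) \<Rightarrow> bool" where
  "exponential_type_at_most \<sigma> F \<longleftrightarrow>
     (\<forall>\<epsilon>>0. \<exists>C>0. \<forall>z. norm (F z) \<le> C * exp ((\<sigma> + \<epsilon>) * norm z))"

definition real_entire :: "(complex \<Rightarrow> complex) \<Rightarrow> bool" where
  "real_entire F \<longleftrightarrow> F holomorphic_on UNIV \<and> (\<forall>x::real. F (of_real x) \<in> \<real>)"

definition gaussian :: "real \<Rightarrow> complex \<Rightarrow> complex" where
  "gaussian lam z = exp (- of_real (pi * lam) * z\<^sup>2)"

text \<open>The sums over the integers converge absolutely. On the poles of the summands the formula
  does not give the intended value; \<^const>\<open>remove_sings\<close> replaces the value at every point by the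
  limit there, i.e. fills in the removable singularities at the half-integers.\<close>

definition minorant :: "real \<Rightarrow> complex \<Rightarrow> complex" where
  "minorant lam = remove_sings (\<lambda>z.
     (cos (of_real pi * z) / of_real pi)\<^sup>2 *
     ((\<Sum>\<^sub>\<infinity>m::int. gaussian lam (of_int m + 1/2) / (z - of_int m - 1/2)\<^sup>2) +
      (\<Sum>\<^sub>\<infinity>n::int. deriv (gaussian lam) (of_int n + 1/2) / (z - of_int n - 1/2))))"

text \<open>In this convention the alternating sign belongs to the function indexed by 2
  (many authors call it the fourth theta function), and the nome is
  \<open>q = exp (\<pi> \<i> \<tau>)\<close>.\<close>

definition theta2 :: "complex \<Rightarrow> complex \<Rightarrow> complex" where
  "theta2 v \<tau> = (\<Sum>\<^sub>\<infinity>n::int. (-1) powi n * exp (of_real pi * \<i> * \<tau>) powi (n\<^sup>2) *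
                             exp (2 * of_real pi * \<i> * (of_int n * v)))"

text \<open>The Lebesgue integral over the real line with values in the extended reals, as the integral
  of the positive part minus that of the negative part (\<^const>\<open>ennreal\<close> truncates negative
  numbers to zero). It is meaningful as soon as one of the two parts is finite.\<close>

definition ext_integral :: "(real \<Rightarrow> real) \<Rightarrow> ereal" where
  "ext_integral f = enn2ereal (\<integral>\<^sup>+x. ennreal (f x) \<partial>lborel) - enn2ereal (\<integral>\<^sup>+x. ennreal (- f x) \<partial>lborel)"

text \<open>At the points of interest the theta function is real, so that its real part may be used
  as the bound.\<close>

lemma theta2_imaginary_axis_real: "theta2 0 (\<i> * of_real t) \<in> \<real>"
proof -
  have "(-1) powi n * exp (of_real pi * \<i> * (\<i> * of_real t)) powi (n\<^sup>2) *
          exp (2 * of_real pi * \<i> * (of_int n * 0)) =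
        complex_of_real ((-1) powi n * exp (- pi * t) powi (n\<^sup>2))" for n :: int
  proof -
    have "of_real pi * \<i> * (\<i> * of_real t) = complex_of_real (- pi * t)"
      by (simp add: complex_eq_iff)
    then show ?thesis
      by (simp only: exp_of_real) simp
  qed
  then have "theta2 0 (\<i> * of_real t) =
      (\<Sum>\<^sub>\<infinity>n::int. complex_of_real ((-1) powi n * exp (- pi * t) powi (n\<^sup>2)))"
    unfolding theta2_def by (intro infsum_cong)
  then show ?thesis
    by (simp only: Reals_cnj_iff infsum_cnj [symmetric] complex_cnj_complex_of_real)
qed

end

theory Submission
  imports Defs "HOL-Probability.Probability"
begin

text \<open>
Write \<open>G\<close> for the Gaussian and \<open>L\<close> for the function that interpolates \<open>G\<close> to second order at the
  half-integers. The upper bound is Poisson summation: an integrable function \<open>F\<close> of exponential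
  type \<open>2 \<pi>\<close> has a Fourier transform supported in \<open>[-1, 1]\<close> and vanishing at both ends, so that the
  integral of \<open>F\<close> is the sum of \<open>F\<close> over the half-integers. That sum is at most the sum of \<open>G\<close>, which
  Poisson summation for the Gaussian turns into the theta value
  (\<open>half_int_gaussian_sum_eq_theta2\<close>).

  The summation formula is obtained from residues, with the kernel \<open>1 / (1 + exp (2 \<pi> \<i> z))\<close>, for
  functions that decay quadratically and grow strictly more slowly than \<open>exp (2 \<pi> \<bar>Im z\<bar>)\<close>. A general
  \<open>F\<close> is first contracted and multiplied by a squared sinc function. In the limit this yields, as
  in Fatou's lemma, that every partial sum of the nonnegative defects \<open>G - F\<close> at the half-integers is at
  most the sum of \<open>G\<close> minus the integral of \<open>F\<close> (\<open>half_int_majorant_defect_le\<close>). The argument needs \<open>F\<close>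
  to be bounded by a multiple of \<open>exp (2 \<pi> \<bar>Im z\<bar>)\<close>; this follows from the Phragmen-Lindelof
  principle, applied to a primitive of \<open>F\<close>, which is bounded on the real line because \<open>F\<close> is
  integrable.

  The function \<open>L\<close> decays quadratically, so that Poisson summation holds for it with equality and
  its integral is the extremal value. The main point is \<open>L \<le> G\<close>. For fixed \<open>x\<close>, the quotient
  \<open>L x / G x\<close>, divided by \<open>(cos (\<pi> x) / \<pi>)\<^sup>2\<close>, is a sum over the half-integers whose derivative with
  respect to the parameter \<open>\<lambda>\<close> collapses to \<open>2 \<pi> exp (\<pi> \<lambda> x\<^sup>2)\<close> times a number \<open>S \<lambda>\<close> that does not
  depend on \<open>x\<close>. Up to a positive factor \<open>S \<lambda>\<close> is the derivative of \<open>\<surd>\<lambda> \<theta> \<lambda>\<close>, where \<open>\<theta> \<lambda>\<close>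
  is the sum of the Gaussian over the half-integers, and Poisson summation turns \<open>\<surd>\<lambda> \<theta> \<lambda>\<close>
  into an alternating theta series in \<open>q = exp (- \<pi> / \<lambda>)\<close> that decreases in \<open>q\<close>
  (\<open>half_int_theta_defect_nonpos\<close>). So the sum is nonincreasing in \<open>\<lambda>\<close>, and its limit for \<open>\<lambda> \<rightarrow> 0\<close> is
  the partial fraction series of \<open>(\<pi> / cos (\<pi> x))\<^sup>2\<close>, which gives \<open>L x / G x \<le> 1\<close>.

  If \<open>F\<close> attains the bound, all defects vanish, so \<open>F = G\<close> at the half-integers; since \<open>F \<le> G\<close>, the
  derivatives agree there as well. Hence \<open>F - L\<close> has double zeros at all zeros of \<open>cos (\<pi> z)\<close>, the
  quotient of \<open>F - L\<close> by \<open>cos (\<pi> z)\<^sup>2\<close> is entire and bounded, and by Liouville's theorem it is a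
  constant (\<open>multiple_of_cos_squared\<close>). The constant is zero because \<open>F\<close> and \<open>L\<close> have the same integral.
\<close>

section \<open>The Phragmen-Lindelof principle\<close>

text \<open>
  In the sector \<open>\<bar>arg p\<bar> \<le> \<pi> / 4\<close> the power \<open>p\<close> to the \<open>3 / 2\<close>, written \<open>p * csqrt p\<close>, has an argument
  of at most \<open>3 \<pi> / 8\<close>, so that its real part is comparable with its modulus. It serves as a
  damping exponent of order strictly between 1 and 2.
\<close>

lemma Re_mult_csqrt_lower_bound:
  fixes p :: complex
  assumes "Re p > 0" and "\<bar>Im p\<bar> \<le> Re p"
  shows "Re (p * csqrt p) \<ge> norm p * sqrt (norm p) / 16"
proof -
  define s where "s = csqrt p"
  define a b where "a = Re s" and "b = \<bar>Im s\<bar>"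
  have p: "p = s^2" by (simp add: s_def)
  have Rep: "Re p = a^2 - b^2" by (simp add: p a_def b_def power2_eq_square)
  have Imp: "\<bar>Im p\<bar> = 2 * \<bar>a\<bar> * b" by (simp add: p a_def b_def power2_eq_square abs_mult)
  have a0: "a \<ge> 0" using csqrt_principal[of p] by (auto simp: a_def s_def)
  have b0: "b \<ge> 0" by (simp add: b_def)
  have apos: "a > 0"
    using a0 assms(1) Rep by (cases "a = 0") auto
  have "2 * a * b \<le> a^2 - b^2" using assms(2) Rep Imp apos by simp
  hence "2 * b * a \<le> a * a" using zero_le_square[of b] by (simp only: power2_eq_square mult_ac)
  hence ba: "b \<le> a / 2" using apos by simp
  have ns: "norm s \<le> 3/2 * a"
    using cmod_le[of s] ba a0 by (simp add: a_def b_def)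
  have "norm p * sqrt (norm p) = norm s ^ 3"
    by (simp add: p norm_power power3_eq_cube) (simp add: power2_eq_square)
  also have "\<dots> \<le> (3/2 * a)^3" by (intro power_mono ns) simp
  also have "\<dots> = 27/8 * a^3" by (simp add: power_mult_distrib eval_nat_numeral)
  finally have 1: "norm p * sqrt (norm p) \<le> 27/8 * a^3" .
  have "b^2 \<le> (a/2)^2" using ba b0 by (intro power_mono) auto
  hence b2: "3 * b^2 \<le> 3/4 * a^2" by (simp add: power_divide)
  have "Re (p * csqrt p) = Re (s^3)"
    unfolding s_def[symmetric] by (subst p) (simp add: power3_eq_cube power2_eq_square mult.assoc)
  also have "\<dots> = a * (a^2 - 3 * b^2)"
    by (simp add: a_def b_def power3_eq_cube power2_eq_square algebra_simps)
  also have "\<dots> \<ge> a * (a^2 / 4)"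
    using b2 a0 by (intro mult_left_mono) auto
  finally have "Re (p * csqrt p) \<ge> a^3 / 4" by (simp add: eval_nat_numeral)
  moreover have "a^3 \<ge> 0" using a0 by simp
  ultimately show ?thesis using 1 by linarith
qed

lemma maximum_modulus_box:
  assumes hol: "g holomorphic_on cbox a b" and z: "z \<in> box a b"
    and le: "\<And>w. w \<in> cbox a b \<Longrightarrow> w \<notin> box a b \<Longrightarrow> norm (g w) \<le> B"
  shows "norm (g z) \<le> B"
proof -
  have closure: "closure (box a b) = cbox a b" using z by (intro closure_box) auto
  show ?thesis
  proof (rule maximum_modulus_frontier[of g "box a b"])
    show "g holomorphic_on interior (box a b)"
      using hol by (rule holomorphic_on_subset) (use box_subset_cbox in \<open>simp add: interior_open open_box\<close>)
    show "continuous_on (closure (box a b)) g"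
      unfolding closure by (rule holomorphic_on_imp_continuous_on[OF hol])
    show "norm (g w) \<le> B" if "w \<in> frontier (box a b)" for w
      using that le[of w] by (simp add: frontier_def closure interior_open open_box)
  qed (use z bounded_box in auto)
qed

text \<open>
  A quadrant has opening \<open>\<pi> / 2\<close>, so that growth of order less than 2 in its interior is harmless: with
  the quadrant rotated onto the sector \<open>\<bar>arg \<zeta>\<bar> \<le> \<pi> / 4\<close>, the factor \<open>exp (- d \<zeta> csqrt \<zeta>)\<close> beats
  \<open>exp (c \<bar>z\<bar>)\<close> on large squares and costs nothing on the edges. The maximum principle applies, and
  then \<open>d\<close> tends to 0.
\<close>

lemma phragmen_lindelof_quadrant:
  fixes u :: "complex \<Rightarrow> complex"
  assumes hol: "u holomorphic_on UNIV"
    and growth: "\<And>z. norm (u z) \<le> C * exp (c * norm z)" and "c \<ge> 0"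
    and real_axis: "\<And>x. x \<ge> 0 \<Longrightarrow> norm (u (of_real x)) \<le> K"
    and imag_axis: "\<And>y. y \<ge> 0 \<Longrightarrow> norm (u (\<i> * of_real y)) \<le> K"
    and z: "Re z \<ge> 0" "Im z \<ge> 0"
  shows "norm (u z) \<le> K"
proof (cases "Re z = 0 \<or> Im z = 0")
  case True
  moreover have "z = \<i> * of_real (Im z)" if "Re z = 0" using that by (simp add: complex_eq_iff)
  moreover have "z = of_real (Re z)" if "Im z = 0" using that by (simp add: complex_eq_iff)
  ultimately show ?thesis using z real_axis imag_axis by metis
next
  case False
  hence zpos: "Re z > 0" "Im z > 0" using z by auto
  have K0: "K \<ge> 0" using order_trans[OF norm_ge_zero real_axis[of 0]] by simp
  have C0: "C \<ge> 0" using order_trans[OF norm_ge_zero growth[of 0]] by simp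
  \<comment> \<open>Rotation by \<open>- \<pi> / 4\<close> centres the quadrant on the positive axis; adding 1 keeps it away from the
    branch point of the square root.\<close>
  define p :: "complex \<Rightarrow> complex" where "p = (\<lambda>z. 1 + cis (- pi / 4) * z)"
  have Rep: "Re (p w) = 1 + (Re w + Im w) * (sqrt 2 / 2)"
    and Imp: "Im (p w) = (Im w - Re w) * (sqrt 2 / 2)" for w
  proof -
    have "cis (- pi / 4) = Complex (sqrt 2 / 2) (- (sqrt 2 / 2))"
      by (simp add: complex_eq_iff cos_45 sin_45)
    thus "Re (p w) = 1 + (Re w + Im w) * (sqrt 2 / 2)" "Im (p w) = (Im w - Re w) * (sqrt 2 / 2)"
      unfolding p_def by (simp_all only: complex.sel plus_complex.sel times_complex.sel one_complex.sel) (simp_all only: algebra_simps)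
  qed
  have pq: "Re (p w) > 0" "\<bar>Im (p w)\<bar> \<le> Re (p w)" "norm (p w) \<ge> norm w" if "Re w \<ge> 0" "Im w \<ge> 0" for w
  proof -
    have nonneg: "(Re w + Im w) * (sqrt 2 / 2) \<ge> 0" using that by simp
    thus "Re (p w) > 0" unfolding Rep by linarith
    have "\<bar>Im w - Re w\<bar> * (sqrt 2 / 2) \<le> (Re w + Im w) * (sqrt 2 / 2)"
      using that by (intro mult_right_mono) auto
    thus "\<bar>Im (p w)\<bar> \<le> Re (p w)" unfolding Rep Imp abs_mult by (simp only: abs_of_nonneg[of "sqrt 2 / 2"] divide_nonneg_pos real_sqrt_ge_zero)
    define v where "v = cis (- pi / 4) * w"
    have pv: "p w = 1 + v" by (simp only: p_def v_def)
    have n: "norm v = norm w" by (simp add: v_def norm_mult)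
    have "(norm (1 + v))^2 = 1 + 2 * Re v + (norm v)^2"
      unfolding cmod_power2 by (simp add: power2_eq_square algebra_simps)
    moreover have "Re v = (Re w + Im w) * (sqrt 2 / 2)" using Rep[of w] pv by simp
    moreover note nonneg
    ultimately have "(norm w)^2 \<le> (norm (p w))^2" unfolding pv n by linarith
    thus "norm (p w) \<ge> norm w" by (rule power2_le_imp_le) simp
  qed
  have main: "norm (u z) \<le> (K + d) * exp (d * Re (p z * csqrt (p z)))" if d: "d > 0" for d
  proof -
    define g where "g = (\<lambda>w. u w * exp (- of_real d * (p w * csqrt (p w))))"
    have ng: "norm (g w) = norm (u w) * exp (- d * Re (p w * csqrt (p w)))" for w
    proof -
      have "Re (- of_real d * v) = - d * Re v" for v by simp
      thus ?thesis unfolding g_def norm_mult norm_exp_eq_Re by (simp only:)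
    qed
    have "eventually (\<lambda>R. d * sqrt R / 16 \<ge> c + 1 \<and> C * exp (- R) \<le> d \<and> R > Re z \<and> R > Im z \<and> R > 0) at_top"
    proof (intro eventually_conj)
      have "filterlim (\<lambda>R. d * sqrt R / 16) at_top at_top" using d by real_asymp
      thus "eventually (\<lambda>R. d * sqrt R / 16 \<ge> c + 1) at_top" unfolding filterlim_at_top by blast
      have "((\<lambda>R. C * exp (- R)) \<longlongrightarrow> 0) at_top" by real_asymp
      thus "eventually (\<lambda>R. C * exp (- R) \<le> d) at_top" using d
        by (metis (mono_tags, lifting) eventually_mono less_imp_le order_tendstoD(2))
    qed (auto simp: eventually_gt_at_top)
    then obtain R where R: "d * sqrt R / 16 \<ge> c + 1" "C * exp (- R) \<le> d" "R > Re z" "R > Im z" "R > 0"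
      using eventually_happens'[OF trivial_limit_at_top_linorder] by blast
    have holg: "g holomorphic_on {w. Re (p w) > 0}"
    proof -
      have "p w \<notin> \<real>\<^sub>\<le>\<^sub>0" if "Re (p w) > 0" for w using that by (auto simp: complex_nonpos_Reals_iff)
      moreover have "p holomorphic_on A" for A unfolding p_def by (intro holomorphic_intros)
      moreover have "u holomorphic_on A" for A using hol by (rule holomorphic_on_subset) auto
      ultimately show ?thesis unfolding g_def
        by (intro holomorphic_intros) auto
    qed
    have "norm (g z) \<le> K + d"
    proof (rule maximum_modulus_box[of g 0 "Complex R R"])
      show "g holomorphic_on cbox 0 (Complex R R)"
        using holg by (rule holomorphic_on_subset) (use pq in \<open>auto simp: in_cbox_complex_iff\<close>)
      show "z \<in> box 0 (Complex R R)" using R zpos by (simp add: in_box_complex_iff)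
      fix w assume w: "w \<in> cbox 0 (Complex R R)" "w \<notin> box 0 (Complex R R)"
      have q: "0 \<le> Re w \<and> Re w \<le> R \<and> 0 \<le> Im w \<and> Im w \<le> R" using w(1) by (simp add: in_cbox_complex_iff)
      have sq: "Re (p w * csqrt (p w)) \<ge> norm w * sqrt (norm w) / 16"
      proof -
        have "norm w * sqrt (norm w) / 16 \<le> norm (p w) * sqrt (norm (p w)) / 16"
          using pq(3)[of w] q by (intro divide_right_mono mult_mono) auto
        also have "\<dots> \<le> Re (p w * csqrt (p w))"
          using pq[of w] q by (intro Re_mult_csqrt_lower_bound) auto
        finally show ?thesis .
      qed
      have sq0: "Re (p w * csqrt (p w)) \<ge> 0" using sq by (rule order_trans[rotated]) simp
      consider "Re w = 0" | "Im w = 0" | "norm w \<ge> R"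
      proof -
        have "Re w = R \<or> Im w = R \<or> Re w = 0 \<or> Im w = 0" using q w(2) by (auto simp: in_box_complex_iff)
        hence "Re w = 0 \<or> Im w = 0 \<or> R \<le> norm w" using abs_Re_le_cmod[of w] abs_Im_le_cmod[of w] by linarith
        thus ?thesis using that by blast
      qed
      thus "norm (g w) \<le> K + d"
      proof cases
        case 1
        hence "w = \<i> * of_real (Im w)" by (simp add: complex_eq_iff)
        hence "norm (u w) \<le> K" using imag_axis q by metis
        moreover have "exp (- d * Re (p w * csqrt (p w))) \<le> 1" using sq0 d by simp
        ultimately have "norm (g w) \<le> K * 1" unfolding ng using K0 by (intro mult_mono) auto
        thus ?thesis using d by simp
      next
        case 2
        hence "w = of_real (Re w)" by (simp add: complex_eq_iff)
        hence "norm (u w) \<le> K" using real_axis q by metis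
        moreover have "exp (- d * Re (p w * csqrt (p w))) \<le> 1" using sq0 d by simp
        ultimately have "norm (g w) \<le> K * 1" unfolding ng using K0 by (intro mult_mono) auto
        thus ?thesis using d by simp
      next
        case 3
        have "d * Re (p w * csqrt (p w)) \<ge> d * (norm w * sqrt (norm w) / 16)"
          using sq d by (intro mult_left_mono) auto
        also have "d * (norm w * sqrt (norm w) / 16) = norm w * (d * sqrt (norm w) / 16)" by simp
        also have "norm w * (d * sqrt (norm w) / 16) \<ge> norm w * (d * sqrt R / 16)"
          using 3 d by (intro mult_left_mono divide_right_mono) auto
        also have "norm w * (d * sqrt R / 16) \<ge> norm w * (c + 1)"
          using R by (intro mult_left_mono) auto
        finally have A: "d * Re (p w * csqrt (p w)) \<ge> norm w * (c + 1)" by simp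
        have "norm (g w) \<le> (C * exp (c * norm w)) * exp (- d * Re (p w * csqrt (p w)))"
          unfolding ng by (intro mult_right_mono growth) auto
        also have "\<dots> = C * exp (c * norm w - d * Re (p w * csqrt (p w)))"
          by (simp add: exp_add[symmetric])
        also have "\<dots> \<le> C * exp (- R)"
          using A 3 C0 by (intro mult_left_mono) (auto simp: algebra_simps)
        finally show ?thesis using R(2) K0 by linarith
      qed
    qed
    hence "norm (u z) * exp (- (d * Re (p z * csqrt (p z)))) \<le> K + d"
      unfolding ng by (simp only: mult_minus_left)
    thus ?thesis unfolding exp_minus by (simp only: divide_inverse[symmetric] pos_divide_le_eq[OF exp_gt_zero])
  qed
  define A where "A = Re (p z * csqrt (p z))"
  have "((\<lambda>d. (K + d) * exp (d * A)) \<longlongrightarrow> (K + 0) * exp (0 * A)) (at_right 0)"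
    by (intro tendsto_intros)
  moreover have "eventually (\<lambda>d. norm (u z) \<le> (K + d) * exp (d * A)) (at_right 0)"
    by (rule eventually_at_rightI[of 0 1]) (use main in \<open>simp_all add: A_def\<close>)
  ultimately have "norm (u z) \<le> (K + 0) * exp (0 * A)"
    by (rule tendsto_lowerbound) simp
  thus ?thesis by simp
qed

text \<open>
  The modulus of \<open>1 - \<i> d z\<close> is at least 1 on the closed half-plane and tends to infinity. Division by
  it makes a bounded function small on the far sides of large rectangles without raising its values
  on the real line, which replaces an arbitrary bound \<open>K\<close> by the bound \<open>M\<close> on the real line.
\<close>

lemma maximum_principle_upper_half_plane:
  fixes h :: "complex \<Rightarrow> complex"
  assumes hol: "h holomorphic_on UNIV"
    and bounded: "\<And>z. Im z \<ge> 0 \<Longrightarrow> norm (h z) \<le> K"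
    and real_axis: "\<And>x. norm (h (of_real x)) \<le> M"
    and z: "Im z \<ge> 0"
  shows "norm (h z) \<le> M"
proof (cases "Im z = 0")
  case True
  hence "z = of_real (Re z)" by (simp add: complex_eq_iff)
  thus ?thesis using real_axis by metis
next
  case False
  hence zpos: "Im z > 0" using z by auto
  have M0: "M \<ge> 0" using order_trans[OF norm_ge_zero real_axis[of 0]] by simp
  have K0: "K \<ge> 0" using order_trans[OF norm_ge_zero bounded[of 0]] by simp
  have main: "norm (h z) \<le> (M + d) * norm (1 - \<i> * of_real d * z)" if d: "d > 0" for d
  proof -
    have nq: "norm (1 - \<i> * of_real d * w) \<ge> 1" "norm (1 - \<i> * of_real d * w) \<ge> d * norm w"
      if "Im w \<ge> 0" for w
    proof -
      have "(norm (1 - \<i> * of_real d * w))^2 = 1 + 2 * d * Im w + (d * norm w)^2"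
        unfolding cmod_power2 power_mult_distrib by (simp add: power2_eq_square algebra_simps)
      moreover have "d * Im w \<ge> 0" using that d by simp
      moreover have "(d * norm w)^2 \<ge> 0" by simp
      ultimately have "1^2 \<le> (norm (1 - \<i> * of_real d * w))^2 \<and> (d * norm w)^2 \<le> (norm (1 - \<i> * of_real d * w))^2"
        by simp
      thus "norm (1 - \<i> * of_real d * w) \<ge> 1" "norm (1 - \<i> * of_real d * w) \<ge> d * norm w"
        using d by (auto intro: power2_le_imp_le)
    qed
    define g where "g = (\<lambda>w. h w / (1 - \<i> * of_real d * w))"
    define R where "R = max (norm z + 1) (K / (d * d))"
    have R: "R > norm z" "R * (d * d) \<ge> K" "R > 0"
    proof -
      show "R > norm z" unfolding R_def by linarith
      have "R \<ge> K / (d * d)" unfolding R_def by linarith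
      thus "R * (d * d) \<ge> K" unfolding pos_divide_le_eq[OF mult_pos_pos[OF d d]] .
      show "R > 0" unfolding R_def using norm_ge_zero[of z] by linarith
    qed
    have holg: "g holomorphic_on {w. Im w \<ge> 0}"
    proof -
      have "1 - \<i> * of_real d * w \<noteq> 0" if "Im w \<ge> 0" for w using nq(1)[OF that] by auto
      thus ?thesis unfolding g_def
        by (intro holomorphic_intros holomorphic_on_subset[OF hol]) auto
    qed
    have "norm (g z) \<le> M + d"
    proof (rule maximum_modulus_box[of g "Complex (- R) 0" "Complex R R"])
      show "g holomorphic_on cbox (Complex (- R) 0) (Complex R R)"
        using holg by (rule holomorphic_on_subset) (auto simp: in_cbox_complex_iff)
      show "z \<in> box (Complex (- R) 0) (Complex R R)"
        using R(1) zpos abs_Re_le_cmod[of z] abs_Im_le_cmod[of z] by (auto simp: in_box_complex_iff abs_less_iff)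
      fix w assume w: "w \<in> cbox (Complex (- R) 0) (Complex R R)" "w \<notin> box (Complex (- R) 0) (Complex R R)"
      have q: "- R \<le> Re w \<and> Re w \<le> R \<and> 0 \<le> Im w \<and> Im w \<le> R" using w(1) by (simp add: in_cbox_complex_iff)
      have ng: "norm (g w) = norm (h w) / norm (1 - \<i> * of_real d * w)"
        by (simp add: g_def norm_divide)
      consider "Im w = 0" | "norm w \<ge> R"
      proof -
        have "Re w = R \<or> Im w = R \<or> Re w = - R \<or> Im w = 0" using q w(2) by (auto simp: in_box_complex_iff)
        hence "Im w = 0 \<or> R \<le> norm w" using abs_Re_le_cmod[of w] abs_Im_le_cmod[of w] by linarith
        thus ?thesis using that by blast
      qed
      thus "norm (g w) \<le> M + d"
      proof cases
        case 1
        hence "w = of_real (Re w)" by (simp add: complex_eq_iff)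
        hence "norm (h w) \<le> M" using real_axis by metis
        hence "norm (g w) \<le> M / 1" unfolding ng using nq(1)[of w] q M0 by (intro frac_le) auto
        thus ?thesis using d by simp
      next
        case 2
        have "norm (g w) \<le> K / (d * R)"
          unfolding ng
        proof (rule frac_le)
          show "d * R \<le> norm (1 - \<i> * of_real d * w)"
            using nq(2)[of w] mult_left_mono[OF 2, of d] q d by linarith
          show "0 < d * R" using d R(3) by (rule mult_pos_pos)
          show "norm (h w) \<le> K" using q by (intro bounded) simp
        qed (fact K0)
        also have "\<dots> \<le> d" unfolding pos_divide_le_eq[OF mult_pos_pos[OF d R(3)]] using R(2) by (simp only: mult_ac)
        finally show ?thesis using M0 by linarith
      qed
    qed
    moreover have pos: "norm (1 - \<i> * of_real d * z) > 0" using nq(1)[OF z] by linarith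
    ultimately show ?thesis unfolding g_def norm_divide by (simp only: pos_divide_le_eq[OF pos])
  qed
  have "((\<lambda>d. (M + d) * norm (1 - \<i> * of_real d * z)) \<longlongrightarrow> (M + 0) * norm (1 - \<i> * of_real 0 * z)) (at_right 0)"
    by (intro tendsto_intros)
  moreover have "eventually (\<lambda>d. norm (h z) \<le> (M + d) * norm (1 - \<i> * of_real d * z)) (at_right 0)"
    by (rule eventually_at_rightI[of 0 1]) (use main in auto)
  ultimately have "norm (h z) \<le> (M + 0) * norm (1 - \<i> * of_real 0 * z)"
    by (rule tendsto_lowerbound) simp
  thus ?thesis by simp
qed

text \<open>
  The factor \<open>exp (\<i> (\<sigma> + e) z)\<close> compensates the growth along the imaginary axis, so that the result for
  quadrants applies to both halves of the half-plane. It leaves a bound that depends on \<open>e\<close>; the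
  maximum principle for the half-plane removes this dependence, and \<open>e\<close> can tend to 0.
\<close>

lemma phragmen_lindelof_upper_half_plane:
  assumes hol: "F holomorphic_on UNIV"
    and type: "exponential_type_at_most \<sigma> F" and "\<sigma> \<ge> 0"
    and real_axis: "\<And>x. norm (F (of_real x)) \<le> M"
    and z: "Im z \<ge> 0"
  shows "norm (F z) \<le> M * exp (\<sigma> * Im z)"
proof -
  have main: "norm (F z) \<le> M * exp ((\<sigma> + e) * Im z)" if e: "e > 0" for e
  proof -
    obtain C where C: "C > 0" "\<And>z. norm (F z) \<le> C * exp ((\<sigma> + e) * norm z)"
      using type e unfolding exponential_type_at_most_def by blast
    define h where "h = (\<lambda>z. F z * exp (\<i> * of_real (\<sigma> + e) * z))"
    have nh: "norm (h w) = norm (F w) * exp (- (\<sigma> + e) * Im w)" for w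
      by (simp add: h_def norm_mult algebra_simps)
    have holh: "h holomorphic_on UNIV" unfolding h_def by (intro holomorphic_intros hol)
    define c where "c = 2 * (\<sigma> + e)"
    have c0: "c \<ge> 0" using assms(3) e by (simp add: c_def)
    have growth: "norm (h w) \<le> C * exp (c * norm w)" for w
    proof -
      have "- (\<sigma> + e) * Im w \<le> (\<sigma> + e) * norm w"
        using abs_Im_le_cmod[of w] assms(3) e
        by (metis abs_le_iff add_nonneg_pos less_eq_real_def minus_mult_commute mult_left_mono order_trans)
      hence "norm (h w) \<le> (C * exp ((\<sigma> + e) * norm w)) * exp ((\<sigma> + e) * norm w)"
        unfolding nh using C by (intro mult_mono) auto
      also have "\<dots> = C * exp (c * norm w)" by (simp add: c_def exp_add[symmetric] algebra_simps)
      finally show ?thesis .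
    qed
    have re: "norm (h (of_real x)) \<le> max C M" for x using real_axis[of x] by (simp add: nh)
    have im: "norm (h (\<i> * of_real y)) \<le> max C M" if "y \<ge> 0" for y
    proof -
      have "norm (h (\<i> * of_real y)) \<le> (C * exp ((\<sigma> + e) * y)) * exp (- (\<sigma> + e) * y)"
        unfolding nh using C(2)[of "\<i> * of_real y"] that C(1) by (intro mult_mono) (auto simp: norm_mult)
      also have "\<dots> = C * exp ((\<sigma> + e) * y + - (\<sigma> + e) * y)" by (simp only: exp_add mult.assoc)
      also have "\<dots> = C" by (simp only: mult_minus_left add.right_inverse exp_zero mult_1_right)
      finally show ?thesis by simp
    qed
    have bdd: "norm (h w) \<le> max C M" if "Im w \<ge> 0" for w
    proof (cases "Re w \<ge> 0")
      case True
      show ?thesis by (rule phragmen_lindelof_quadrant[OF holh growth c0 re im True that])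
    next
      case False
      \<comment> \<open>The second quadrant is the image of the first one under multiplication by \<open>\<i>\<close>.\<close>
      define u where "u = (\<lambda>w. h (\<i> * w))"
      have "norm (u (- \<i> * w)) \<le> max C M"
      proof (rule phragmen_lindelof_quadrant[where u = u and z = "- \<i> * w" and C = C and c = c])
        have "(h \<circ> (\<lambda>w. \<i> * w)) holomorphic_on UNIV"
          by (rule holomorphic_on_compose_gen[where t = UNIV]) (auto intro!: holomorphic_intros holh)
        thus "u holomorphic_on UNIV" by (simp add: u_def o_def)
      next
        show "norm (u w) \<le> C * exp (c * norm w)" for w
          using growth[of "\<i> * w"] by (simp add: u_def norm_mult)
        show "norm (u (of_real x)) \<le> max C M" if "x \<ge> 0" for x using im[OF that] by (simp add: u_def)
        show "norm (u (\<i> * of_real y)) \<le> max C M" for y using re[of "- y"] by (simp add: u_def)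
      qed (use c0 that False in auto)
      thus ?thesis by (simp add: u_def)
    qed
    have "norm (h z) \<le> M"
      by (rule maximum_principle_upper_half_plane[where h = h, OF holh bdd _ z]) (use real_axis in \<open>simp_all add: nh\<close>)
    thus ?thesis unfolding nh
      by (simp only: mult_minus_left exp_minus divide_inverse[symmetric] pos_divide_le_eq[OF exp_gt_zero])
  qed
  have "((\<lambda>e. M * exp ((\<sigma> + e) * Im z)) \<longlongrightarrow> M * exp ((\<sigma> + 0) * Im z)) (at_right 0)"
    by (intro tendsto_intros)
  moreover have "eventually (\<lambda>e. norm (F z) \<le> M * exp ((\<sigma> + e) * Im z)) (at_right 0)"
    by (rule eventually_at_rightI[of 0 1]) (use main in auto)
  ultimately have "norm (F z) \<le> M * exp ((\<sigma> + 0) * Im z)"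
    by (rule tendsto_lowerbound) simp
  thus ?thesis by simp
qed

theorem phragmen_lindelof_exponential_type:
  assumes hol: "F holomorphic_on UNIV"
    and type: "exponential_type_at_most \<sigma> F" and "\<sigma> \<ge> 0"
    and real_axis: "\<And>x. norm (F (of_real x)) \<le> M"
  shows "norm (F z) \<le> M * exp (\<sigma> * \<bar>Im z\<bar>)"
proof (cases "Im z \<ge> 0")
  case True
  thus ?thesis using phragmen_lindelof_upper_half_plane[OF assms True] by simp
next
  case False
  have "norm ((\<lambda>w. F (- w)) (- z)) \<le> M * exp (\<sigma> * Im (- z))"
  proof (rule phragmen_lindelof_upper_half_plane[where F = "\<lambda>w. F (- w)" and z = "- z"])
    have "(F \<circ> uminus) holomorphic_on UNIV"
      by (rule holomorphic_on_compose_gen[where t = UNIV]) (auto intro!: holomorphic_intros hol)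
    thus "(\<lambda>w. F (- w)) holomorphic_on UNIV" by (simp add: o_def)
    show "exponential_type_at_most \<sigma> (\<lambda>w. F (- w))"
      using type unfolding exponential_type_at_most_def by (metis norm_minus_cancel)
    show "norm (F (- of_real x)) \<le> M" for x using real_axis[of "- x"] by simp
  qed (use assms False in auto)
  thus ?thesis using False by simp
qed

text \<open>
  The primitive of \<open>F\<close> that vanishes at 0 has the same exponential type and is bounded on the real line
  by the integral of \<open>\<bar>F\<bar>\<close>. The Phragmen-Lindelof principle applies to it, and Cauchy's estimate on
  discs of radius 1 carries the bound over to its derivative \<open>F\<close>.
\<close>

lemma integrable_real_axis_imp_bounded:
  assumes hol: "F holomorphic_on UNIV"
    and type: "exponential_type_at_most \<sigma> F" and "\<sigma> \<ge> 0"
    and int: "integrable lborel (\<lambda>x. F (of_real x))"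
  obtains M where "\<And>z. norm (F z) \<le> M * exp (\<sigma> * \<bar>Im z\<bar>)"
proof -
  define M where "M = integral\<^sup>L lborel (\<lambda>x. norm (F (of_real x)))"
  obtain g where g: "\<And>x. (g has_field_derivative F x) (at x)"
    using holomorphic_convex_primitive'[OF convex_UNIV open_UNIV hol] by auto
  define P where "P = (\<lambda>z. g z - g 0)"
  have P: "(P has_field_derivative F x) (at x)" for x
    unfolding P_def by (auto intro!: derivative_eq_intros g)
  have P': "(P has_field_derivative F x) (at x within A)" for x A
    using P by (rule has_field_derivative_at_within)
  have P0: "P 0 = 0" by (simp add: P_def)
  have holP: "P holomorphic_on UNIV"
    using P' by (auto simp: holomorphic_on_def field_differentiable_def)
  have seg: "norm (P z) \<le> B * norm z" if "\<And>w. norm w \<le> norm z \<Longrightarrow> norm (F w) \<le> B" for z B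
  proof -
    have "norm (P z - P 0) \<le> B * norm (z - 0)"
      by (rule field_differentiable_bound[of "cball 0 (norm z)" P F B]) (use that P' in auto)
    thus ?thesis by (simp add: P0)
  qed
  have typeP: "exponential_type_at_most \<sigma> P"
    unfolding exponential_type_at_most_def
  proof (intro allI impI)
    fix e :: real assume e: "e > 0"
    obtain C where C: "C > 0" "\<And>z. norm (F z) \<le> C * exp ((\<sigma> + e / 2) * norm z)"
      using type e unfolding exponential_type_at_most_def by (metis half_gt_zero)
    have "norm (P z) \<le> (2 * C / e) * exp ((\<sigma> + e) * norm z)" for z
    proof -
      have "norm (P z) \<le> (C * exp ((\<sigma> + e / 2) * norm z)) * norm z"
      proof (rule seg)
        fix w :: complex assume "norm w \<le> norm z"
        hence "(\<sigma> + e / 2) * norm w \<le> (\<sigma> + e / 2) * norm z" using assms(3) e by (intro mult_left_mono) auto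
        hence "C * exp ((\<sigma> + e / 2) * norm w) \<le> C * exp ((\<sigma> + e / 2) * norm z)" using C(1) by simp
        thus "norm (F w) \<le> C * exp ((\<sigma> + e / 2) * norm z)" using C(2)[of w] by linarith
      qed
      also have "\<dots> \<le> (C * exp ((\<sigma> + e / 2) * norm z)) * ((2 / e) * exp (e / 2 * norm z))"
      proof (rule mult_left_mono)
        have "e / 2 * norm z \<le> exp (e / 2 * norm z)" using exp_ge_add_one_self[of "e / 2 * norm z"] by linarith
        thus "norm z \<le> (2 / e) * exp (e / 2 * norm z)" using e by (simp add: field_simps)
      qed (use C(1) in simp)
      also have "\<dots> = (2 * C / e) * (exp ((\<sigma> + e / 2) * norm z) * exp (e / 2 * norm z))" by simp
      also have "exp ((\<sigma> + e / 2) * norm z) * exp (e / 2 * norm z) = exp ((\<sigma> + e) * norm z)"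
        by (simp add: exp_add[symmetric] algebra_simps)
      finally show ?thesis .
    qed
    moreover have "2 * C / e > 0" using C e by simp
    ultimately show "\<exists>C>0. \<forall>z. norm (P z) \<le> C * exp ((\<sigma> + e) * norm z)" by blast
  qed
  have realP: "norm (P (of_real x)) \<le> M" for x
  proof -
    have vd: "((\<lambda>x. P (of_real x)) has_vector_derivative F (of_real x)) (at x within A)" for x A
      by (rule has_vector_derivative_real_field[OF P])
    have contF: "continuous_on A (\<lambda>x::real. F (of_real x))" for A
      by (rule continuous_on_compose2[of UNIV F]) (auto intro!: continuous_intros holomorphic_on_imp_continuous_on hol)
    have fin: "norm (LBINT x:{a..b}. F (of_real x)) \<le> M" for a b
    proof -
      have "norm (LBINT x:{a..b}. F (of_real x)) \<le> (LBINT x:{a..b}. norm (F (of_real x)))"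
        unfolding set_lebesgue_integral_def by (rule order_trans[OF integral_norm_bound]) simp
      also have "\<dots> \<le> M" unfolding M_def set_lebesgue_integral_def
      proof (rule integral_mono)
        show "integrable lborel (\<lambda>x. indicat_real {a..b} x *\<^sub>R norm (F (of_real x)))"
          by (rule integrable_mult_indicator) (use int in auto)
      qed (use int in \<open>auto simp: indicator_def\<close>)
      finally show ?thesis .
    qed
    have ftc: "(LBINT x:{a..b}. F (of_real x)) = P (of_real b) - P (of_real a)" if "a \<le> b" for a b
      using integral_FTC_atLeastAtMost[OF that, of "\<lambda>x. P (of_real x)" "\<lambda>x. F (of_real x)"] vd contF
      by (simp add: set_lebesgue_integral_def)
    show ?thesis
    proof (cases "x \<ge> 0")
      case True
      thus ?thesis using fin[of 0 x] ftc[OF True] by (simp add: P0)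
    next
      case False
      thus ?thesis using fin[of x 0] ftc[of x 0] by (simp add: P0)
    qed
  qed
  have boundP: "norm (P z) \<le> M * exp (\<sigma> * \<bar>Im z\<bar>)" for z
    by (rule phragmen_lindelof_exponential_type[OF holP typeP assms(3) realP])
  have M0: "M \<ge> 0" by (simp add: M_def)
  have "norm (F z) \<le> (M * exp \<sigma>) * exp (\<sigma> * \<bar>Im z\<bar>)" for z
  proof -
    define B where "B = M * exp (\<sigma> * (\<bar>Im z\<bar> + 1))"
    have "norm ((deriv ^^ 1) P z) \<le> fact 1 * B / 1 ^ 1"
    proof (rule Cauchy_inequality)
      show "P holomorphic_on ball z 1" "continuous_on (cball z 1) P"
        using holP by (auto intro: holomorphic_on_subset holomorphic_on_imp_continuous_on)
      fix w assume w: "norm (z - w) = 1"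
      have "\<bar>Im w\<bar> \<le> \<bar>Im z\<bar> + 1" using abs_Im_le_cmod[of "z - w"] w by simp
      hence "\<sigma> * \<bar>Im w\<bar> \<le> \<sigma> * (\<bar>Im z\<bar> + 1)" using assms(3) by (rule mult_left_mono)
      hence "M * exp (\<sigma> * \<bar>Im w\<bar>) \<le> B" unfolding B_def using M0 by (intro mult_left_mono) auto
      thus "norm (P w) \<le> B" using boundP[of w] by linarith
    qed simp
    moreover have "deriv P z = F z" using P by (rule DERIV_imp_deriv)
    ultimately have "norm (F z) \<le> B" by simp
    also have "B = (M * exp \<sigma>) * exp (\<sigma> * \<bar>Im z\<bar>)" by (simp add: B_def exp_add[symmetric] algebra_simps)
    finally show ?thesis .
  qed
  thus ?thesis using that by blast
qed

section \<open>The normalized sinc function\<close>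

lemma norm_cos_le_exp_Im: "norm (cos z) \<le> exp \<bar>Im z\<bar>"
proof -
  have "norm (cos z) \<le> (norm (exp (\<i> * z)) + norm (exp (- (\<i> * z)))) / 2"
    using norm_triangle_ineq[of "exp (\<i> * z)" "exp (- (\<i> * z))"]
    unfolding cos_exp_eq norm_divide by (simp add: divide_right_mono)
  also have "\<dots> \<le> exp \<bar>Im z\<bar>" by (auto simp: abs_if)
  finally show ?thesis .
qed

lemma norm_sin_le_exp_Im: "norm (sin z) \<le> exp \<bar>Im z\<bar>"
  using norm_cos_le_exp_Im[of "z - of_real pi / 2"] by (simp add: cos_diff cos_of_real sin_of_real flip: of_real_divide)

lemma norm_sin_le_norm_mult_exp_Im: "norm (sin z) \<le> norm z * exp \<bar>Im z\<bar>"
proof -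
  have "norm (sin z - sin 0) \<le> exp \<bar>Im z\<bar> * norm (z - 0)"
  proof (rule field_differentiable_bound[of "{w. \<bar>Im w\<bar> \<le> \<bar>Im z\<bar>}" sin cos])
    have "{w. \<bar>Im w\<bar> \<le> \<bar>Im z\<bar>} = {w. Im w \<le> \<bar>Im z\<bar>} \<inter> {w. Im w \<ge> - \<bar>Im z\<bar>}" by auto
    thus "convex {w. \<bar>Im w\<bar> \<le> \<bar>Im z\<bar>}"
      by (simp add: convex_Int convex_halfspace_Im_le convex_halfspace_Im_ge)
    show "norm (cos w) \<le> exp \<bar>Im z\<bar>" if "w \<in> {w. \<bar>Im w\<bar> \<le> \<bar>Im z\<bar>}" for w
      using norm_cos_le_exp_Im[of w] that by (auto intro: order_trans)
  qed (auto intro!: derivative_eq_intros)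
  thus ?thesis by (simp add: mult.commute)
qed

definition sinc_pi :: "complex \<Rightarrow> complex" where
  "sinc_pi z = (if z = 0 then 1 else sin (of_real pi * z) / (of_real pi * z))"

lemma holomorphic_sinc_pi: "sinc_pi holomorphic_on UNIV"
proof -
  define s where "s = (\<lambda>z::complex. sin (of_real pi * z))"
  have hol: "s holomorphic_on UNIV" unfolding s_def by (intro holomorphic_intros)
  have "deriv s 0 = of_real pi"
    unfolding s_def by (rule DERIV_imp_deriv) (auto intro!: derivative_eq_intros)
  hence "sinc_pi = (\<lambda>z. (if z = 0 then deriv s 0 else (s z - s 0) / (z - 0)) / of_real pi)"
    by (auto simp: fun_eq_iff sinc_pi_def s_def)
  moreover have "(\<lambda>z. if z = 0 then deriv s 0 else (s z - s 0) / (z - 0)) holomorphic_on UNIV"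
    by (rule pole_lemma[OF hol]) simp
  ultimately show ?thesis
    using holomorphic_on_divide[OF _ holomorphic_on_const[of "of_real pi"]] by force
qed

lemma holomorphic_on_sinc_pi [holomorphic_intros]:
  assumes "f holomorphic_on A"
  shows "(\<lambda>z. sinc_pi (f z)) holomorphic_on A"
  using holomorphic_on_compose_gen[OF assms holomorphic_sinc_pi] by (simp add: o_def)

lemma sinc_pi_mult: "of_real pi * z * sinc_pi z = sin (of_real pi * z)"
  by (simp add: sinc_pi_def)

lemma norm_sinc_pi_le: "norm (sinc_pi z) \<le> exp (pi * \<bar>Im z\<bar>)"
  using norm_sin_le_norm_mult_exp_Im[of "of_real pi * z"]
  by (simp add: sinc_pi_def norm_divide norm_mult abs_mult field_simps)

lemma norm_sinc_pi_le_decay: "norm z * norm (sinc_pi z) \<le> exp (pi * \<bar>Im z\<bar>)"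
proof -
  have "norm (of_real pi * z * sinc_pi z) \<le> exp (pi * \<bar>Im z\<bar>)"
    unfolding sinc_pi_mult using norm_sin_le_exp_Im[of "of_real pi * z"] by (simp add: abs_mult)
  moreover have "1 * (norm z * norm (sinc_pi z)) \<le> pi * (norm z * norm (sinc_pi z))"
    using pi_gt3 by (intro mult_right_mono) auto
  ultimately show ?thesis by (simp add: norm_mult mult.assoc)
qed

lemma norm_sinc_pi_power2_le:
  "norm (sinc_pi z) ^ 2 \<le> 2 * exp (2 * pi * \<bar>Im z\<bar>) / (1 + norm z ^ 2)"
proof -
  have "norm (sinc_pi z) ^ 2 \<le> exp (pi * \<bar>Im z\<bar>) ^ 2"
    by (intro power_mono norm_sinc_pi_le) simp
  moreover have "(norm z * norm (sinc_pi z)) ^ 2 \<le> exp (pi * \<bar>Im z\<bar>) ^ 2"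
    by (intro power_mono norm_sinc_pi_le_decay) simp
  ultimately have "norm (sinc_pi z) ^ 2 * (1 + norm z ^ 2) \<le> 2 * exp (pi * \<bar>Im z\<bar>) ^ 2"
    unfolding power_mult_distrib ring_distribs by (simp only: mult_ac mult_1_left)
  also have "exp (pi * \<bar>Im z\<bar>) ^ 2 = exp (2 * pi * \<bar>Im z\<bar>)"
    by (simp add: exp_double[symmetric] mult.assoc)
  finally show ?thesis by (simp add: pos_le_divide_eq add_pos_nonneg)
qed

lemma sinc_pi_of_real: "sinc_pi (of_real x) = of_real (Re (sinc_pi (of_real x)))"
proof -
  have "sinc_pi (of_real x) = of_real (if x = 0 then 1 else sin (pi * x) / (pi * x))"
    by (simp add: sinc_pi_def flip: sin_of_real of_real_mult)
  thus ?thesis by simp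
qed

lemma sinc_pi_minus: "sinc_pi (- z) = sinc_pi z"
  by (simp add: sinc_pi_def)

lemma sinc_pi_of_int: "n \<noteq> 0 \<Longrightarrow> sinc_pi (of_int n) = 0"
proof -
  assume "n \<noteq> 0"
  have "of_real pi * of_int n = (of_real (pi * of_int n) :: complex)" by simp
  hence "sin (of_real pi * of_int n :: complex) = of_real (sin (pi * of_int n))"
    by (simp only: sin_of_real)
  also have "sin (pi * of_int n) = 0" by (rule sin_npi_int)
  finally show ?thesis using \<open>n \<noteq> 0\<close> by (simp add: sinc_pi_def)
qed

section \<open>Integrals over horizontal lines\<close>

lemma integrable_inverse_1_plus_square: "integrable lborel (\<lambda>x::real. 1 / (1 + x^2))"
proof -
  define h where "h = (\<lambda>x::real. indicat_real {0<..} x *\<^sub>R (1 / (1 + x^2)))"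
  have pos: "integrable lborel h"
    using integrable_I0i_1_div_plus_square
    by (simp add: h_def interval_lebesgue_integrable_def set_integrable_def zero_ereal_def)
  hence neg: "integrable lborel (\<lambda>x. h (0 + (- 1) * x))"
    by (subst lborel_integrable_real_affine_iff) auto
  have "integrable lborel (\<lambda>x. h x + h (0 + (- 1) * x))"
    by (intro Bochner_Integration.integrable_add pos neg)
  thus ?thesis
  proof (rule integrable_cong_AE_imp)
    have "AE x in lborel. x \<noteq> (0::real)" by (rule AE_lborel_singleton)
    thus "AE x in lborel. h x + h (0 + (- 1) * x) = 1 / (1 + x^2)"
      by eventually_elim (auto simp: h_def indicator_def)
  qed simp
qed

text \<open>
  This number is \<open>\<pi>\<close>; it enters the estimates as a constant.
\<close>

definition arctan_mass :: real where
  "arctan_mass = (LBINT x. 1 / (1 + x^2))"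

lemma
  fixes h :: "real \<Rightarrow> 'a :: {banach, second_countable_topology}"
  assumes meas: "h \<in> borel_measurable borel" and bound: "\<And>x. norm (h x) \<le> C / (1 + x^2)"
  shows integrable_quadratic_decay: "integrable lborel h"
    and norm_integral_quadratic_decay: "norm (integral\<^sup>L lborel h) \<le> C * arctan_mass"
proof -
  have int: "integrable lborel (\<lambda>x. C * (1 / (1 + x^2)))"
    by (intro integrable_mult_right integrable_inverse_1_plus_square)
  show i: "integrable lborel h"
  proof (rule Bochner_Integration.integrable_bound[OF int])
    show "AE x in lborel. norm (h x) \<le> norm (C * (1 / (1 + x^2)))"
      using order_trans[OF bound abs_ge_self] by (auto intro!: AE_I2)
  qed (use meas in simp)
  have "norm (integral\<^sup>L lborel h) \<le> (LBINT x. norm (h x))" by (rule integral_norm_bound)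
  also have "\<dots> \<le> (LBINT x. C * (1 / (1 + x^2)))"
    by (rule integral_mono) (use i int bound in auto)
  also have "\<dots> = C * arctan_mass" unfolding arctan_mass_def by (rule integral_mult_right_zero)
  finally show "norm (integral\<^sup>L lborel h) \<le> C * arctan_mass" .
qed

lemma has_contour_integral_linepath_same_Im_iff:
  assumes "x1 < x2"
  shows "(f has_contour_integral I) (linepath (Complex x1 y) (Complex x2 y)) \<longleftrightarrow>
         ((\<lambda>x. f (Complex x y)) has_integral I) {x1..x2}"
proof -
  have C: "Complex x y = of_real x + \<i> * of_real y" for x by (simp add: complex_eq_iff)
  have L: "linepath (Complex x1 y) (Complex x2 y) t = linepath (of_real x1) (of_real x2) t + \<i> * of_real y" for t
    by (simp add: linepath_def C algebra_simps scaleR_conv_of_real)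
  have D: "Complex x2 y - Complex x1 y = of_real x2 - of_real x1" by (simp add: C)
  have "(f has_contour_integral I) (linepath (Complex x1 y) (Complex x2 y)) \<longleftrightarrow>
        ((\<lambda>z. f (z + \<i> * of_real y)) has_contour_integral I) (linepath (of_real x1) (of_real x2))"
    unfolding has_contour_integral_linepath L D ..
  also have "\<dots> \<longleftrightarrow> ((\<lambda>x. f (Complex x y)) has_integral I) {x1..x2}"
    using has_contour_integral_linepath_Reals_iff[of "of_real x1" "of_real x2" "\<lambda>z. f (z + \<i> * of_real y)" I] assms
    by (simp add: C)
  finally show ?thesis .
qed

text \<open>
  The horizontal sides give the two integrals, and each vertical side contributes at most its length
  times the bound on it.
\<close>

lemma contour_integral_rectpath_approx:
  assumes "N > 0" "a < b"
    and cont: "continuous_on (path_image (rectpath (Complex (- N) a) (Complex N b))) f"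
    and bound: "\<And>y. a \<le> y \<Longrightarrow> y \<le> b \<Longrightarrow> norm (f (Complex N y)) \<le> B"
               "\<And>y. a \<le> y \<Longrightarrow> y \<le> b \<Longrightarrow> norm (f (Complex (- N) y)) \<le> B"
  shows "norm (contour_integral (rectpath (Complex (- N) a) (Complex N b)) f -
           (integral {- N..N} (\<lambda>x. f (Complex x a)) - integral {- N..N} (\<lambda>x. f (Complex x b))))
         \<le> 2 * (b - a) * B"
proof -
  define p1 p2 p3 p4 where "p1 = Complex (- N) a" "p2 = Complex N a" "p3 = Complex N b" "p4 = Complex (- N) b"
  note p = this
  have R: "rectpath p1 p3 = linepath p1 p2 +++ linepath p2 p3 +++ linepath p3 p4 +++ linepath p4 p1"
    by (simp add: rectpath_def Let_def p)
  have P: "path_image (rectpath p1 p3) =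
             closed_segment p1 p2 \<union> closed_segment p2 p3 \<union> closed_segment p3 p4 \<union> closed_segment p4 p1"
    unfolding R by (simp add: path_image_join Un_assoc)
  have cont': "continuous_on (closed_segment p1 p2) f" "continuous_on (closed_segment p2 p3) f"
      "continuous_on (closed_segment p4 p3) f" "continuous_on (closed_segment p4 p1) f"
    using cont unfolding p[symmetric] P
    by (auto elim!: continuous_on_subset simp: closed_segment_commute[of p4 p3])
  have B0: "B \<ge> 0" using order_trans[OF norm_ge_zero bound(1)[of a]] assms(2) by simp
  have has: "(f has_contour_integral contour_integral (linepath u v) f) (linepath u v)"
    if "continuous_on (closed_segment u v) f" for u v
    using that by (intro has_contour_integral_integral contour_integrable_continuous_linepath)
  have h1: "contour_integral (linepath p1 p2) f = integral {- N..N} (\<lambda>x. f (Complex x a))"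
    using has[OF cont'(1)] assms(1) unfolding p
    by (subst (asm) has_contour_integral_linepath_same_Im_iff) (auto simp: integral_unique)
  have h3: "contour_integral (linepath p4 p3) f = integral {- N..N} (\<lambda>x. f (Complex x b))"
    using has[OF cont'(3)] assms(1) unfolding p
    by (subst (asm) has_contour_integral_linepath_same_Im_iff) (auto simp: integral_unique)
  have h2: "norm (contour_integral (linepath p2 p3) f) \<le> B * norm (p3 - p2)"
  proof (rule has_contour_integral_bound_linepath[OF has[OF cont'(2)] B0])
    fix z assume "z \<in> closed_segment p2 p3"
    hence "Re z = N" "a \<le> Im z" "Im z \<le> b"
      using assms(2) by (auto simp: p closed_segment_same_Re closed_segment_eq_real_ivl split: if_splits)
    thus "norm (f z) \<le> B" using bound(1)[of "Im z"] by (metis complex_surj)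
  qed
  have h4: "norm (contour_integral (linepath p4 p1) f) \<le> B * norm (p1 - p4)"
  proof (rule has_contour_integral_bound_linepath[OF has[OF cont'(4)] B0])
    fix z assume "z \<in> closed_segment p4 p1"
    hence "Re z = - N" "a \<le> Im z" "Im z \<le> b"
      using assms(2) by (auto simp: p closed_segment_same_Re closed_segment_eq_real_ivl split: if_splits)
    thus "norm (f z) \<le> B" using bound(2)[of "Im z"] by (metis complex_surj)
  qed
  have h3': "(f has_contour_integral - contour_integral (linepath p4 p3) f) (linepath p3 p4)"
    using has_contour_integral_reversepath[OF _ has[OF cont'(3)]] by simp
  have "(f has_contour_integral (contour_integral (linepath p1 p2) f + (contour_integral (linepath p2 p3) f +
          (- contour_integral (linepath p4 p3) f + contour_integral (linepath p4 p1) f)))) (rectpath p1 p3)"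
    unfolding R by (intro has_contour_integral_join has cont' h3') auto
  hence "contour_integral (rectpath p1 p3) f = contour_integral (linepath p1 p2) f + (contour_integral (linepath p2 p3) f +
          (- contour_integral (linepath p4 p3) f + contour_integral (linepath p4 p1) f))"
    by (rule contour_integral_unique)
  hence eq: "contour_integral (rectpath p1 p3) f - (integral {- N..N} (\<lambda>x. f (Complex x a)) - integral {- N..N} (\<lambda>x. f (Complex x b)))
       = contour_integral (linepath p2 p3) f + contour_integral (linepath p4 p1) f"
    unfolding h1 h3 by simp
  have n: "norm (p3 - p2) = b - a" "norm (p1 - p4) = b - a"
    using assms(2) by (simp_all add: p cmod_def)
  have "2 * (b - a) * B = B * (b - a) + B * (b - a)" by simp
  thus ?thesis
    using norm_triangle_ineq[of "contour_integral (linepath p2 p3) f" "contour_integral (linepath p4 p1) f"]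
      h2[unfolded n] h4[unfolded n]
    unfolding p[symmetric] eq by linarith
qed

lemma integral_symmetric_interval_tendsto:
  fixes h :: "real \<Rightarrow> complex"
  assumes "integrable lborel h"
  shows "(\<lambda>n. integral {- real (Suc n)..real (Suc n)} h) \<longlonglongrightarrow> integral\<^sup>L lborel h"
proof -
  have "(\<lambda>n. LBINT x. indicat_real {- real (Suc n)..real (Suc n)} x *\<^sub>R h x) \<longlonglongrightarrow> integral\<^sup>L lborel h"
  proof (rule integral_dominated_convergence[where w = "\<lambda>x. norm (h x)"])
    show "AE x in lborel. (\<lambda>n. indicat_real {- real (Suc n)..real (Suc n)} x *\<^sub>R h x) \<longlonglongrightarrow> h x"
    proof (rule AE_I2)
      fix x :: real
      obtain m where "\<bar>x\<bar> \<le> real m" using real_arch_simple by blast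
      hence "eventually (\<lambda>n. indicat_real {- real (Suc n)..real (Suc n)} x *\<^sub>R h x = h x) sequentially"
        by (intro eventually_sequentiallyI[of m]) (auto simp: indicator_def)
      thus "(\<lambda>n. indicat_real {- real (Suc n)..real (Suc n)} x *\<^sub>R h x) \<longlonglongrightarrow> h x"
        by (rule tendsto_eventually)
    qed
  qed (use assms in \<open>auto simp: indicator_def\<close>)
  moreover have "(LBINT x. indicat_real {- real (Suc n)..real (Suc n)} x *\<^sub>R h x)
                   = integral {- real (Suc n)..real (Suc n)} h" for n
  proof -
    have "set_integrable lborel {- real (Suc n)..real (Suc n)} h"
      unfolding set_integrable_def by (rule integrable_mult_indicator) (use assms in auto)
    from set_borel_integral_eq_integral(2)[OF this] show ?thesis by (simp add: set_lebesgue_integral_def)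
  qed
  ultimately show ?thesis by simp
qed

lemma contour_integral_rectpath_tendsto:
  assumes "a < b"
    and cont: "\<And>n. continuous_on (path_image (rectpath (Complex (- real (Suc n)) a) (Complex (real (Suc n)) b))) f"
    and bound: "\<And>n y. a \<le> y \<Longrightarrow> y \<le> b \<Longrightarrow> norm (f (Complex (real (Suc n)) y)) \<le> B n"
               "\<And>n y. a \<le> y \<Longrightarrow> y \<le> b \<Longrightarrow> norm (f (Complex (- real (Suc n)) y)) \<le> B n"
    and "B \<longlonglongrightarrow> 0"
    and int: "integrable lborel (\<lambda>x. f (Complex x a))" "integrable lborel (\<lambda>x. f (Complex x b))"
  shows "(\<lambda>n. contour_integral (rectpath (Complex (- real (Suc n)) a) (Complex (real (Suc n)) b)) f)
           \<longlonglongrightarrow> (LBINT x. f (Complex x a)) - (LBINT x. f (Complex x b))"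
proof -
  let ?I = "\<lambda>n. integral {- real (Suc n)..real (Suc n)} (\<lambda>x. f (Complex x a)) -
                  integral {- real (Suc n)..real (Suc n)} (\<lambda>x. f (Complex x b))"
  let ?R = "\<lambda>n. contour_integral (rectpath (Complex (- real (Suc n)) a) (Complex (real (Suc n)) b)) f"
  have "?I \<longlonglongrightarrow> (LBINT x. f (Complex x a)) - (LBINT x. f (Complex x b))"
    by (intro tendsto_diff integral_symmetric_interval_tendsto int)
  moreover have "(\<lambda>n. ?R n - ?I n) \<longlonglongrightarrow> 0"
  proof (rule Lim_null_comparison)
    show "eventually (\<lambda>n. norm (?R n - ?I n) \<le> 2 * (b - a) * B n) sequentially"
      by (intro always_eventually allI contour_integral_rectpath_approx cont bound assms(1)) auto
    show "(\<lambda>n. 2 * (b - a) * B n) \<longlonglongrightarrow> 0" using tendsto_mult_right_zero[OF assms(5)] by simp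
  qed
  ultimately have "(\<lambda>n. (?R n - ?I n) + ?I n) \<longlonglongrightarrow> 0 + ((LBINT x. f (Complex x a)) - (LBINT x. f (Complex x b)))"
    by (intro tendsto_add)
  thus ?thesis by simp
qed

lemma quadratic_decay_tendsto_0: "(\<lambda>n. C / (1 + real (Suc n)^2)) \<longlonglongrightarrow> 0"
  by real_asymp

text \<open>
  Cauchy's theorem for rectangles whose vertical sides recede to infinity.
\<close>

lemma integral_shift_line:
  assumes hol: "f holomorphic_on UNIV" and "T > 0"
    and decay: "\<And>x y. 0 \<le> y \<Longrightarrow> y \<le> T \<Longrightarrow> norm (f (Complex x y)) \<le> C / (1 + x^2)"
  shows "(LBINT x. f (Complex x T)) = (LBINT x. f (of_real x))"
proof -
  have contf: "continuous_on A f" for A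
    using holomorphic_on_imp_continuous_on[OF hol] continuous_on_subset by blast
  have meas: "(\<lambda>x. f (Complex x y)) \<in> borel_measurable borel" for y
    unfolding Complex_eq
    by (intro borel_measurable_continuous_onI continuous_on_compose2[OF contf[of UNIV]] continuous_intros) auto
  have lim: "(\<lambda>n. contour_integral (rectpath (Complex (- real (Suc n)) 0) (Complex (real (Suc n)) T)) f)
          \<longlonglongrightarrow> (LBINT x. f (Complex x 0)) - (LBINT x. f (Complex x T))"
  proof (rule contour_integral_rectpath_tendsto[where B = "\<lambda>n. C / (1 + real (Suc n)^2)"])
    show "norm (f (Complex (real (Suc n)) y)) \<le> C / (1 + real (Suc n)^2)" if "0 \<le> y" "y \<le> T" for n y
      by (rule decay[OF that])
    show "norm (f (Complex (- real (Suc n)) y)) \<le> C / (1 + real (Suc n)^2)" if "0 \<le> y" "y \<le> T" for n y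
      using decay[OF that, of "- real (Suc n)"] unfolding power2_minus .
    show "integrable lborel (\<lambda>x. f (Complex x 0))" "integrable lborel (\<lambda>x. f (Complex x T))"
      by (rule integrable_quadratic_decay[OF meas decay]; use assms in simp)+
  qed (use assms contf quadratic_decay_tendsto_0 in auto)
  have "contour_integral (rectpath (Complex (- real (Suc n)) 0) (Complex (real (Suc n)) T)) f = 0" for n
    by (rule contour_integral_unique, rule Cauchy_theorem_convex_simple[OF hol]) auto
  hence "(LBINT x. f (Complex x 0)) - (LBINT x. f (Complex x T)) = 0"
    using lim by (simp add: LIMSEQ_const_iff)
  thus ?thesis by (simp add: Complex_eq)
qed

section \<open>Summation over the half-integers by residues\<close>

definition half_int :: "nat \<Rightarrow> real" where
  "half_int n = real n + 1/2"

lemma half_int_pos: "half_int n > 0"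
  by (simp add: half_int_def add_nonneg_pos)

text \<open>
  The half-integers \<open>n + 1/2\<close> and \<open>- (n + 1/2)\<close> are taken together, which turns sums over all
  half-integers into ordinary series.
\<close>

definition half_int_pair_sum :: "(complex \<Rightarrow> complex) \<Rightarrow> nat \<Rightarrow> complex" where
  "half_int_pair_sum f n = f (of_real (half_int n)) + f (of_real (- half_int n))"

text \<open>
  The kernel has a simple pole with residue \<open>- 1 / (2 \<pi> \<i>)\<close> at every half-integer; it tends to 1 for
  \<open>Im z \<rightarrow> \<infinity>\<close> and to 0 for \<open>Im z \<rightarrow> - \<infinity>\<close>.
\<close>

definition half_int_kernel :: "complex \<Rightarrow> complex" where
  "half_int_kernel z = 1 / (1 + exp (2 * of_real pi * \<i> * z))"

lemma exp_2pi_i_eq_minus_1_iff: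
  "1 + exp (2 * of_real pi * \<i> * z) = 0 \<longleftrightarrow> (\<exists>m::int. z = of_int m + 1/2)"
proof -
  have "1 + exp (2 * of_real pi * \<i> * z) = 0 \<longleftrightarrow> exp (2 * of_real pi * \<i> * z) = exp (of_real pi * \<i>)"
    using add_eq_0_iff[of 1 "exp (2 * of_real pi * \<i> * z)"] by simp
  also have "\<dots> \<longleftrightarrow> (\<exists>m::int. 2 * of_real pi * \<i> * z = of_real pi * \<i> + of_int (2 * m) * of_real pi * \<i>)"
    unfolding exp_eq by simp
  also have "\<dots> \<longleftrightarrow> (\<exists>m::int. z = of_int m + 1/2)"
  proof (rule ex_cong1)
    fix m :: int
    have "2 * of_real pi * \<i> * z = of_real pi * \<i> + of_int (2 * m) * of_real pi * \<i> \<longleftrightarrow>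
          (2 * of_real pi * \<i>) * z = (2 * of_real pi * \<i>) * (of_int m + 1/2)"
      by (simp add: algebra_simps)
    also have "\<dots> \<longleftrightarrow> z = of_int m + 1/2" by (subst mult_cancel_left) simp
    finally show "(2 * of_real pi * \<i> * z = of_real pi * \<i> + of_int (2 * m) * of_real pi * \<i>) = (z = of_int m + 1/2)" .
  qed
  finally show ?thesis .
qed

lemma holomorphic_half_int_kernel:
  assumes "\<And>m::int. of_int m + 1/2 \<notin> A"
  shows "half_int_kernel holomorphic_on A"
proof -
  have "1 + exp (2 * of_real pi * \<i> * z) \<noteq> 0" if "z \<in> A" for z
    using assms that by (auto simp: exp_2pi_i_eq_minus_1_iff)
  thus ?thesis unfolding half_int_kernel_def by (intro holomorphic_intros) auto
qed

text \<open>
  If \<open>f\<close> vanishes at the half-integer there is no pole; this case follows by additivity from the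
  residues for \<open>f + 1\<close> and for 1.
\<close>

lemma residue_half_int_kernel:
  assumes hol: "f holomorphic_on UNIV"
  shows "residue (\<lambda>z. f z * half_int_kernel z) (of_int m + 1/2) = - f (of_int m + 1/2) / (2 * of_real pi * \<i>)"
proof -
  define p where "p = (of_int m + 1/2 :: complex)"
  define g where "g = (\<lambda>z. 1 + exp (2 * of_real pi * \<i> * z))"
  have gp: "g p = 0" unfolding g_def p_def exp_2pi_i_eq_minus_1_iff by blast
  hence ep: "exp (2 * of_real pi * \<i> * p) = - 1" by (simp add: g_def add_eq_0_iff)
  have g': "(g has_field_derivative (- (2 * of_real pi * \<i>))) (at p)"
    unfolding g_def by (auto intro!: derivative_eq_intros simp: ep)
  have holg: "g holomorphic_on A" for A unfolding g_def by (intro holomorphic_intros)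
  define S where "S = ball p (1/2)"
  have S: "open S" "connected S" "p \<in> S" by (simp_all add: S_def)
  have gnz: "g z \<noteq> 0" if z: "z \<in> S - {p}" for z
  proof
    assume "g z = 0"
    then obtain m' :: int where m': "z = of_int m' + 1/2" unfolding g_def exp_2pi_i_eq_minus_1_iff by blast
    have "norm (p - z) = norm (of_int (m - m') :: complex)" by (simp add: m' p_def)
    also have "\<dots> = of_int \<bar>m - m'\<bar>" by (simp only: norm_of_int of_int_abs)
    finally have "real_of_int \<bar>m - m'\<bar> < of_int 1" using z by (simp add: S_def dist_norm)
    hence "\<bar>m - m'\<bar> < 1" unfolding of_int_less_iff .
    hence "m = m'" by simp
    thus False using z m' by (simp add: p_def)
  qed
  have res: "residue (\<lambda>z. h z / g z) p = h p / (- (2 * of_real pi * \<i>))"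
    if "h holomorphic_on S" "h p \<noteq> 0" for h
    by (rule residue_simple_pole_deriv[OF that(1) holg S g' that(2) gp]) simp
  have holf: "f holomorphic_on A" for A using hol by (rule holomorphic_on_subset) simp
  have "residue (\<lambda>z. f z / g z) p = f p / (- (2 * of_real pi * \<i>))"
  proof (cases "f p = 0")
    case False
    thus ?thesis by (intro res holf)
  next
    case True
    have "residue (\<lambda>z. f z / g z + 1 / g z) p = residue (\<lambda>z. f z / g z) p + residue (\<lambda>z. 1 / g z) p"
      by (rule residue_add[OF S(1,3)]; intro holomorphic_intros holf holg gnz)
    moreover have "residue (\<lambda>z. f z / g z + 1 / g z) p = residue (\<lambda>z. (f z + 1) / g z) p"
      by (simp add: add_divide_distrib)
    moreover have "residue (\<lambda>z. (f z + 1) / g z) p = (f p + 1) / (- (2 * of_real pi * \<i>))"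
      by (rule res) (auto intro!: holomorphic_intros holf simp: True)
    moreover have "residue (\<lambda>z. 1 / g z) p = 1 / (- (2 * of_real pi * \<i>))"
      by (rule res) auto
    ultimately show ?thesis using True by simp
  qed
  thus ?thesis by (simp add: half_int_kernel_def g_def p_def)
qed

lemma sum_symmetric_int_interval:
  fixes g :: "int \<Rightarrow> 'a::comm_monoid_add"
  shows "(\<Sum>m\<in>{- int N..<int N}. g m) = (\<Sum>n<N. g (int n) + g (- int n - 1))"
proof (induction N)
  case (Suc N)
  have "{- int (Suc N)..<int (Suc N)} = insert (int N) (insert (- int N - 1) {- int N..<int N})" by auto
  thus ?case using Suc by (simp add: add_ac)
qed auto

lemma contour_integral_rectpath_half_int_kernel:
  assumes hol: "f holomorphic_on UNIV" and "T > 0" "N > 0"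
  shows "contour_integral (rectpath (Complex (- real N) (- T)) (Complex (real N) T))
           (\<lambda>z. f z * half_int_kernel z) = - (\<Sum>n<N. half_int_pair_sum f n)"
proof -
  define S where "S = {z. - real N - 1/2 < Re z} \<inter> {z. Re z < real N + 1/2}"
  define pt where "pt = (\<lambda>m::int. of_int m + 1/2 :: complex)"
  define pts where "pts = pt ` {- int N..<int N}"
  let ?g = "rectpath (Complex (- real N) (- T)) (Complex (real N) T)"
  have Re_pt: "Re (pt m) = of_int m + 1/2" "Im (pt m) = 0" for m by (simp_all add: pt_def)
  have "contour_integral ?g (\<lambda>z. f z * half_int_kernel z) =
      2 * pi * \<i> * (\<Sum>p\<in>pts. winding_number ?g p * residue (\<lambda>z. f z * half_int_kernel z) p)"
  proof (rule Residue_theorem[of S])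
    show "open S" unfolding S_def
      by (intro open_Int open_halfspace_Re_gt open_halfspace_Re_lt)
    have "convex S" unfolding S_def by (intro convex_Int convex_halfspace_Re_gt convex_halfspace_Re_lt)
    thus "connected S" by (rule convex_connected)
    show "finite pts" by (simp add: pts_def)
    have "of_int m + 1/2 \<notin> S - pts" for m :: int
    proof
      assume *: "of_int m + 1/2 \<in> S - pts"
      hence "- real N - 1/2 < Re (pt m)" "Re (pt m) < real N + 1/2" by (auto simp: S_def pt_def)
      hence "- int N \<le> m" "m < int N" unfolding Re_pt by linarith+
      thus False using * by (auto simp: pts_def pt_def)
    qed
    thus "(\<lambda>z. f z * half_int_kernel z) holomorphic_on S - pts"
      by (intro holomorphic_intros holomorphic_half_int_kernel holomorphic_on_subset[OF hol]) auto
    show "path_image ?g \<subseteq> S - pts"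
    proof
      fix z assume "z \<in> path_image ?g"
      hence z: "(Re z \<in> {- real N, real N} \<and> Im z \<in> {- T..T}) \<or> (Im z \<in> {- T, T} \<and> Re z \<in> {- real N..real N})"
        using assms by (subst (asm) path_image_rectpath) auto
      hence "z \<in> S" by (auto simp: S_def)
      moreover have "z \<noteq> pt m" for m
      proof
        assume "z = pt m"
        hence "of_int m + 1/2 = real N \<or> of_int m + 1/2 = - real N" using z assms(2) by (auto simp: Re_pt)
        hence "of_int (2 * m + 1) = real_of_int (2 * int N) \<or> of_int (2 * m + 1) = real_of_int (- 2 * int N)" by auto
        hence "2 * m + 1 = 2 * int N \<or> 2 * m + 1 = - 2 * int N" unfolding of_int_eq_iff .
        thus False by presburger
      qed
      ultimately show "z \<in> S - pts" by (auto simp: pts_def)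
    qed
    show "\<forall>z. z \<notin> S \<longrightarrow> winding_number ?g z = 0"
    proof (intro allI impI)
      fix z assume "z \<notin> S"
      hence "z \<notin> cbox (Complex (- real N) (- T)) (Complex (real N) T)"
        by (auto simp: S_def in_cbox_complex_iff)
      thus "winding_number ?g z = 0" using assms by (intro winding_number_rectpath_outside) auto
    qed
  qed auto
  also have "(\<Sum>p\<in>pts. winding_number ?g p * residue (\<lambda>z. f z * half_int_kernel z) p) =
             (\<Sum>m\<in>{- int N..<int N}. winding_number ?g (pt m) * residue (\<lambda>z. f z * half_int_kernel z) (pt m))"
    unfolding pts_def by (subst sum.reindex) (auto simp: inj_on_def pt_def)
  also have "\<dots> = (\<Sum>m\<in>{- int N..<int N}. - f (pt m) / (2 * of_real pi * \<i>))"
  proof (rule sum.cong)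
    fix m assume m: "m \<in> {- int N..<int N}"
    have "- real N < of_int m + 1/2" "of_int m + 1/2 < real N" using m by auto
    hence "pt m \<in> box (Complex (- real N) (- T)) (Complex (real N) T)"
      using assms by (auto simp: in_box_complex_iff Re_pt)
    hence "winding_number ?g (pt m) = 1" by (rule winding_number_rectpath)
    thus "winding_number ?g (pt m) * residue (\<lambda>z. f z * half_int_kernel z) (pt m) = - f (pt m) / (2 * of_real pi * \<i>)"
      using residue_half_int_kernel[OF hol, of m] by (simp add: pt_def)
  qed auto
  also have "2 * pi * \<i> * \<dots> = - (\<Sum>m\<in>{- int N..<int N}. f (pt m))"
    by (simp add: sum_distrib_left sum_negf)
  also have "(\<Sum>m\<in>{- int N..<int N}. f (pt m)) = (\<Sum>n<N. f (pt (int n)) + f (pt (- int n - 1)))"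
    by (rule sum_symmetric_int_interval)
  also have "\<dots> = (\<Sum>n<N. half_int_pair_sum f n)"
  proof (rule sum.cong)
    fix n
    have "pt (int n) = of_real (half_int n)" "pt (- int n - 1) = of_real (- half_int n)"
      by (simp_all add: pt_def half_int_def)
    thus "f (pt (int n)) + f (pt (- int n - 1)) = half_int_pair_sum f n"
      by (simp only: half_int_pair_sum_def)
  qed auto
  finally show ?thesis .
qed

lemma norm_exp_2pi_i: "norm (exp (2 * of_real pi * \<i> * z)) = exp (- 2 * pi * Im z)"
  by simp

lemma norm_half_int_kernel_le:
  assumes "T \<ge> 1" "\<bar>Im z\<bar> = T"
  shows "norm (half_int_kernel z) \<le> 2"
proof -
  define w where "w = exp (2 * of_real pi * \<i> * z)"
  have e: "exp (- 2 * pi * T) \<le> 1/2"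
  proof -
    have "2 \<le> 1 + 2 * pi * T" using pi_gt3 assms(1) mult_mono[of 1 "2*pi" 1 T] by simp
    also have "\<dots> \<le> exp (2 * pi * T)" by (rule exp_ge_add_one_self)
    finally show ?thesis by (simp add: exp_minus field_simps)
  qed
  have e2: "exp (2 * pi * T) \<ge> 2" using e by (simp add: exp_minus field_simps)
  have nw: "norm w = exp (- 2 * pi * Im z)" unfolding w_def by (rule norm_exp_2pi_i)
  have "norm w \<le> 1/2 \<or> norm w \<ge> 2" using e e2 assms(2) unfolding nw by (cases "Im z \<ge> 0") auto
  hence "norm (1 + w) \<ge> 1/2"
    using norm_triangle_ineq2[of 1 "- w"] norm_triangle_ineq2[of w "- 1"] by (auto simp: add.commute)
  thus ?thesis unfolding half_int_kernel_def w_def[symmetric]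
    unfolding norm_divide norm_one by (subst pos_divide_le_eq) linarith+
qed

text \<open>
  The residue theorem for growing rectangles. Their vertical sides lie over integers, where the
  kernel is bounded by 1, so that the decay of \<open>f\<close> makes the contribution of these sides vanish.
\<close>

lemma half_int_pair_sum_sums_line_integrals:
  assumes hol: "f holomorphic_on UNIV" and "T \<ge> 1"
    and decay: "\<And>x y. \<bar>y\<bar> \<le> T \<Longrightarrow> norm (f (Complex x y)) \<le> C / (1 + x^2)"
  shows "half_int_pair_sum f sums
           ((LBINT x. f (Complex x T) * half_int_kernel (Complex x T)) -
            (LBINT x. f (Complex x (- T)) * half_int_kernel (Complex x (- T))))"
    and "\<bar>y\<bar> = T \<Longrightarrow> (\<lambda>x. f (Complex x y) * half_int_kernel (Complex x y)) \<in> borel_measurable borel"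
proof -
  define F where "F = (\<lambda>z. f z * half_int_kernel z)"
  have contF: "continuous_on A F" if "\<And>m::int. of_int m + 1/2 \<notin> A" for A
    unfolding F_def using that
    by (intro continuous_intros holomorphic_on_imp_continuous_on holomorphic_half_int_kernel
          holomorphic_on_subset[OF hol]) auto
  have C0: "C \<ge> 0" using order_trans[OF norm_ge_zero decay[of 0 0]] assms(2) by simp
  have meas: "(\<lambda>x. F (Complex x y)) \<in> borel_measurable borel" if "\<bar>y\<bar> = T" for y
  proof (intro borel_measurable_continuous_onI continuous_on_compose2[OF contF[of "{z. Im z = y}"]])
    show "of_int m + 1/2 \<notin> {z. Im z = y}" for m using that assms(2) by auto
  qed (auto intro!: continuous_intros simp: Complex_eq)
  thus "(\<lambda>x. f (Complex x y) * half_int_kernel (Complex x y)) \<in> borel_measurable borel" if "\<bar>y\<bar> = T"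
    using that by (simp add: F_def)
  have int: "integrable lborel (\<lambda>x. F (Complex x y))" if "\<bar>y\<bar> = T" for y
  proof (rule integrable_quadratic_decay[OF meas[OF that]])
    fix x
    have "norm (F (Complex x y)) \<le> (C / (1 + x^2)) * 2" unfolding F_def norm_mult
      using that norm_half_int_kernel_le[OF assms(2), of "Complex x y"] C0
      by (intro mult_mono decay) (auto simp: add_nonneg_nonneg)
    thus "norm (F (Complex x y)) \<le> (C * 2) / (1 + x^2)" by simp
  qed
  have kernel_vertical: "norm (half_int_kernel (Complex (of_int m) y)) \<le> 1" for m :: int and y
  proof -
    have "exp (2 * of_real pi * \<i> * Complex (of_int m) y)
        = exp (of_real (- 2 * pi * y)) * exp (2 * of_real pi * \<i> * of_int m)"
      unfolding exp_add[symmetric] by (simp add: Complex_eq algebra_simps)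
    also have "exp (2 * of_real pi * \<i> * of_int m) = (1 :: complex)"
      by (subst exp_eq_1) auto
    also have "exp (of_real (- 2 * pi * y)) * (1 :: complex) = of_real (exp (- 2 * pi * y))"
      by (simp only: exp_of_real mult_1_right)
    finally have "1 + exp (2 * of_real pi * \<i> * Complex (of_int m) y) = of_real (1 + exp (- 2 * pi * y))"
      by simp
    hence "norm (1 + exp (2 * of_real pi * \<i> * Complex (of_int m) y)) \<ge> 1"
      by (simp only: norm_of_real) simp
    thus ?thesis unfolding half_int_kernel_def norm_divide norm_one
      by (subst pos_divide_le_eq) linarith+
  qed
  have lim: "(\<lambda>n. contour_integral (rectpath (Complex (- real (Suc n)) (- T)) (Complex (real (Suc n)) T)) F)
          \<longlonglongrightarrow> (LBINT x. F (Complex x (- T))) - (LBINT x. F (Complex x T))"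
  proof (rule contour_integral_rectpath_tendsto[where B = "\<lambda>n. C / (1 + real (Suc n)^2)"])
    have vert: "norm (F (Complex (of_int m) y)) \<le> C / (1 + (of_int m)^2)" if "- T \<le> y" "y \<le> T" for m :: int and y
    proof -
      have "norm (F (Complex (of_int m) y)) \<le> (C / (1 + (of_int m)^2)) * 1" unfolding F_def norm_mult
        using that C0 kernel_vertical[of m y]
        by (intro mult_mono decay) (auto simp: add_nonneg_nonneg abs_le_iff)
      thus ?thesis by simp
    qed
    show "norm (F (Complex (real (Suc n)) y)) \<le> C / (1 + real (Suc n)^2)" if "- T \<le> y" "y \<le> T" for n y
      using vert[OF that, of "int (Suc n)"] by (simp only: of_int_of_nat_eq)
    show "norm (F (Complex (- real (Suc n)) y)) \<le> C / (1 + real (Suc n)^2)" if "- T \<le> y" "y \<le> T" for n y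
      using vert[OF that, of "- int (Suc n)"] by (simp only: of_int_of_nat_eq of_int_minus power2_minus)
    show "continuous_on (path_image (rectpath (Complex (- real (Suc n)) (- T)) (Complex (real (Suc n)) T))) F" for n
    proof (rule contF)
      fix m :: int
      show "of_int m + 1/2 \<notin> path_image (rectpath (Complex (- real (Suc n)) (- T)) (Complex (real (Suc n)) T))"
      proof
        assume "of_int m + 1/2 \<in> path_image (rectpath (Complex (- real (Suc n)) (- T)) (Complex (real (Suc n)) T))"
        hence "of_int m + 1/2 = real (Suc n) \<or> of_int m + 1/2 = - real (Suc n)"
          using assms(2) by (subst (asm) path_image_rectpath) auto
        hence "of_int (2 * m + 1) = real_of_int (2 * int (Suc n)) \<or> of_int (2 * m + 1) = real_of_int (- 2 * int (Suc n))" by auto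
        hence "2 * m + 1 = 2 * int (Suc n) \<or> 2 * m + 1 = - 2 * int (Suc n)" unfolding of_int_eq_iff .
        thus False by presburger
      qed
    qed
  qed (use assms(2) int quadratic_decay_tendsto_0 in auto)
  have "contour_integral (rectpath (Complex (- real (Suc n)) (- T)) (Complex (real (Suc n)) T)) F =
        - (\<Sum>k<Suc n. half_int_pair_sum f k)" for n
    unfolding F_def using contour_integral_rectpath_half_int_kernel[OF hol, of T "Suc n"] assms(2) by simp
  hence "(\<lambda>n. - (\<Sum>k<Suc n. half_int_pair_sum f k)) \<longlonglongrightarrow> (LBINT x. F (Complex x (- T))) - (LBINT x. F (Complex x T))"
    using lim by simp
  from tendsto_minus[OF this] have "(\<lambda>n. \<Sum>k<Suc n. half_int_pair_sum f k) \<longlonglongrightarrow> (LBINT x. F (Complex x T)) - (LBINT x. F (Complex x (- T)))"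
    unfolding minus_minus minus_diff_eq .
  hence "(\<lambda>n. \<Sum>k<n. half_int_pair_sum f k) \<longlonglongrightarrow> (LBINT x. F (Complex x T)) - (LBINT x. F (Complex x (- T)))"
    by (rule filterlim_sequentially_Suc[THEN iffD1])
  thus "half_int_pair_sum f sums
           ((LBINT x. f (Complex x T) * half_int_kernel (Complex x T)) -
            (LBINT x. f (Complex x (- T)) * half_int_kernel (Complex x (- T))))"
    by (simp add: sums_def F_def)
qed

section \<open>Poisson summation for functions of exponential type\<close>

lemma half_int_kernel_reflect:
  assumes "Im z \<noteq> 0"
  shows "half_int_kernel (- z) = 1 - half_int_kernel z"
proof -
  define w where "w = exp (2 * of_real pi * \<i> * z)"
  have "1 + w \<noteq> 0"
    using assms unfolding w_def by (auto simp: exp_2pi_i_eq_minus_1_iff)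
  moreover have "w \<noteq> 0" by (simp add: w_def)
  moreover have eq: "exp (2 * of_real pi * \<i> * (- z)) = 1 / w"
    by (simp add: w_def exp_minus divide_inverse)
  ultimately have "1 / (1 + 1 / w) = 1 - 1 / (1 + w)"
    by (simp add: divide_simps) (simp add: algebra_simps)
  thus ?thesis unfolding half_int_kernel_def eq w_def[symmetric] .
qed

lemma norm_half_int_kernel_minus_1_le:
  assumes "T \<ge> 1" "Im z = T"
  shows "norm (half_int_kernel z - 1) \<le> 2 * exp (- 2 * pi * T)"
proof -
  define w where "w = exp (2 * of_real pi * \<i> * z)"
  have nz: "1 + w \<noteq> 0"
    using assms unfolding w_def by (auto simp: exp_2pi_i_eq_minus_1_iff)
  hence "half_int_kernel z - 1 = - (w * half_int_kernel z)"
    unfolding half_int_kernel_def w_def[symmetric] by (simp add: field_simps)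
  hence "norm (half_int_kernel z - 1) = norm w * norm (half_int_kernel z)"
    by (simp only: norm_minus_cancel norm_mult)
  also have "norm w = exp (- 2 * pi * T)" unfolding w_def norm_exp_2pi_i assms(2) ..
  also have "exp (- 2 * pi * T) * norm (half_int_kernel z) \<le> exp (- 2 * pi * T) * 2"
    by (intro mult_left_mono norm_half_int_kernel_le[OF assms(1)]) (use assms in auto)
  finally show ?thesis by simp
qed

text \<open>
  On the line of height \<open>T\<close> the kernel differs from 1, and on the line of height \<open>- T\<close> from 0, by at
  most \<open>2 exp (- 2 \<pi> T)\<close>. As \<open>f\<close> grows at most like \<open>exp (2 \<pi> \<rho> T)\<close> with \<open>\<rho> < 1\<close>, letting \<open>T\<close> tend to
  infinity leaves the integral of \<open>f\<close> along a horizontal line, which can be moved to the real line.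
\<close>

lemma half_int_pair_sum_sums_integral_strict_type:
  assumes hol: "f holomorphic_on UNIV" and "0 \<le> \<rho>" "\<rho> < 1"
    and bound: "\<And>x y. norm (f (Complex x y)) \<le> C * exp (2 * pi * \<rho> * \<bar>y\<bar>) / (1 + x^2)"
  shows "half_int_pair_sum f sums (LBINT x. f (of_real x))"
proof -
  define A where "A = (\<lambda>T. LBINT x. f (Complex x T) * half_int_kernel (Complex x T))"
  define I where "I = (LBINT x. f (of_real x))"
  define K where "K = 4 * C * arctan_mass"
  have C0: "C \<ge> 0" using order_trans[OF norm_ge_zero bound[of 0 0]] by simp
  have contf: "continuous_on A f" for A
    using holomorphic_on_imp_continuous_on[OF hol] continuous_on_subset by blast
  have measf: "(\<lambda>x. f (Complex x y)) \<in> borel_measurable borel" for y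
    unfolding Complex_eq
    by (intro borel_measurable_continuous_onI continuous_on_compose2[OF contf[of UNIV]] continuous_intros) auto
  have *: "half_int_pair_sum f sums (A T - A (- T)) \<and> norm (A T - A (- T) - I) \<le> K * exp (- (2 * pi * (1 - \<rho>) * T))"
    if T: "T \<ge> 1" for T
  proof
    define D where "D = C * exp (2 * pi * \<rho> * T)"
    have D0: "D \<ge> 0" using C0 by (simp add: D_def)
    have decay: "norm (f (Complex x y)) \<le> D / (1 + x^2)" if "\<bar>y\<bar> \<le> T" for x y
    proof -
      have "2 * pi * \<rho> * \<bar>y\<bar> \<le> 2 * pi * \<rho> * T" using that assms(2) by (intro mult_left_mono) auto
      hence "C * exp (2 * pi * \<rho> * \<bar>y\<bar>) / (1 + x^2) \<le> D / (1 + x^2)"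
        unfolding D_def using C0 by (intro divide_right_mono mult_left_mono) (auto simp: add_nonneg_nonneg)
      thus ?thesis using bound[of x y] by linarith
    qed
    note P = half_int_pair_sum_sums_line_integrals[OF hol T decay]
    show "half_int_pair_sum f sums (A T - A (- T))" using P(1) by (simp add: A_def)
    define E where "E = D * (2 * exp (- 2 * pi * T))"
    have measT: "(\<lambda>x. f (Complex x y) * half_int_kernel (Complex x y)) \<in> borel_measurable borel" if "\<bar>y\<bar> = T" for y
      using P(2)[OF _ that] by simp
    have b1: "norm (f (Complex x T) * half_int_kernel (Complex x T) - f (Complex x T)) \<le> E / (1 + x^2)" for x
    proof -
      have "norm (f (Complex x T) * half_int_kernel (Complex x T) - f (Complex x T)) =
            norm (f (Complex x T)) * norm (half_int_kernel (Complex x T) - 1)"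
        by (simp add: norm_mult[symmetric] algebra_simps)
      also have "\<dots> \<le> (D / (1 + x^2)) * (2 * exp (- 2 * pi * T))"
        using T D0 by (intro mult_mono decay norm_half_int_kernel_minus_1_le) (auto simp: add_nonneg_nonneg)
      finally show ?thesis by (simp add: E_def)
    qed
    have b2: "norm (f (Complex x (- T)) * half_int_kernel (Complex x (- T))) \<le> E / (1 + x^2)" for x
    proof -
      have "half_int_kernel (Complex x (- T)) = 1 - half_int_kernel (Complex (- x) T)"
        using half_int_kernel_reflect[of "Complex (- x) T"] T by (simp add: Complex_eq)
      hence n: "norm (half_int_kernel (Complex x (- T))) \<le> 2 * exp (- 2 * pi * T)"
        using norm_half_int_kernel_minus_1_le[OF T, of "Complex (- x) T"] by (simp add: norm_minus_commute)
      have "norm (f (Complex x (- T)) * half_int_kernel (Complex x (- T))) \<le> (D / (1 + x^2)) * (2 * exp (- 2 * pi * T))"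
        unfolding norm_mult using T D0 n by (intro mult_mono decay) (auto simp: add_nonneg_nonneg)
      thus ?thesis by (simp add: E_def)
    qed
    have "integrable lborel (\<lambda>x. f (Complex x T) * half_int_kernel (Complex x T) - f (Complex x T))"
      by (rule integrable_quadratic_decay[OF _ b1]) (use measT[of T] measf[of T] T in simp)
    moreover have intf: "integrable lborel (\<lambda>x. f (Complex x T))"
      by (rule integrable_quadratic_decay[OF measf decay]) (use T in simp)
    ultimately have "A T = (LBINT x. f (Complex x T) * half_int_kernel (Complex x T) - f (Complex x T)) + (LBINT x. f (Complex x T))"
      unfolding A_def by (subst Bochner_Integration.integral_add[symmetric]) simp_all
    moreover have "(LBINT x. f (Complex x T)) = I"
      unfolding I_def by (rule integral_shift_line[OF hol _ decay]) (use T in auto)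
    ultimately have "A T - I = (LBINT x. f (Complex x T) * half_int_kernel (Complex x T) - f (Complex x T))" by simp
    also have "norm \<dots> \<le> E * arctan_mass"
      by (rule norm_integral_quadratic_decay[OF _ b1]) (use measT[of T] measf[of T] T in simp)
    finally have n1: "norm (A T - I) \<le> E * arctan_mass" .
    have n2: "norm (A (- T)) \<le> E * arctan_mass" unfolding A_def
      by (rule norm_integral_quadratic_decay[OF _ b2]) (use measT[of "- T"] T in simp)
    have "norm (A T - A (- T) - I) \<le> norm (A T - I) + norm (A (- T))"
      using norm_triangle_ineq4[of "A T - I" "A (- T)"] by (simp add: algebra_simps)
    also have "\<dots> \<le> 2 * (E * arctan_mass)" using n1 n2 by simp
    also have "\<dots> = K * (exp (2 * pi * \<rho> * T) * exp (- 2 * pi * T))" by (simp add: K_def E_def D_def)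
    also have "exp (2 * pi * \<rho> * T) * exp (- 2 * pi * T) = exp (- (2 * pi * (1 - \<rho>) * T))"
      by (simp add: exp_add[symmetric] algebra_simps)
    finally show "norm (A T - A (- T) - I) \<le> K * exp (- (2 * pi * (1 - \<rho>) * T))" .
  qed
  define s where "s = A 1 - A (- 1)"
  have s: "half_int_pair_sum f sums s" using *[of 1] by (simp add: s_def)
  have "norm (s - I) \<le> K * exp (- (2 * pi * (1 - \<rho>) * T))" if "T \<ge> 1" for T
    using *[OF that] sums_unique2[OF s] by auto
  hence ev: "eventually (\<lambda>T. norm (s - I) \<le> K * exp (- (2 * pi * (1 - \<rho>) * T))) at_top"
    using eventually_ge_at_top[of 1] by (rule eventually_mono[rotated]) auto
  define c where "c = 2 * pi * (1 - \<rho>)"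
  have "c > 0" using assms(3) by (simp add: c_def)
  hence "((\<lambda>T. K * exp (- (c * T))) \<longlongrightarrow> 0) at_top" by real_asymp
  hence "((\<lambda>T. K * exp (- (2 * pi * (1 - \<rho>) * T))) \<longlongrightarrow> 0) at_top" by (simp add: c_def)
  hence "norm (s - I) \<le> 0" by (rule tendsto_lowerbound[OF _ ev]) simp
  thus ?thesis using s by (simp add: I_def)
qed

text \<open>
  With \<open>e = 1 / (k + 4)\<close>, the argument of \<open>F\<close> is contracted by \<open>1 - 2 e\<close> and the result multiplied by
  \<open>sinc_pi (e z)\<^sup>2\<close>, which has type \<open>2 \<pi> e\<close>. Type \<open>2 \<pi>\<close> is thus lowered to \<open>2 \<pi> (1 - e)\<close>, and functions
  bounded on the real line acquire quadratic decay there. The shift by 4 keeps the contraction factor between \<open>1/2\<close> and 1.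
\<close>

definition mollify :: "nat \<Rightarrow> (complex \<Rightarrow> complex) \<Rightarrow> complex \<Rightarrow> complex" where
  "mollify k F z = F (of_real (1 - 2 / real (k + 4)) * z) * sinc_pi (of_real (1 / real (k + 4)) * z) ^ 2"

lemma mollify_half_int_pair_sum_sums:
  assumes hol: "F holomorphic_on UNIV" and bound: "\<And>z. norm (F z) \<le> M * exp (2 * pi * \<bar>Im z\<bar>)"
  shows "half_int_pair_sum (mollify k F) sums (LBINT x. mollify k F (of_real x))"
proof -
  define e where "e = 1 / real (k + 4)"
  have e: "e > 0" "e \<le> 1/4" by (auto simp: e_def field_simps)
  have moll: "mollify k F z = F (of_real (1 - 2 * e) * z) * sinc_pi (of_real e * z) ^ 2" for z
    by (simp add: mollify_def e_def)
  have M0: "M \<ge> 0" using order_trans[OF norm_ge_zero bound[of 0]] by simp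
  show ?thesis
  proof (rule half_int_pair_sum_sums_integral_strict_type[where \<rho> = "1 - e" and C = "2 * M / e^2"])
    have "(F \<circ> (\<lambda>z. of_real (1 - 2 * e) * z)) holomorphic_on UNIV"
      by (rule holomorphic_on_compose_gen[where t = UNIV]) (auto intro!: holomorphic_intros hol)
    hence "(\<lambda>z. F (of_real (1 - 2 * e) * z)) holomorphic_on UNIV" by (simp add: o_def)
    thus "mollify k F holomorphic_on UNIV" unfolding moll[abs_def] by (intro holomorphic_intros)
    fix x y :: real
    let ?z = "Complex x y"
    have "norm (mollify k F ?z) = norm (F (of_real (1 - 2 * e) * ?z)) * norm (sinc_pi (of_real e * ?z)) ^ 2"
      by (simp add: moll norm_mult norm_power)
    also have "\<dots> \<le> (M * exp (2 * pi * \<bar>(1 - 2 * e) * y\<bar>)) * (2 * exp (2 * pi * \<bar>e * y\<bar>) / (1 + norm (of_real e * ?z) ^ 2))"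
      using bound[of "of_real (1 - 2 * e) * ?z"] norm_sinc_pi_power2_le[of "of_real e * ?z"] M0
      by (intro mult_mono) auto
    also have "\<dots> = 2 * M * (exp (2 * pi * \<bar>(1 - 2 * e) * y\<bar>) * exp (2 * pi * \<bar>e * y\<bar>)) / (1 + norm (of_real e * ?z) ^ 2)"
      by simp
    also have "exp (2 * pi * \<bar>(1 - 2 * e) * y\<bar>) * exp (2 * pi * \<bar>e * y\<bar>) = exp (2 * pi * (1 - e) * \<bar>y\<bar>)"
    proof -
      have "\<bar>(1 - 2 * e) * y\<bar> = (1 - 2 * e) * \<bar>y\<bar>" "\<bar>e * y\<bar> = e * \<bar>y\<bar>"
        using e by (simp_all add: abs_mult)
      thus ?thesis by (simp only: exp_add[symmetric]) (simp add: algebra_simps)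
    qed
    also have "2 * M * exp (2 * pi * (1 - e) * \<bar>y\<bar>) / (1 + norm (of_real e * ?z) ^ 2) \<le> 2 * M * exp (2 * pi * (1 - e) * \<bar>y\<bar>) / (e^2 * (1 + x^2))"
    proof (rule divide_left_mono)
      have 1: "e^2 \<le> 1" using e by (simp add: power_le_one)
      have n: "norm (of_real e * ?z) ^ 2 = e^2 * (x^2 + y^2)"
        using e by (simp add: norm_mult power_mult_distrib cmod_power2)
      have "e^2 * y^2 \<ge> 0" by simp
      thus "e^2 * (1 + x^2) \<le> 1 + norm (of_real e * ?z) ^ 2"
        unfolding n ring_distribs using 1 by linarith
      show "0 < (1 + norm (of_real e * ?z) ^ 2) * (e^2 * (1 + x^2))"
        using e by (intro mult_pos_pos) (auto simp: add_pos_nonneg)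
    qed (use M0 in auto)
    finally show "norm (mollify k F ?z) \<le> 2 * M / e^2 * exp (2 * pi * (1 - e) * \<bar>y\<bar>) / (1 + x^2)"
      by simp
  qed (use e in auto)
qed

lemma norm_sinc_pi_of_real_le: "norm (sinc_pi (of_real x)) \<le> 1"
  using norm_sinc_pi_le[of "of_real x"] by simp

lemma isCont_sinc_pi: "isCont sinc_pi z"
  using holomorphic_on_imp_continuous_on[OF holomorphic_sinc_pi]
  by (simp add: continuous_on_eq_continuous_at)

lemma sinc_pi_square_tendsto_1: "(\<lambda>k. sinc_pi (of_real (c k)) ^ 2) \<longlonglongrightarrow> 1" if "c \<longlonglongrightarrow> 0"
proof -
  have "(\<lambda>k. of_real (c k) :: complex) \<longlonglongrightarrow> of_real 0" using that by (rule tendsto_of_real)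
  hence "(\<lambda>k. sinc_pi (of_real (c k))) \<longlonglongrightarrow> sinc_pi (of_real 0)"
    by (rule isCont_tendsto_compose[OF isCont_sinc_pi])
  hence "(\<lambda>k. sinc_pi (of_real (c k)) ^ 2) \<longlonglongrightarrow> sinc_pi (of_real 0) ^ 2" by (rule tendsto_power)
  thus ?thesis by (simp add: sinc_pi_def)
qed

lemma mollify_tendsto:
  assumes "isCont F z" "z = of_real x"
  shows "(\<lambda>k. mollify k F z) \<longlonglongrightarrow> F z"
proof -
  have "(\<lambda>k. of_real (1 - 2 / real (k + 4)) * z) \<longlonglongrightarrow> of_real 1 * z"
    by (intro tendsto_mult tendsto_of_real tendsto_const) real_asymp
  hence "(\<lambda>k. F (of_real (1 - 2 / real (k + 4)) * z)) \<longlonglongrightarrow> F (of_real 1 * z)"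
    using assms(1) by (intro isCont_tendsto_compose[of _ F]) auto
  moreover have "(\<lambda>k. 1 / real (k + 4) * x) \<longlonglongrightarrow> 0" by real_asymp
  note sinc_pi_square_tendsto_1[OF this]
  ultimately have "(\<lambda>k. F (of_real (1 - 2 / real (k + 4)) * z) * sinc_pi (of_real (1 / real (k + 4) * x)) ^ 2)
     \<longlonglongrightarrow> F (of_real 1 * z) * 1" by (intro tendsto_mult)
  thus ?thesis by (simp add: mollify_def[abs_def] assms(2))
qed

text \<open>
  A substitution moves the contraction from \<open>F\<close> onto the sinc factor, which is at most 1 on the real
  line, so that \<open>\<bar>F\<bar>\<close> itself is a dominating function.
\<close>

lemma integral_mollify_tendsto:
  assumes int: "integrable lborel (\<lambda>x. F (of_real x))" and cont: "continuous_on UNIV F"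
  shows "(\<lambda>k. LBINT x. mollify k F (of_real x)) \<longlonglongrightarrow> (LBINT x. F (of_real x))"
proof -
  define e where "e = (\<lambda>k. 1 / real (k + 4))"
  define r where "r = (\<lambda>k. 1 - 2 / real (k + 4))"
  have r: "r k \<ge> 1/2" for k by (simp add: r_def field_simps)
  define h where "h = (\<lambda>k x. F (of_real x) * sinc_pi (of_real (e k / r k * x)) ^ 2)"
  have "(\<lambda>k. LBINT x. h k x) \<longlonglongrightarrow> (LBINT x. F (of_real x))"
  proof (rule integral_dominated_convergence[where w = "\<lambda>x. norm (F (of_real x))"])
    show "AE x in lborel. (\<lambda>k. h k x) \<longlonglongrightarrow> F (of_real x)"
    proof (rule AE_I2)
      fix x :: real
      have "(\<lambda>k. e k / r k * x) \<longlonglongrightarrow> 0" unfolding e_def r_def by real_asymp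
      from tendsto_mult[OF tendsto_const[of "F (of_real x)"] sinc_pi_square_tendsto_1[OF this]]
      show "(\<lambda>k. h k x) \<longlonglongrightarrow> F (of_real x)" by (simp add: h_def)
    qed
    show "AE x in lborel. norm (h k x) \<le> norm (F (of_real x))" for k
    proof (rule AE_I2)
      fix x :: real
      have "norm (sinc_pi (of_real (e k / r k * x))) ^ 2 \<le> 1"
        by (rule power_le_one[OF norm_ge_zero norm_sinc_pi_of_real_le])
      thus "norm (h k x) \<le> norm (F (of_real x))"
        unfolding h_def norm_mult norm_power by (intro mult_left_le) auto
    qed
    show "h k \<in> borel_measurable lborel" for k
    proof -
      have "continuous_on UNIV (h k)" unfolding h_def
        by (intro continuous_intros continuous_on_compose2[OF cont]
             continuous_on_compose2[OF holomorphic_on_imp_continuous_on[OF holomorphic_sinc_pi]]) auto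
      thus ?thesis using borel_measurable_continuous_onI by simp
    qed
  qed (use int in auto)
  moreover have "(\<lambda>k. 1 / r k) \<longlonglongrightarrow> 1" unfolding r_def by real_asymp
  ultimately have "(\<lambda>k. (1 / r k) *\<^sub>R (LBINT x. h k x)) \<longlonglongrightarrow> 1 *\<^sub>R (LBINT x. F (of_real x))"
    by (intro tendsto_scaleR)
  moreover have "(1 / r k) *\<^sub>R (LBINT x. h k x) = (LBINT x. mollify k F (of_real x))" for k
  proof -
    have rp: "r k > 0" using r[of k] by simp
    have "(LBINT x. h k x) = \<bar>r k\<bar> *\<^sub>R (LBINT x. h k (0 + r k * x))"
      by (rule lborel_integral_real_affine) (use rp in simp)
    moreover have "h k (0 + r k * x) = mollify k F (of_real x)" for x
      using rp by (simp add: h_def mollify_def e_def) (simp add: r_def)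
    ultimately show ?thesis using rp by simp
  qed
  ultimately show ?thesis by simp
qed

lemma summable_half_int_quadratic: "summable (\<lambda>n. C / (1 + half_int n ^ 2))"
proof -
  have "summable (\<lambda>n. inverse (real n ^ 2))" by (rule inverse_power_summable) simp
  hence s: "summable (\<lambda>n. 2 * inverse (real (Suc n) ^ 2))"
    by (intro summable_mult) (simp only: summable_Suc_iff[of "\<lambda>n. inverse (real n ^ 2)"])
  have "summable (\<lambda>n. 1 / (1 + half_int n ^ 2))"
  proof (rule summable_comparison_test'[OF s])
    fix n
    have pos: "1 + half_int n ^ 2 > 0" by (simp add: add_pos_nonneg)
    have "2 * (1 + half_int n ^ 2) - real (Suc n) ^ 2 = real n ^ 2 + 3/2"
      by (simp add: half_int_def power2_eq_square algebra_simps)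
    hence "real (Suc n) ^ 2 \<le> 2 * (1 + half_int n ^ 2)"
      using zero_le_power2[of "real n"] by linarith
    hence "1 / (1 + half_int n ^ 2) \<le> 2 / real (Suc n) ^ 2"
      using pos by (simp add: field_simps)
    thus "norm (1 / (1 + half_int n ^ 2)) \<le> 2 * inverse (real (Suc n) ^ 2)"
      using pos by (simp add: divide_inverse)
  qed
  from summable_mult[OF this, of C] show ?thesis by simp
qed

lemma sequential_tannery:
  fixes a :: "nat \<Rightarrow> nat \<Rightarrow> 'a :: {real_normed_algebra, banach}"
  assumes "\<And>n. (\<lambda>k. a n k) \<longlonglongrightarrow> b n" "\<And>n k. norm (a n k) \<le> B n" "summable B"
  shows "summable b" "(\<lambda>k. \<Sum>n. a n k) \<longlonglongrightarrow> (\<Sum>n. b n)"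
proof -
  have "eventually (\<lambda>(n, k). norm (a n k) \<le> B n) (at_top \<times>\<^sub>F sequentially)"
    using assms(2) by (intro always_eventually) auto
  from tannerys_theorem[OF assms(1) this assms(3)]
  show "summable b" "(\<lambda>k. \<Sum>n. a n k) \<longlonglongrightarrow> (\<Sum>n. b n)"
    using summable_norm_cancel by auto
qed

text \<open>
  Both sides are limits of the corresponding quantities for the mollified functions; for the series
  this is Tannery's theorem, the quadratic decay of \<open>F\<close> on the real line giving the dominating series.
\<close>

theorem half_int_pair_sum_sums_integral:
  assumes hol: "F holomorphic_on UNIV" and bound: "\<And>z. norm (F z) \<le> M * exp (2 * pi * \<bar>Im z\<bar>)"
    and decay: "\<And>x. norm (F (of_real x)) \<le> C / (1 + x^2)"
  shows "half_int_pair_sum F sums (LBINT x. F (of_real x))"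
proof -
  have cont: "continuous_on UNIV F" by (rule holomorphic_on_imp_continuous_on[OF hol])
  have isC: "isCont F z" for z using cont by (simp add: continuous_on_eq_continuous_at)
  have C0: "C \<ge> 0" using order_trans[OF norm_ge_zero decay[of 0]] by simp
  have "(\<lambda>x. F (of_real x)) \<in> borel_measurable borel"
    by (intro borel_measurable_continuous_onI continuous_on_compose2[OF cont] continuous_intros) auto
  hence int: "integrable lborel (\<lambda>x. F (of_real x))" using decay by (rule integrable_quadratic_decay)
  have moll: "norm (mollify k F (of_real x)) \<le> 4 * C / (1 + x^2)" for k x
  proof -
    define r where "r = 1 - 2 / real (k + 4)"
    have r: "r \<ge> 1/2" by (simp add: r_def field_simps)
    have "norm (mollify k F (of_real x)) = norm (F (of_real (r * x))) * norm (sinc_pi (of_real (1 / real (k + 4) * x))) ^ 2"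
      by (simp add: mollify_def r_def norm_mult norm_power)
    also have "\<dots> \<le> norm (F (of_real (r * x))) * 1"
      by (intro mult_left_mono power_le_one norm_sinc_pi_of_real_le) auto
    also have "\<dots> \<le> C / (1 + (r * x)^2)" using decay[of "r * x"] by simp
    also have "\<dots> \<le> C / ((1 + x^2) / 4)"
    proof (rule divide_left_mono)
      have "(1/2)^2 \<le> r^2" using r by (intro power_mono) auto
      hence "(1/4) * x^2 \<le> r^2 * x^2" by (intro mult_right_mono) (auto simp: power2_eq_square)
      thus "(1 + x^2) / 4 \<le> 1 + (r * x)^2" by (simp add: power_mult_distrib)
      show "0 < (1 + (r * x)^2) * ((1 + x^2) / 4)"
        by (intro mult_pos_pos) (auto simp: add_pos_nonneg)
    qed (rule C0)
    also have "\<dots> = 4 * C / (1 + x^2)" by simp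
    finally show ?thesis .
  qed
  have T1: "(\<lambda>k. half_int_pair_sum (mollify k F) n) \<longlonglongrightarrow> half_int_pair_sum F n" for n
    unfolding half_int_pair_sum_def by (intro tendsto_add mollify_tendsto isC) auto
  have T2: "norm (half_int_pair_sum (mollify k F) n) \<le> 8 * C / (1 + half_int n ^ 2)" for n k
  proof -
    have "norm (half_int_pair_sum (mollify k F) n) \<le> 4 * C / (1 + half_int n ^ 2) + 4 * C / (1 + (- half_int n) ^ 2)"
      unfolding half_int_pair_sum_def by (intro norm_triangle_mono moll)
    thus ?thesis by simp
  qed
  note T = sequential_tannery[OF T1 T2 summable_half_int_quadratic]
  have "(\<Sum>n. half_int_pair_sum (mollify k F) n) = (LBINT x. mollify k F (of_real x))" for k
    using mollify_half_int_pair_sum_sums[OF hol bound] by (rule sums_unique[symmetric])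
  hence "(\<lambda>k. LBINT x. mollify k F (of_real x)) \<longlonglongrightarrow> (\<Sum>n. half_int_pair_sum F n)" using T(2) by simp
  hence "(\<Sum>n. half_int_pair_sum F n) = (LBINT x. F (of_real x))"
    using integral_mollify_tendsto[OF int cont] LIMSEQ_unique by blast
  thus ?thesis using T(1) by (simp add: sums_iff)
qed

text \<open>
  For the mollified functions the sum of all defects is known by Poisson summation, and it exceeds
  every partial sum because the defects are nonnegative. As in Fatou's lemma, the inequality between
  these two quantities survives in the limit, in which each partial sum involves only finitely many
  values of \<open>F\<close>.
\<close>

theorem half_int_majorant_defect_le:
  assumes hol: "F holomorphic_on UNIV" and bound: "\<And>z. norm (F z) \<le> M * exp (2 * pi * \<bar>Im z\<bar>)"
    and int: "integrable lborel (\<lambda>x. F (of_real x))"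
    and le: "\<And>x. Re (F (of_real x)) \<le> g x"
    and cont: "continuous_on UNIV g" and nonneg: "\<And>x. g x \<ge> 0"
    and dom: "\<And>r n. 1/2 \<le> r \<Longrightarrow> r \<le> 1 \<Longrightarrow> g (r * half_int n) + g (- (r * half_int n)) \<le> B n"
    and "summable B"
  shows "(\<Sum>n<N. g (half_int n) + g (- half_int n) - Re (half_int_pair_sum F n))
           \<le> (\<Sum>n. g (half_int n) + g (- half_int n)) - Re (LBINT x. F (of_real x))"
proof -
  have contF: "continuous_on UNIV F" by (rule holomorphic_on_imp_continuous_on[OF hol])
  have isC: "isCont F z" for z using contF by (simp add: continuous_on_eq_continuous_at)
  have isCg: "isCont g x" for x using cont by (simp add: continuous_on_eq_continuous_at)
  define r where "r = (\<lambda>k. 1 - 2 / real (k + 4))"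
  define s where "s = (\<lambda>k x. Re (sinc_pi (of_real (1 / real (k + 4) * x)) ^ 2))"
  have r: "1/2 \<le> r k" "r k \<le> 1" for k by (simp_all add: r_def field_simps)
  have s: "sinc_pi (of_real (1 / real (k + 4) * x)) ^ 2 = of_real (s k x)" "0 \<le> s k x" "s k x \<le> 1" for k x
  proof -
    define t where "t = Re (sinc_pi (of_real (1 / real (k + 4) * x)))"
    have t: "sinc_pi (of_real (1 / real (k + 4) * x)) = of_real t"
      unfolding t_def by (rule sinc_pi_of_real)
    have st: "s k x = t^2" unfolding s_def t by simp
    show "sinc_pi (of_real (1 / real (k + 4) * x)) ^ 2 = of_real (s k x)" unfolding st t by simp
    show "0 \<le> s k x" unfolding st by simp
    have "\<bar>t\<bar> \<le> 1" using norm_sinc_pi_of_real_le[of "1 / real (k + 4) * x"] unfolding t by simp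
    thus "s k x \<le> 1" unfolding st by (simp add: abs_square_le_1)
  qed
  have Re_moll: "Re (mollify k F (of_real x)) = Re (F (of_real (r k * x))) * s k x" for k x
  proof -
    have "mollify k F (of_real x) = F (of_real (r k * x)) * sinc_pi (of_real (1 / real (k + 4) * x)) ^ 2"
      by (simp add: mollify_def r_def)
    thus ?thesis unfolding s by simp
  qed
  define a where "a = (\<lambda>n k. g (r k * half_int n) * s k (half_int n) + g (- (r k * half_int n)) * s k (- half_int n))"
  have a_le: "Re (half_int_pair_sum (mollify k F) n) \<le> a n k" for n k
    unfolding half_int_pair_sum_def a_def plus_complex.sel Re_moll
    using le[of "r k * half_int n"] le[of "r k * (- half_int n)"] s
    by (intro add_mono mult_right_mono) auto
  have a0: "a n k \<ge> 0" for n k unfolding a_def using nonneg s by simp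
  have aB: "norm (a n k) \<le> B n" for n k
  proof -
    have "a n k \<le> g (r k * half_int n) * 1 + g (- (r k * half_int n)) * 1"
      unfolding a_def using nonneg s by (intro add_mono mult_left_mono) auto
    thus ?thesis using dom[OF r, of k n] a0[of n k] by simp
  qed
  have s_lim: "(\<lambda>k. s k x) \<longlonglongrightarrow> 1" for x
  proof -
    have "(\<lambda>k. 1 / real (k + 4) * x) \<longlonglongrightarrow> 0" by real_asymp
    from tendsto_Re[OF sinc_pi_square_tendsto_1[OF this]] show ?thesis by (simp add: s_def)
  qed
  have r_lim: "(\<lambda>k. r k * x) \<longlonglongrightarrow> x" for x unfolding r_def by real_asymp
  have lim_a: "(\<lambda>k. a n k) \<longlonglongrightarrow> g (half_int n) + g (- half_int n)" for n
  proof -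
    have "(\<lambda>k. a n k) \<longlonglongrightarrow> g (half_int n) * 1 + g (- half_int n) * 1"
      unfolding a_def
      by (intro tendsto_add tendsto_mult s_lim isCont_tendsto_compose[OF isCg] tendsto_minus r_lim)
    thus ?thesis by simp
  qed
  note tan = sequential_tannery[OF lim_a aB assms(8)]
  have sums_moll: "(\<lambda>n. Re (half_int_pair_sum (mollify k F) n)) sums Re (LBINT x. mollify k F (of_real x))" for k
    by (rule sums_Re[OF mollify_half_int_pair_sum_sums[OF hol bound]])
  have fin: "(\<Sum>n<N. a n k - Re (half_int_pair_sum (mollify k F) n))
      \<le> (\<Sum>n. a n k) - Re (LBINT x. mollify k F (of_real x))" for k
  proof -
    have sa: "summable (\<lambda>n. a n k)" by (rule summable_comparison_test'[OF assms(8) aB])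
    have "(\<lambda>n. a n k - Re (half_int_pair_sum (mollify k F) n)) sums ((\<Sum>n. a n k) - Re (LBINT x. mollify k F (of_real x)))"
      by (rule sums_diff[OF summable_sums[OF sa] sums_moll])
    thus ?thesis using a_le sum_le_suminf[of "\<lambda>n. a n k - Re (half_int_pair_sum (mollify k F) n)" "{..<N}"]
      by (simp add: sums_iff)
  qed
  have L: "(\<lambda>k. \<Sum>n<N. a n k - Re (half_int_pair_sum (mollify k F) n)) \<longlonglongrightarrow>
     (\<Sum>n<N. g (half_int n) + g (- half_int n) - Re (half_int_pair_sum F n))"
    unfolding half_int_pair_sum_def
    by (intro tendsto_sum tendsto_diff lim_a tendsto_Re tendsto_add mollify_tendsto isC) auto
  have R: "(\<lambda>k. (\<Sum>n. a n k) - Re (LBINT x. mollify k F (of_real x))) \<longlonglongrightarrow>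
     (\<Sum>n. g (half_int n) + g (- half_int n)) - Re (LBINT x. F (of_real x))"
    by (intro tendsto_diff tan(2) tendsto_Re integral_mollify_tendsto[OF int contF])
  show ?thesis by (rule LIMSEQ_le[OF L R]) (use fin in auto)
qed

section \<open>Poisson summation for the Gaussian and the theta function\<close>

lemma exp_neg_square_le:
  assumes "c > 0"
  shows "exp (- c * x^2) \<le> (1 + 1 / c) / (1 + (x::real)^2)"
proof -
  have "1 + c * x^2 \<le> exp (c * x^2)" by (rule exp_ge_add_one_self)
  moreover have p: "1 + c * x^2 > 0" using assms by (simp add: add_pos_nonneg)
  ultimately have "exp (- c * x^2) \<le> 1 / (1 + c * x^2)"
    by (simp add: exp_minus divide_inverse le_imp_inverse_le)
  also have "\<dots> \<le> (1 + 1 / c) / (1 + x^2)"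
  proof -
    have "1 * (1 + x^2) \<le> (1 + 1 / c) * (1 + c * x^2)"
      using assms by (simp add: algebra_simps)
    thus ?thesis using p by (simp add: frac_le_eq divide_simps add_pos_nonneg mult.commute)
  qed
  finally show ?thesis .
qed

text \<open>
  Each factor \<open>x\<^sup>2\<close> is absorbed by half of the exponent.
\<close>

lemma summable_half_int_gaussian_moment:
  "c > 0 \<Longrightarrow> summable (\<lambda>n. half_int n ^ (2 * j) * exp (- c * half_int n ^ 2))"
proof (induction j arbitrary: c)
  case 0
  show ?case
    by (rule summable_comparison_test'[OF summable_half_int_quadratic[of "1 + 1 / c"]])
       (use exp_neg_square_le[OF 0] in simp)
next
  case (Suc j)
  have "summable (\<lambda>n. half_int n ^ (2 * j) * exp (- (c / 2) * half_int n ^ 2))"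
    using Suc.prems by (intro Suc.IH) simp
  hence "summable (\<lambda>n. (2 / c) * (half_int n ^ (2 * j) * exp (- (c / 2) * half_int n ^ 2)))"
    by (rule summable_mult)
  thus ?case
  proof (rule summable_comparison_test')
    fix n
    let ?x = "half_int n"
    have "c / 2 * ?x^2 \<le> exp (c / 2 * ?x^2)" using exp_ge_add_one_self[of "c / 2 * ?x^2"] by linarith
    hence "?x^2 \<le> (2 / c) * exp (c / 2 * ?x^2)" using Suc.prems by (simp add: field_simps)
    hence "(?x ^ (2 * j) * exp (- c * ?x^2)) * ?x^2 \<le> (?x ^ (2 * j) * exp (- c * ?x^2)) * ((2 / c) * exp (c / 2 * ?x^2))"
      by (rule mult_left_mono) simp
    also have "\<dots> = (2 / c) * (?x ^ (2 * j) * (exp (- c * ?x^2) * exp (c / 2 * ?x^2)))" by simp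
    also have "exp (- c * ?x^2) * exp (c / 2 * ?x^2) = exp (- (c / 2) * ?x^2)"
      by (simp add: exp_add[symmetric])
    finally have "(?x ^ (2 * j) * exp (- c * ?x^2)) * ?x^2 \<le> (2 / c) * (?x ^ (2 * j) * exp (- (c / 2) * ?x^2))" .
    moreover have "norm (?x ^ (2 * Suc j) * exp (- c * ?x^2)) = (?x ^ (2 * j) * exp (- c * ?x^2)) * ?x^2"
      using half_int_pos[of n] by (simp add: abs_mult power2_eq_square)
    ultimately show "norm (?x ^ (2 * Suc j) * exp (- c * ?x^2)) \<le> (2 / c) * (?x ^ (2 * j) * exp (- (c / 2) * ?x^2))"
      by simp
  qed
qed

lemmas summable_half_int_gaussian = summable_half_int_gaussian_moment[of _ 0, simplified]

lemma gaussian_of_real: "gaussian lam (of_real x) = of_real (exp (- pi * lam * x^2))"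
proof -
  have "- of_real (pi * lam) * (of_real x)\<^sup>2 = complex_of_real (- pi * lam * x^2)" by simp
  thus ?thesis unfolding gaussian_def by (simp only: exp_of_real)
qed

lemma gaussian_minus: "gaussian lam (- z) = gaussian lam z"
  by (simp add: gaussian_def)

lemma holomorphic_gaussian: "gaussian lam holomorphic_on A"
  unfolding gaussian_def by (intro holomorphic_intros)

lemma norm_gaussian: "norm (gaussian lam (Complex x y)) = exp (- pi * lam * (x^2 - y^2))"
  by (simp add: gaussian_def power2_eq_square)

text \<open>
  A rescaling of the characteristic function of the standard normal distribution.
\<close>

lemma gaussian_fourier_transform:
  assumes "lam > 0"
  shows "(LBINT x. gaussian lam (of_real x) * exp (2 * of_real pi * \<i> * of_real (t * x))) =
           of_real (lam powr (-1/2) * exp (- pi * t^2 / lam))"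
proof -
  define c where "c = sqrt (2 * pi * lam)"
  have c: "c > 0" "c^2 = 2 * pi * lam" using assms by (simp_all add: c_def)
  define u where "u = 2 * pi * t / c"
  define h where "h = (\<lambda>x. of_real (std_normal_density x) * iexp (u * x))"
  have "char std_normal_distribution u = (LBINT x. h x)"
    unfolding char_def h_def
    by (subst integral_density) (auto simp: scaleR_conv_of_real normal_density_nonneg)
  hence "(LBINT x. h x) = of_real (exp (- (u^2) / 2))" by (simp add: char_std_normal_distribution)
  also have "u^2 / 2 = pi * t^2 / lam"
    unfolding u_def power_divide power_mult_distrib c(2) using assms by (simp add: field_simps power2_eq_square)
  hence "- (u^2) / 2 = - pi * t^2 / lam" by simp
  also have "(LBINT x. h x) = \<bar>c\<bar> *\<^sub>R (LBINT x. h (0 + c * x))"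
    by (rule lborel_integral_real_affine) (use c in simp)
  also have "(\<lambda>x. h (0 + c * x)) = (\<lambda>x. of_real (1 / sqrt (2 * pi)) * (gaussian lam (of_real x) * exp (2 * of_real pi * \<i> * of_real (t * x))))"
  proof
    fix x
    have "(c * x)^2 / 2 = pi * lam * x^2" unfolding power_mult_distrib c(2) by simp
    hence d: "std_normal_density (0 + c * x) = 1 / sqrt (2 * pi) * exp (- pi * lam * x^2)"
      by (simp add: std_normal_density_def)
    have e: "u * (0 + c * x) = 2 * pi * (t * x)" using c by (simp add: u_def)
    show "h (0 + c * x) = of_real (1 / sqrt (2 * pi)) * (gaussian lam (of_real x) * exp (2 * of_real pi * \<i> * of_real (t * x)))"
      unfolding h_def d e gaussian_of_real by (simp add: mult_ac)
  qed
  also have "(LBINT x. of_real (1 / sqrt (2 * pi)) * (gaussian lam (of_real x) * exp (2 * of_real pi * \<i> * of_real (t * x)))) =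
      of_real (1 / sqrt (2 * pi)) * (LBINT x. gaussian lam (of_real x) * exp (2 * of_real pi * \<i> * of_real (t * x)))"
    by (rule integral_mult_right_zero)
  finally have eq: "\<bar>c\<bar> *\<^sub>R (of_real (1 / sqrt (2 * pi)) * (LBINT x. gaussian lam (of_real x) * exp (2 * of_real pi * \<i> * of_real (t * x)))) =
      of_real (exp (- pi * t^2 / lam))" .
  have sl: "c * (1 / sqrt (2 * pi)) = sqrt lam" by (simp add: c_def real_sqrt_mult)
  have "\<bar>c\<bar> *\<^sub>R (of_real (1 / sqrt (2 * pi)) * X) = of_real (sqrt lam) * X" for X :: complex
  proof -
    have "\<bar>c\<bar> *\<^sub>R (of_real (1 / sqrt (2 * pi)) * X) = of_real (c * (1 / sqrt (2 * pi))) * X"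
      using c by (simp add: scaleR_conv_of_real)
    thus ?thesis unfolding sl .
  qed
  hence "of_real (sqrt lam) * (LBINT x. gaussian lam (of_real x) * exp (2 * of_real pi * \<i> * of_real (t * x))) =
      of_real (exp (- pi * t^2 / lam))" using eq by simp
  hence "(LBINT x. gaussian lam (of_real x) * exp (2 * of_real pi * \<i> * of_real (t * x))) = of_real (exp (- pi * t^2 / lam)) / of_real (sqrt lam)"
    using assms by (simp add: field_simps)
  also have "lam powr (-1/2) = 1 / sqrt lam" using assms by (simp add: powr_minus_divide powr_half_sqrt)
  hence "of_real (exp (- pi * t^2 / lam)) / of_real (sqrt lam) = (of_real (lam powr (-1/2) * exp (- pi * t^2 / lam)) :: complex)"
    by simp
  finally show ?thesis .
qed

lemma gaussian_decay:
  assumes "lam > 0" "\<bar>y\<bar> \<le> 1"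
  shows "norm (gaussian lam (Complex x y)) \<le> exp (pi * lam) * (1 + 1 / (pi * lam)) / (1 + x^2)"
proof -
  have "y^2 \<le> 1" using assms(2) by (simp add: abs_square_le_1)
  hence "pi * lam * y^2 \<le> pi * lam" using assms(1) mult_left_mono[of "y^2" 1 "pi * lam"] by simp
  hence "norm (gaussian lam (Complex x y)) \<le> exp (pi * lam) * exp (- (pi * lam) * x^2)"
    by (simp add: norm_gaussian exp_add[symmetric] algebra_simps)
  also have "\<dots> \<le> exp (pi * lam) * ((1 + 1 / (pi * lam)) / (1 + x^2))"
    using assms(1) by (intro mult_left_mono exp_neg_square_le) auto
  finally show ?thesis by simp
qed

text \<open>
  The Gaussian grows too fast in the imaginary direction for the lines of integration to recede, so
  the heights 1 and \<open>- 1\<close> are kept. Evenness turns the integral along the lower line into one along the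
  upper line, where the kernel is the sum of the geometric series in \<open>- exp (2 \<pi> \<i> z)\<close>. Its terms
  produce the values of the Fourier transform at the integers.
\<close>

theorem gaussian_half_int_poisson:
  assumes "lam > 0"
  shows "summable (\<lambda>j. (-1)^j * exp (- pi * real j ^ 2 / lam))"
    and "(\<Sum>n. 2 * exp (- pi * lam * half_int n ^ 2)) =
           lam powr (-1/2) * (2 * (\<Sum>j. (-1)^j * exp (- pi * real j ^ 2 / lam)) - 1)"
proof -
  let ?G = "gaussian lam" and ?k = half_int_kernel
  define C where "C = exp (pi * lam) * (1 + 1 / (pi * lam))"
  have C0: "C \<ge> 0" using assms by (simp add: C_def)
  have decay: "norm (?G (Complex x y)) \<le> C / (1 + x^2)" if "\<bar>y\<bar> \<le> 1" for x y
    using gaussian_decay[OF assms that] by (simp add: C_def)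
  define z where "z = (\<lambda>x. Complex x 1)"
  define w where "w = (\<lambda>x. exp (2 * of_real pi * \<i> * z x))"
  have nw: "norm (w x) = exp (- 2 * pi)" for x by (simp add: w_def z_def)
  have cont_z: "continuous_on UNIV z" unfolding z_def Complex_eq by (intro continuous_intros)
  have cont_G: "continuous_on UNIV (\<lambda>x. ?G (z x))" unfolding gaussian_def by (intro continuous_intros cont_z)
  have cont_w: "continuous_on UNIV w" unfolding w_def by (intro continuous_intros cont_z)
  note P = half_int_pair_sum_sums_line_integrals[where f = ?G and T = 1, OF holomorphic_gaussian order_refl decay]
  have meas_k: "(\<lambda>x. ?G (z x) * ?k (z x)) \<in> borel_measurable borel" using P(2)[of 1] by (simp add: z_def)
  have nk: "norm (?k (z x)) \<le> 2" for x by (rule norm_half_int_kernel_le[of 1]) (auto simp: z_def)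
  have k_rec: "?k (z x) = (\<Sum>j<K. (- w x)^j) + (- w x)^K * ?k (z x)" for x K
  proof -
    have "Im (z x) \<noteq> Im (of_int m + 1/2)" for m by (simp add: z_def)
    hence nz: "1 + w x \<noteq> 0" unfolding w_def exp_2pi_i_eq_minus_1_iff by metis
    define v where "v = - w x"
    have wv: "w x = - v" by (simp add: v_def)
    have v: "v \<noteq> 1" using nz unfolding wv by simp
    have "(\<Sum>j<K. v^j) = (v^K - 1) / (v - 1)" using v(1) by (rule geometric_sum)
    also have "\<dots> = (1 - v^K) / (1 - v)" by (metis minus_diff_eq minus_divide_divide)
    finally have "1 / (1 - v) = (\<Sum>j<K. v^j) + v^K * (1 / (1 - v))" by (simp add: diff_divide_distrib)
    moreover have kv: "?k (z x) = 1 / (1 - v)"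
      unfolding half_int_kernel_def using wv unfolding w_def by simp
    ultimately show ?thesis unfolding kv v_def[symmetric] by blast
  qed
  define I where "I = (\<lambda>j::nat. lam powr (-1/2) * exp (- pi * real j ^ 2 / lam))"
  have int_w: "integrable lborel (\<lambda>x. ?G (z x) * w x ^ j)" for j
  proof (rule integrable_quadratic_decay[where C = C])
    show "(\<lambda>x. ?G (z x) * w x ^ j) \<in> borel_measurable borel"
      by (intro borel_measurable_continuous_onI continuous_intros cont_G cont_w)
    fix x
    have "norm (?G (z x) * w x ^ j) \<le> C / (1 + x^2) * 1"
      unfolding norm_mult norm_power nw z_def using C0
      by (intro mult_mono decay power_le_one) (auto simp: add_nonneg_nonneg)
    thus "norm (?G (z x) * w x ^ j) \<le> C / (1 + x^2)" by simp
  qed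
  have I: "(LBINT x. ?G (z x) * w x ^ j) = of_real (I j)" for j
  proof -
    have "(LBINT x. (\<lambda>u. ?G u * exp (2 * of_real pi * \<i> * u) ^ j) (Complex x 1)) =
          (LBINT x. (\<lambda>u. ?G u * exp (2 * of_real pi * \<i> * u) ^ j) (of_real x))"
    proof (rule integral_shift_line[where C = C])
      show "(\<lambda>u. ?G u * exp (2 * of_real pi * \<i> * u) ^ j) holomorphic_on UNIV"
        by (intro holomorphic_intros holomorphic_gaussian)
      fix x y :: real assume y: "0 \<le> y" "y \<le> 1"
      have "norm (?G (Complex x y) * exp (2 * of_real pi * \<i> * Complex x y) ^ j) \<le> C / (1 + x^2) * 1"
        unfolding norm_mult norm_power norm_exp_2pi_i using C0 y
        by (intro mult_mono decay power_le_one) (auto simp: add_nonneg_nonneg)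
      thus "norm (?G (Complex x y) * exp (2 * of_real pi * \<i> * Complex x y) ^ j) \<le> C / (1 + x^2)" by simp
    qed simp
    also have "\<dots> = (LBINT x. ?G (of_real x) * exp (2 * of_real pi * \<i> * of_real (real j * x)))"
      by (simp add: exp_of_nat_mult[symmetric] mult_ac)
    also have "\<dots> = of_real (I j)" unfolding I_def by (rule gaussian_fourier_transform[OF assms])
    finally show ?thesis by (simp add: z_def w_def)
  qed
  define A where "A = (LBINT x. ?G (z x) * ?k (z x))"
  have A_sums: "(\<lambda>j. (-1)^j * of_real (I j)) sums A"
  proof -
    have "norm ((\<Sum>j<K. (-1)^j * of_real (I j)) - A) \<le> (2 * C * exp (- 2 * pi) ^ K) * arctan_mass" for K
    proof -
      have int_rest: "norm (?G (z x) * ((- w x)^K * ?k (z x))) \<le> (2 * C * exp (- 2 * pi) ^ K) / (1 + x^2)" for x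
      proof -
        have "norm (?G (z x) * ((- w x)^K * ?k (z x))) \<le> (C / (1 + x^2)) * (exp (- 2 * pi) ^ K * 2)"
          unfolding norm_mult norm_power norm_minus_cancel nw z_def
          using nk[of x] C0 by (intro mult_mono decay) (auto simp: z_def add_nonneg_nonneg)
        thus ?thesis by (simp add: mult_ac)
      qed
      have meas_rest: "(\<lambda>x. ?G (z x) * ((- w x)^K * ?k (z x))) \<in> borel_measurable borel"
      proof -
        have "(\<lambda>x. (- w x)^K) \<in> borel_measurable borel"
          by (intro borel_measurable_continuous_onI continuous_intros cont_w)
        hence "(\<lambda>x. (- w x)^K * (?G (z x) * ?k (z x))) \<in> borel_measurable borel"
          using meas_k by (rule borel_measurable_times)
        thus ?thesis by (simp add: mult_ac)
      qed
      have "A = (LBINT x. (\<Sum>j<K. (-1)^j * (?G (z x) * w x ^ j)) + ?G (z x) * ((- w x)^K * ?k (z x)))"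
        unfolding A_def
      proof (rule Bochner_Integration.integral_cong)
        fix x
        have "?G (z x) * ?k (z x) = ?G (z x) * ((\<Sum>j<K. (- w x)^j) + (- w x)^K * ?k (z x))"
          using k_rec[of x K] by metis
        also have "(\<Sum>j<K. (- w x)^j) = (\<Sum>j<K. (-1)^j * w x ^ j)"
          by (intro sum.cong refl) (simp add: power_minus[of "w x"])
        finally show "?G (z x) * ?k (z x) = (\<Sum>j<K. (-1)^j * (?G (z x) * w x ^ j)) + ?G (z x) * ((- w x)^K * ?k (z x))"
          by (simp add: distrib_left sum_distrib_left mult_ac)
      qed simp
      also have "\<dots> = (\<Sum>j<K. (-1)^j * of_real (I j)) + (LBINT x. ?G (z x) * ((- w x)^K * ?k (z x)))"
        using int_w I integrable_quadratic_decay[OF meas_rest int_rest]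
        by (subst Bochner_Integration.integral_add)
           (auto simp: Bochner_Integration.integral_sum intro!: Bochner_Integration.integrable_sum integrable_mult_right)
      finally have "(\<Sum>j<K. (-1)^j * of_real (I j)) - A = - (LBINT x. ?G (z x) * ((- w x)^K * ?k (z x)))" by simp
      thus ?thesis using norm_integral_quadratic_decay[OF meas_rest int_rest] by (simp only: norm_minus_cancel)
    qed
    moreover have "(\<lambda>K. (2 * C * exp (- 2 * pi) ^ K) * arctan_mass) \<longlonglongrightarrow> 0"
    proof -
      have "(\<lambda>K. exp (- 2 * pi) ^ K) \<longlonglongrightarrow> (0::real)" by (rule LIMSEQ_power_zero) simp
      from tendsto_mult_right[OF this, of "2 * C * arctan_mass"] show ?thesis by (simp add: mult_ac)
    qed
    ultimately have "(\<lambda>K. (\<Sum>j<K. (-1)^j * of_real (I j)) - A) \<longlonglongrightarrow> 0"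
      by (rule Lim_null_comparison[OF always_eventually[OF allI]])
    thus ?thesis unfolding sums_def by (simp add: LIM_zero_iff)
  qed
  have "(LBINT x. ?G (Complex x (- 1)) * ?k (Complex x (- 1))) = (LBINT x. ?G (z x) * (1 - ?k (z x)))"
  proof -
    have "(LBINT x. ?G (Complex x (- 1)) * ?k (Complex x (- 1))) =
        \<bar>- 1\<bar> *\<^sub>R (LBINT x. ?G (Complex (0 + (- 1) * x) (- 1)) * ?k (Complex (0 + (- 1) * x) (- 1)))"
      by (rule lborel_integral_real_affine) simp
    also have "\<dots> = (LBINT x. ?G (- z x) * ?k (- z x))"
      by (simp add: z_def Complex_eq)
    also have "\<dots> = (LBINT x. ?G (z x) * (1 - ?k (z x)))"
      by (subst half_int_kernel_reflect) (auto simp: z_def gaussian_minus)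
    finally show ?thesis .
  qed
  also have "\<dots> = (LBINT x. ?G (z x) * w x ^ 0 - ?G (z x) * ?k (z x))"
    by (simp add: algebra_simps)
  also have "\<dots> = of_real (I 0) - A"
  proof -
    have "norm (?G (z x) * ?k (z x)) \<le> (C * 2) / (1 + x^2)" for x
    proof -
      have "norm (?G (z x) * ?k (z x)) \<le> (C / (1 + x^2)) * 2"
        unfolding norm_mult z_def
        using nk[of x] C0 by (intro mult_mono decay) (auto simp: z_def add_nonneg_nonneg)
      thus ?thesis by simp
    qed
    hence "integrable lborel (\<lambda>x. ?G (z x) * ?k (z x))" by (rule integrable_quadratic_decay[OF meas_k])
    thus ?thesis using int_w[of 0] I[of 0] unfolding A_def
      by (subst Bochner_Integration.integral_diff) simp_all
  qed
  finally have "half_int_pair_sum ?G sums (A - (of_real (I 0) - A))"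
    using P(1) by (simp add: A_def z_def)
  hence s: "half_int_pair_sum ?G sums (2 * A - of_real (I 0))" by (simp add: algebra_simps)
  have hps: "half_int_pair_sum ?G n = of_real (2 * exp (- pi * lam * half_int n ^ 2))" for n
    unfolding half_int_pair_sum_def gaussian_of_real by simp
  have "(\<lambda>j. Re ((-1)^j * of_real (I j))) sums Re A" by (rule sums_Re[OF A_sums])
  moreover have "Re ((-1)^j * of_real (I j)) = (-1)^j * I j" for j
    by (cases "even j") auto
  ultimately have "(\<lambda>j. (-1)^j * I j) sums Re A" by simp
  hence "(\<lambda>j. lam powr (1/2) * ((-1)^j * I j)) sums (lam powr (1/2) * Re A)" by (rule sums_mult)
  moreover have "lam powr (1/2) * ((-1)^j * I j) = (-1)^j * exp (- pi * real j ^ 2 / lam)" for j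
    using assms powr_add[of lam "1/2" "-1/2"] by (simp add: I_def)
  ultimately have sums: "(\<lambda>j. (-1)^j * exp (- pi * real j ^ 2 / lam)) sums (lam powr (1/2) * Re A)" by simp
  thus "summable (\<lambda>j. (-1)^j * exp (- pi * real j ^ 2 / lam))" by (rule sums_summable)
  have "(\<lambda>n. 2 * exp (- pi * lam * half_int n ^ 2)) sums Re (2 * A - of_real (I 0))"
    using sums_Re[OF s] unfolding hps by simp
  hence "(\<Sum>n. 2 * exp (- pi * lam * half_int n ^ 2)) = 2 * Re A - I 0"
    by (simp add: sums_iff)
  also have "\<dots> = lam powr (-1/2) * (2 * (lam powr (1/2) * Re A) - 1)"
    using assms powr_add[of lam "-1/2" "1/2"] by (simp add: I_def algebra_simps flip: mult.assoc)
  finally show "(\<Sum>n. 2 * exp (- pi * lam * half_int n ^ 2)) =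
           lam powr (-1/2) * (2 * (\<Sum>j. (-1)^j * exp (- pi * real j ^ 2 / lam)) - 1)"
    using sums by (simp add: sums_iff)
qed

lemma has_sum_int_pairs:
  fixes b :: "int \<Rightarrow> 'a :: banach"
  assumes "summable (\<lambda>n. norm (b (int n)))" "summable (\<lambda>n. norm (b (- int n - 1)))"
  shows "(b has_sum (\<Sum>n. b (int n) + b (- int n - 1))) UNIV"
proof -
  let ?p = int and ?q = "\<lambda>n. - int n - 1"
  have 1: "(b has_sum (\<Sum>n. b (?p n))) (range ?p)"
    using norm_summable_imp_has_sum[OF assms(1) summable_sums[OF summable_norm_cancel[OF assms(1)]]]
    by (subst has_sum_reindex) (auto simp: o_def inj_on_def)
  have 2: "(b has_sum (\<Sum>n. b (?q n))) (range ?q)"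
    using norm_summable_imp_has_sum[OF assms(2) summable_sums[OF summable_norm_cancel[OF assms(2)]]]
    by (subst has_sum_reindex) (auto simp: o_def inj_on_def)
  have "range ?p \<inter> range ?q = {}" by auto
  from has_sum_Un_disjoint[OF 1 2 this]
  have "(b has_sum ((\<Sum>n. b (?p n)) + (\<Sum>n. b (?q n)))) (range ?p \<union> range ?q)" .
  moreover have "range ?p \<union> range ?q = UNIV"
  proof -
    have "m \<in> range ?p \<union> range ?q" for m :: int
    proof (cases "m \<ge> 0")
      case True thus ?thesis by (auto intro!: image_eqI[of m ?p "nat m"])
    next
      case False thus ?thesis by (auto intro!: image_eqI[of m ?q "nat (- m - 1)"])
    qed
    thus ?thesis by blast
  qed
  ultimately show ?thesis
    using suminf_add[OF summable_norm_cancel[OF assms(1)] summable_norm_cancel[OF assms(2)]] by simp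
qed

theorem half_int_gaussian_sum_eq_theta2:
  assumes "lam > 0"
  shows "(\<Sum>n. 2 * exp (- pi * lam * half_int n ^ 2)) = lam powr (-1/2) * Re (theta2 0 (\<i> * of_real (1 / lam)))"
proof -
  define a where "a = (\<lambda>j::nat. (-1)^j * exp (- pi * real j ^ 2 / lam))"
  have sa: "summable a" unfolding a_def by (rule gaussian_half_int_poisson(1)[OF assms])
  have sna: "summable (\<lambda>j. norm (a j))"
  proof -
    have c: "pi / lam > 0" using assms by simp
    have "summable (\<lambda>n. (exp (- (pi / lam))) ^ n)" by (rule summable_geometric) (use c in simp)
    thus ?thesis
    proof (rule summable_comparison_test')
      fix n
      have "real n \<le> real n ^ 2" by (cases n) (auto simp: power2_eq_square)
      hence "(pi / lam) * real n \<le> (pi / lam) * real n ^ 2" using c by (intro mult_left_mono) auto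
      thus "norm (norm (a n)) \<le> exp (- (pi / lam)) ^ n"
        unfolding exp_of_nat_mult[symmetric] by (simp add: a_def abs_mult power_abs mult_ac)
    qed
  qed
  define b where "b = (\<lambda>n::int. complex_of_real (a (nat \<bar>n\<bar>)))"
  have b: "(-1) powi n * exp (of_real pi * \<i> * (\<i> * of_real (1 / lam))) powi (n\<^sup>2) * exp (2 * of_real pi * \<i> * (of_int n * 0)) = b n" for n :: int
  proof -
    define m where "m = nat \<bar>n\<bar>"
    have n2: "n\<^sup>2 = int (m^2)" by (simp add: m_def)
    have s: "(-1) powi n = ((-1)^m :: complex)"
      unfolding m_def power_int_def by simp
    have "of_real pi * \<i> * (\<i> * of_real (1 / lam)) = complex_of_real (- pi / lam)"
      by (simp add: complex_eq_iff)
    hence e: "exp (of_real pi * \<i> * (\<i> * of_real (1 / lam))) = complex_of_real (exp (- pi / lam))"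
      by (simp only: exp_of_real)
    have p: "exp (- pi / lam) ^ (m^2) = exp (- pi * real m ^ 2 / lam)"
      by (simp add: exp_of_nat_mult[symmetric])
    hence "complex_of_real (exp (- pi / lam)) ^ (m^2) = of_real (exp (- pi * real m ^ 2 / lam))"
      by (metis of_real_power)
    moreover have "b n = of_real ((-1)^m * exp (- pi * real m ^ 2 / lam))" by (simp only: b_def a_def m_def)
    ultimately show ?thesis unfolding e n2 s power_int_of_nat by simp
  qed
  have "(b has_sum (\<Sum>n. b (int n) + b (- int n - 1))) UNIV"
  proof (rule has_sum_int_pairs)
    show "summable (\<lambda>n. norm (b (int n)))" using sna by (simp add: b_def)
    have "nat \<bar>- int n - 1\<bar> = Suc n" for n by simp
    hence "norm (b (- int n - 1)) = norm (a (Suc n))" for n by (simp only: b_def norm_of_real real_norm_def)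
    moreover have "summable (\<lambda>n. norm (a (Suc n)))"
      using sna summable_Suc_iff[of "\<lambda>n. norm (a n)"] by blast
    ultimately show "summable (\<lambda>n. norm (b (- int n - 1)))" by simp
  qed
  hence "theta2 0 (\<i> * of_real (1 / lam)) = (\<Sum>n. b (int n) + b (- int n - 1))"
    unfolding theta2_def b by (rule infsumI)
  also have "\<dots> = (\<Sum>n. complex_of_real (a n + a (Suc n)))"
  proof -
    have "nat \<bar>- int n - 1\<bar> = Suc n" for n by simp
    thus ?thesis unfolding b_def by simp
  qed
  also have "\<dots> = complex_of_real (\<Sum>n. a n + a (Suc n))"
    by (rule suminf_of_real[symmetric]) (intro summable_add sa summable_Suc_iff[THEN iffD2])
  also have "(\<Sum>n. a n + a (Suc n)) = (\<Sum>n. a n) + (\<Sum>n. a (Suc n))"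
    by (intro suminf_add[symmetric] sa summable_Suc_iff[THEN iffD2])
  also have "(\<Sum>n. a (Suc n)) = (\<Sum>n. a n) - 1"
    using suminf_split_head[OF sa] by (simp add: a_def)
  finally have "Re (theta2 0 (\<i> * of_real (1 / lam))) = 2 * (\<Sum>j. a j) - 1" by simp
  thus ?thesis using gaussian_half_int_poisson(2)[OF assms] by (simp add: a_def)
qed

section \<open>Monotonicity of the theta function\<close>

lemma DERIV_nonpos_if_locally_nonincreasing:
  fixes f :: "real \<Rightarrow> real"
  assumes "(f has_real_derivative D) (at x)" "d > 0"
    and "\<And>y. x < y \<Longrightarrow> y < x + d \<Longrightarrow> f y \<le> f x"
  shows "D \<le> 0"
proof (rule ccontr)
  assume "\<not> D \<le> 0"
  then obtain e where e: "e > 0" "\<And>h. h > 0 \<Longrightarrow> h < e \<Longrightarrow> f x < f (x + h)"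
    using DERIV_pos_inc_right[OF assms(1)] by auto
  define h where "h = min d e / 2"
  have "h > 0" "h < e" "h < d" using e(1) assms(2) by (auto simp: h_def)
  thus False using e(2)[of h] assms(3)[of "x + h"] by simp
qed

definition half_int_theta :: "real \<Rightarrow> real" where
  "half_int_theta \<mu> = (\<Sum>n. exp (- pi * \<mu> * half_int n ^ 2))"

text \<open>
  If \<open>\<theta>\<close> denotes \<open>half_int_theta\<close>, this is \<open>\<theta> \<mu> + 2 \<mu> \<theta>' \<mu>\<close>, which is \<open>2 \<surd>\<mu>\<close> times the derivative
  of \<open>\<surd>\<mu> \<theta> \<mu>\<close>.
\<close>

definition half_int_theta_defect :: "real \<Rightarrow> real" where
  "half_int_theta_defect \<mu> = (\<Sum>n. exp (- pi * \<mu> * half_int n ^ 2) * (1 - 2 * pi * \<mu> * half_int n ^ 2))"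

lemma
  assumes "\<mu> > 0"
  shows summable_half_int_theta: "summable (\<lambda>n. exp (- pi * \<mu> * half_int n ^ 2))"
    and summable_half_int_theta_moment: "summable (\<lambda>n. half_int n ^ 2 * exp (- pi * \<mu> * half_int n ^ 2))"
    and summable_half_int_theta_defect:
      "summable (\<lambda>n. exp (- pi * \<mu> * half_int n ^ 2) * (1 - 2 * pi * \<mu> * half_int n ^ 2))"
proof -
  have c: "pi * \<mu> > 0" using assms by simp
  show 1: "summable (\<lambda>n. exp (- pi * \<mu> * half_int n ^ 2))"
    using summable_half_int_gaussian[OF c] by simp
  show 2: "summable (\<lambda>n. half_int n ^ 2 * exp (- pi * \<mu> * half_int n ^ 2))"
    using summable_half_int_gaussian_moment[OF c, of 1] by simp
  have "summable (\<lambda>n. exp (- pi * \<mu> * half_int n ^ 2) - 2 * pi * \<mu> * (half_int n ^ 2 * exp (- pi * \<mu> * half_int n ^ 2)))"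
    by (intro summable_diff summable_mult 1 2)
  thus "summable (\<lambda>n. exp (- pi * \<mu> * half_int n ^ 2) * (1 - 2 * pi * \<mu> * half_int n ^ 2))"
    by (simp add: algebra_simps)
qed

lemma half_int_theta_has_derivative:
  assumes "\<mu> > 0"
  shows "(half_int_theta has_real_derivative (\<Sum>n. - pi * half_int n ^ 2 * exp (- pi * \<mu> * half_int n ^ 2))) (at \<mu>)"
proof -
  let ?S = "{\<mu> / 2..}"
  have "((\<lambda>x. \<Sum>n. exp (- pi * x * half_int n ^ 2)) has_real_derivative
          (\<Sum>n. - pi * half_int n ^ 2 * exp (- pi * \<mu> * half_int n ^ 2))) (at \<mu>)"
  proof (rule has_field_derivative_series'(2)[where S = ?S and ?x0.0 = \<mu>])
    show "((\<lambda>x. exp (- pi * x * half_int n ^ 2)) has_real_derivative - pi * half_int n ^ 2 * exp (- pi * x * half_int n ^ 2)) (at x within ?S)" for n x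
      by (auto intro!: derivative_eq_intros)
    show "uniformly_convergent_on ?S (\<lambda>n x. \<Sum>i<n. - pi * half_int i ^ 2 * exp (- pi * x * half_int i ^ 2))"
    proof (rule Weierstrass_m_test')
      fix n x assume "x \<in> ?S"
      hence "\<mu> / 2 \<le> x" by simp
      hence "pi * (\<mu> / 2) * half_int n ^ 2 \<le> pi * x * half_int n ^ 2"
        by (intro mult_right_mono mult_left_mono) auto
      thus "norm (- pi * half_int n ^ 2 * exp (- pi * x * half_int n ^ 2)) \<le> pi * (half_int n ^ 2 * exp (- pi * (\<mu> / 2) * half_int n ^ 2))"
        by (simp add: abs_mult mult_left_mono)
    next
      show "summable (\<lambda>n. pi * (half_int n ^ 2 * exp (- pi * (\<mu> / 2) * half_int n ^ 2)))"
        using assms by (intro summable_mult summable_half_int_theta_moment) simp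
    qed
    show "summable (\<lambda>n. exp (- pi * \<mu> * half_int n ^ 2))" by (rule summable_half_int_theta[OF assms])
    show "\<mu> \<in> interior ?S" using assms by simp
  qed (use assms in auto)
  thus ?thesis by (simp add: half_int_theta_def[abs_def])
qed

text \<open>
  After the constant term the series is a sum of pairs \<open>q\<^sup>b - q\<^sup>a\<close> with \<open>a = (2 i + 1)\<^sup>2\<close> and
  \<open>b = (2 i + 2)\<^sup>2\<close>. Here \<open>b \<le> 4 a\<close> and \<open>b - a \<ge> 3\<close>, so that the derivative of such a pair is nonpositive
  as long as \<open>q\<^sup>3 \<le> 1/4\<close>.
\<close>

lemma alternating_theta_antimono:
  assumes s: "summable (\<lambda>j. (-1)^j * p ^ (j^2))" "summable (\<lambda>j. (-1)^j * q ^ (j^2))"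
    and "0 \<le> p" "p \<le> q" "q \<le> (1/2 :: real)"
  shows "(\<Sum>j. (-1)^j * q ^ (j^2)) \<le> (\<Sum>j. (-1)^j * p ^ (j^2))"
proof -
  define a where "a = (\<lambda>x::real. \<lambda>j::nat. (-1)^j * x ^ (j^2))"
  define h where "h = (\<lambda>x::real. \<lambda>i::nat. x ^ ((2*i+2)^2) - x ^ ((2*i+1)^2))"
  have pairs: "(\<Sum>j. a x j) = 1 + (\<Sum>i. h x i) \<and> summable (h x)" if "summable (a x)" for x
  proof -
    have "(\<lambda>j. a x (Suc j)) sums ((\<Sum>j. a x j) - a x 0)"
      using that by (simp add: sums_Suc_iff summable_sums)
    from sums_group[OF this, of 2]
    have "(\<lambda>i. \<Sum>j\<in>{i * 2..<i * 2 + 2}. a x (Suc j)) sums ((\<Sum>j. a x j) - a x 0)" by simp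
    moreover have "(\<Sum>j\<in>{i * 2..<i * 2 + 2}. a x (Suc j)) = h x i" for i
    proof -
      have "{i * 2..<i * 2 + 2} = {2 * i, 2 * i + 1}" by auto
      thus ?thesis by (simp add: a_def h_def)
    qed
    ultimately have "h x sums ((\<Sum>j. a x j) - a x 0)" by simp
    thus ?thesis by (simp add: sums_iff a_def)
  qed
  have "h q i \<le> h p i" for i
  proof (rule DERIV_nonpos_imp_nonincreasing[OF assms(4)])
    fix x assume x: "p \<le> x" "x \<le> q"
    define m where "m = (2*i+1)^2"
    have m: "(2*i+2)^2 = m + (4*i+3)" by (simp add: m_def power2_eq_square)
    have m1: "m \<ge> 1" by (simp add: m_def)
    have m4: "m + (4*i+3) \<le> 4 * m" by (simp add: m_def power2_eq_square algebra_simps)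
    have "((\<lambda>x. h x i) has_real_derivative real (m + (4*i+3)) * x ^ (m + (4*i+3) - 1) - real m * x ^ (m - 1)) (at x)"
      unfolding h_def m m_def[symmetric] by (auto intro!: derivative_eq_intros)
    moreover have "real (m + (4*i+3)) * x ^ (m + (4*i+3) - 1) \<le> real m * x ^ (m - 1)"
    proof -
      have x0: "0 \<le> x" "x \<le> 1/2" using x assms by auto
      have "x ^ (4*i+3) \<le> x ^ 3" using x0 by (intro power_decreasing) auto
      also have "\<dots> \<le> (1/2) ^ 3" using x0 by (intro power_mono) auto
      finally have "x ^ (4*i+3) \<le> 1/4" by (simp add: power3_eq_cube)
      hence "real (m + (4*i+3)) * x ^ (4*i+3) \<le> real (4 * m) * (1/4)"
        using m4 x0 by (intro mult_mono) (auto simp del: of_nat_add of_nat_mult)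
      hence "(real (m + (4*i+3)) * x ^ (4*i+3)) * x ^ (m - 1) \<le> real m * x ^ (m - 1)"
        using x0 by (intro mult_right_mono) auto
      moreover have eq: "m + (4*i+3) - 1 = (4*i+3) + (m - 1)" using m1 by simp
      ultimately show ?thesis unfolding eq power_add[of x "4*i+3"] mult.assoc by blast
    qed
    ultimately show "\<exists>y. ((\<lambda>x. h x i) has_real_derivative y) (at x) \<and> y \<le> 0" by force
  qed
  hence "(\<Sum>i. h q i) \<le> (\<Sum>i. h p i)" using pairs s by (intro suminf_le) (auto simp: a_def)
  thus ?thesis using pairs[of p] pairs[of q] s by (simp add: a_def)
qed

lemma exp_minus_pi_squared_half_le: "exp (- (pi^2 / 2)) \<le> 1/2"
proof -
  have "1 \<le> pi^2 / 2" using pi_gt3 power_mono[of 3 pi 2] by simp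
  hence "2 \<le> 1 + pi^2 / 2" by simp
  also have "\<dots> \<le> exp (pi^2 / 2)" by (rule exp_ge_add_one_self)
  finally show ?thesis by (simp add: exp_minus field_simps)
qed

text \<open>
  For \<open>\<mu> \<ge> 2 / \<pi>\<close> every term is nonpositive, because a half-integer has modulus at least \<open>1/2\<close>. For
  smaller \<open>\<mu>\<close>, Poisson summation writes \<open>\<surd>\<mu> \<theta> \<mu>\<close> as an alternating theta series in
  \<open>q = exp (- \<pi> / \<mu>)\<close>; as \<open>q\<close> increases with \<open>\<mu>\<close> and stays below \<open>exp (- \<pi>\<^sup>2 / 2) \<le> 1/2\<close>, this
  series decreases in \<open>\<mu>\<close>, and so the derivative of \<open>\<surd>\<mu> \<theta> \<mu>\<close> is nonpositive.
\<close>

theorem half_int_theta_defect_nonpos: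
  assumes "\<mu> > 0"
  shows "half_int_theta_defect \<mu> \<le> 0"
proof (cases "\<mu> \<ge> 2 / pi")
  case True
  have "exp (- pi * \<mu> * half_int n ^ 2) * (1 - 2 * pi * \<mu> * half_int n ^ 2) \<le> 0" for n
  proof -
    have "(1/2)^2 \<le> half_int n ^ 2" by (intro power_mono) (auto simp: half_int_def)
    moreover have "2 * pi * \<mu> \<ge> 4" using True by (simp add: field_simps)
    ultimately have "4 * (1/2)^2 \<le> 2 * pi * \<mu> * half_int n ^ 2" by (intro mult_mono) auto
    hence "1 - 2 * pi * \<mu> * half_int n ^ 2 \<le> 0" by (simp add: power2_eq_square)
    thus ?thesis by (simp add: mult_nonneg_nonpos)
  qed
  thus ?thesis unfolding half_int_theta_defect_def
    using suminf_le[OF _ summable_half_int_theta_defect[OF assms] summable_zero] by simp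
next
  case False
  have poisson: "2 * (sqrt x * half_int_theta x) = 2 * (\<Sum>j. (-1)^j * exp (- pi / x) ^ (j^2)) - 1"
    "summable (\<lambda>j. (-1)^j * exp (- pi / x) ^ (j^2))" if "x > 0" for x
  proof -
    have e: "exp (- pi * real j ^ 2 / x) = exp (- pi / x) ^ (j^2)" for j
      by (simp add: exp_of_nat_mult[symmetric])
    show "summable (\<lambda>j. (-1)^j * exp (- pi / x) ^ (j^2))"
      using gaussian_half_int_poisson(1)[OF that] unfolding e .
    have "(\<Sum>n. 2 * exp (- pi * x * half_int n ^ 2)) = 2 * half_int_theta x"
      unfolding half_int_theta_def by (rule suminf_mult[OF summable_half_int_theta[OF that]])
    hence "2 * half_int_theta x = x powr (-1/2) * (2 * (\<Sum>j. (-1)^j * exp (- pi / x) ^ (j^2)) - 1)"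
      using gaussian_half_int_poisson(2)[OF that] unfolding e by simp
    hence "sqrt x * (2 * half_int_theta x) = (sqrt x * x powr (-1/2)) * (2 * (\<Sum>j. (-1)^j * exp (- pi / x) ^ (j^2)) - 1)"
      by simp
    also have "sqrt x * x powr (-1/2) = 1"
      using that by (simp add: powr_minus_divide powr_half_sqrt)
    finally show "2 * (sqrt x * half_int_theta x) = 2 * (\<Sum>j. (-1)^j * exp (- pi / x) ^ (j^2)) - 1" by simp
  qed
  let ?D = "\<Sum>n. - pi * half_int n ^ 2 * exp (- pi * \<mu> * half_int n ^ 2)"
  have "((\<lambda>x. sqrt x * half_int_theta x) has_real_derivative (inverse (sqrt \<mu>) / 2 * half_int_theta \<mu> + ?D * sqrt \<mu>)) (at \<mu>)"
    by (rule DERIV_mult[OF DERIV_real_sqrt[OF assms] half_int_theta_has_derivative[OF assms]])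
  hence "inverse (sqrt \<mu>) / 2 * half_int_theta \<mu> + ?D * sqrt \<mu> \<le> 0"
  proof (rule DERIV_nonpos_if_locally_nonincreasing)
    show "2 / pi - \<mu> > 0" using False by simp
    fix y assume y: "\<mu> < y" "y < \<mu> + (2 / pi - \<mu>)"
    have y0: "y > 0" using y assms by simp
    have "(\<Sum>j. (-1)^j * exp (- pi / y) ^ (j^2)) \<le> (\<Sum>j. (-1)^j * exp (- pi / \<mu>) ^ (j^2))"
    proof (rule alternating_theta_antimono[OF poisson(2)[OF assms] poisson(2)[OF y0]])
      show "exp (- pi / \<mu>) \<le> exp (- pi / y)" using y assms by (simp add: frac_le)
      have "pi^2 / 2 \<le> pi / y" using y y0 by (simp add: field_simps power2_eq_square)
      hence "exp (- pi / y) \<le> exp (- (pi^2 / 2))" by simp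
      thus "exp (- pi / y) \<le> 1/2" using exp_minus_pi_squared_half_le by linarith
    qed simp
    thus "sqrt y * half_int_theta y \<le> sqrt \<mu> * half_int_theta \<mu>"
      using poisson(1)[OF assms] poisson(1)[OF y0] by linarith
  qed
  hence "2 * sqrt \<mu> * (inverse (sqrt \<mu>) / 2 * half_int_theta \<mu> + ?D * sqrt \<mu>) \<le> 0"
    using assms by (intro mult_nonneg_nonpos) auto
  also have "2 * sqrt \<mu> * (inverse (sqrt \<mu>) / 2 * half_int_theta \<mu> + ?D * sqrt \<mu>)
      = (sqrt \<mu> * inverse (sqrt \<mu>)) * half_int_theta \<mu> + 2 * (sqrt \<mu> * sqrt \<mu>) * ?D"
    by (simp add: algebra_simps)
  also have "\<dots> = half_int_theta \<mu> + 2 * \<mu> * ?D" using assms by simp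
  also have "\<dots> = half_int_theta_defect \<mu>"
  proof -
    have sD: "summable (\<lambda>n. - pi * half_int n ^ 2 * exp (- pi * \<mu> * half_int n ^ 2))"
      using summable_mult[OF summable_half_int_theta_moment[OF assms], of "- pi"] by (simp add: mult.assoc)
    have "half_int_theta \<mu> + 2 * \<mu> * ?D =
        (\<Sum>n. exp (- pi * \<mu> * half_int n ^ 2) + 2 * \<mu> * (- pi * half_int n ^ 2 * exp (- pi * \<mu> * half_int n ^ 2)))"
      unfolding half_int_theta_def
      using suminf_add[OF summable_half_int_theta[OF assms] summable_mult[OF sD, of "2 * \<mu>"]] suminf_mult[OF sD, of "2 * \<mu>"]
      by simp
    also have "\<dots> = half_int_theta_defect \<mu>"
      unfolding half_int_theta_defect_def by (intro suminf_cong) (simp add: algebra_simps)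
    finally show ?thesis .
  qed
  finally show ?thesis .
qed

section \<open>The interpolating minorant as a series of sinc products\<close>

definition minorant_coeff :: "real \<Rightarrow> nat \<Rightarrow> real" where
  "minorant_coeff lam n = exp (- pi * lam * half_int n ^ 2)"

text \<open>
  The contributions of \<open>n + 1/2\<close> and \<open>- (n + 1/2)\<close> to the interpolation formula. The cosine cancels the
  poles, and the two terms with the derivative of the Gaussian combine into a product of two sinc
  functions. In this form each summand is entire and decays quadratically on the real line.
\<close>

definition minorant_term :: "real \<Rightarrow> nat \<Rightarrow> complex \<Rightarrow> complex" where
  "minorant_term lam n z = of_real (minorant_coeff lam n) *
     (sinc_pi (z - of_real (half_int n)) ^ 2 + sinc_pi (z + of_real (half_int n)) ^ 2 +
      of_real (4 * pi * lam * half_int n ^ 2) *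
        (sinc_pi (z - of_real (half_int n)) * sinc_pi (z + of_real (half_int n))))"

definition minorant_series :: "real \<Rightarrow> complex \<Rightarrow> complex" where
  "minorant_series lam z = (\<Sum>n. minorant_term lam n z)"

lemma sin_pi_shift_half_int:
  fixes z :: complex
  shows
  "sin (of_real pi * (z - of_real (half_int n))) = - ((-1)^n * cos (of_real pi * z))"
  "sin (of_real pi * (z + of_real (half_int n))) = (-1)^n * cos (of_real pi * z)"
proof -
  have h: "of_real pi * of_real (half_int n) = (of_real (pi / 2 + real n * pi) :: complex)"
    by (simp add: half_int_def algebra_simps)
  have s: "sin (of_real (pi / 2 + real n * pi) :: complex) = (-1)^n"
    unfolding sin_of_real by (simp add: sin_add)
  have c: "cos (of_real (pi / 2 + real n * pi) :: complex) = 0"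
    unfolding cos_of_real by (simp add: cos_add)
  show "sin (of_real pi * (z - of_real (half_int n))) = - ((-1)^n * cos (of_real pi * z))"
    unfolding right_diff_distrib h sin_diff s c by simp
  show "sin (of_real pi * (z + of_real (half_int n))) = (-1)^n * cos (of_real pi * z)"
    unfolding distrib_left h sin_add s c by simp
qed

lemma sinc_pi_shift_half_int:
  "z \<noteq> of_real (half_int n) \<Longrightarrow>
     sinc_pi (z - of_real (half_int n)) = - ((-1)^n * cos (of_real pi * z)) / (of_real pi * (z - of_real (half_int n)))"
  "z \<noteq> - of_real (half_int n) \<Longrightarrow>
     sinc_pi (z + of_real (half_int n)) = (-1)^n * cos (of_real pi * z) / (of_real pi * (z + of_real (half_int n)))"
proof -
  show "sinc_pi (z - of_real (half_int n)) = - ((-1)^n * cos (of_real pi * z)) / (of_real pi * (z - of_real (half_int n)))"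
    if "z \<noteq> of_real (half_int n)"
    using that unfolding sinc_pi_def sin_pi_shift_half_int by simp
  show "sinc_pi (z + of_real (half_int n)) = (-1)^n * cos (of_real pi * z) / (of_real pi * (z + of_real (half_int n)))"
    if "z \<noteq> - of_real (half_int n)"
    using that unfolding sinc_pi_def sin_pi_shift_half_int by (simp add: eq_neg_iff_add_eq_0)
qed

lemma minorant_term_eq:
  assumes "z \<noteq> of_real (half_int n)" "z \<noteq> - of_real (half_int n)"
  shows "minorant_term lam n z = (cos (of_real pi * z) / of_real pi)^2 * (of_real (minorant_coeff lam n) *
     (1 / (z - of_real (half_int n))^2 + 1 / (z + of_real (half_int n))^2 -
      of_real (4 * pi * lam * half_int n ^ 2) / ((z - of_real (half_int n)) * (z + of_real (half_int n)))))"
proof -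
  define c e a b where "c = cos (of_real pi * z) / of_real pi" and "e = ((-1)^n :: complex)"
    and "a = z - of_real (half_int n)" and "b = z + of_real (half_int n)"
  have ee: "e * e = 1" unfolding e_def by (simp flip: power_mult_distrib)
  have ab: "sinc_pi a = - (e * c) / a" "sinc_pi b = e * c / b"
    unfolding a_def b_def e_def c_def sinc_pi_shift_half_int(1)[OF assms(1)]
      sinc_pi_shift_half_int(2)[OF assms(2)] by (simp_all add: divide_simps)
  have sq: "(sinc_pi a)^2 = c^2 * (1 / a^2)" "(sinc_pi b)^2 = c^2 * (1 / b^2)"
    "sinc_pi a * sinc_pi b = - (c^2 * (1 / (a * b)))"
  proof -
    have "(- (e * c) / a)^2 = (e * e) * (c^2 * (1 / a^2))" "(e * c / b)^2 = (e * e) * (c^2 * (1 / b^2))"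
      "(- (e * c) / a) * (e * c / b) = - ((e * e) * (c^2 * (1 / (a * b))))"
      by (simp_all add: power2_eq_square)
    thus "(sinc_pi a)^2 = c^2 * (1 / a^2)" "(sinc_pi b)^2 = c^2 * (1 / b^2)"
      "sinc_pi a * sinc_pi b = - (c^2 * (1 / (a * b)))"
      unfolding ab ee by simp_all
  qed
  show ?thesis
    unfolding minorant_term_def a_def[symmetric] b_def[symmetric] c_def[symmetric] sq
    by (simp add: algebra_simps)
qed

text \<open>
  A common bound \<open>B\<close> for the squares of the two sinc values in \<open>minorant_term\<close> bounds the whole
  summand by \<open>minorant_weight lam n * B\<close>.
\<close>

definition minorant_weight :: "real \<Rightarrow> nat \<Rightarrow> real" where
  "minorant_weight lam n = minorant_coeff lam n * (2 + 4 * pi * lam * half_int n ^ 2)"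

lemma
  assumes "lam > 0"
  shows summable_minorant_weight: "summable (minorant_weight lam)"
    and summable_minorant_weight_moment: "summable (\<lambda>n. minorant_weight lam n * (1 + half_int n ^ 2))"
    and minorant_weight_nonneg: "minorant_weight lam n \<ge> 0"
    and minorant_coeff_le_weight: "minorant_coeff lam n \<le> minorant_weight lam n"
proof -
  have c: "pi * lam > 0" using assms by simp
  have s: "summable (\<lambda>n. half_int n ^ (2 * j) * minorant_coeff lam n)" for j
    using summable_half_int_gaussian_moment[OF c, of j] by (simp add: minorant_coeff_def)
  have "summable (\<lambda>n. 2 * (half_int n ^ (2 * 0) * minorant_coeff lam n) + 4 * pi * lam * (half_int n ^ (2 * 1) * minorant_coeff lam n))"
    by (intro summable_add summable_mult s)
  thus 1: "summable (minorant_weight lam)"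
    by (rule summable_cong[THEN iffD1, rotated]) (simp add: minorant_weight_def algebra_simps power2_eq_square)
  have "summable (\<lambda>n. minorant_weight lam n + (2 * (half_int n ^ (2 * 1) * minorant_coeff lam n) + 4 * pi * lam * (half_int n ^ (2 * 2) * minorant_coeff lam n)))"
    by (intro summable_add summable_mult s 1)
  thus "summable (\<lambda>n. minorant_weight lam n * (1 + half_int n ^ 2))"
    by (rule summable_cong[THEN iffD1, rotated]) (simp add: minorant_weight_def algebra_simps power4_eq_xxxx power2_eq_square)
  have m: "minorant_coeff lam n \<ge> 0" by (simp add: minorant_coeff_def)
  have p: "4 * pi * lam * half_int n ^ 2 \<ge> 0" using assms by simp
  show "minorant_weight lam n \<ge> 0" unfolding minorant_weight_def using m p by (intro mult_nonneg_nonneg) auto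
  have "minorant_coeff lam n * 1 \<le> minorant_weight lam n" unfolding minorant_weight_def
    using m p by (intro mult_left_mono) auto
  thus "minorant_coeff lam n \<le> minorant_weight lam n" by simp
qed

lemma norm_minorant_term_le:
  assumes "lam > 0" and "norm (sinc_pi (z - of_real (half_int n))) ^ 2 \<le> B"
    and "norm (sinc_pi (z + of_real (half_int n))) ^ 2 \<le> B"
  shows "norm (minorant_term lam n z) \<le> minorant_weight lam n * B"
proof -
  let ?a = "sinc_pi (z - of_real (half_int n))" and ?b = "sinc_pi (z + of_real (half_int n))"
  let ?c = "4 * pi * lam * half_int n ^ 2"
  have c0: "?c \<ge> 0" using assms by simp
  have "2 * (norm ?a * norm ?b) \<le> norm ?a ^ 2 + norm ?b ^ 2"
    using sum_squares_bound[of "norm ?a" "norm ?b"] by simp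
  hence ab: "norm (?a * ?b) \<le> B" using assms(2,3) by (simp add: norm_mult)
  have "norm (?a^2 + ?b^2 + of_real ?c * (?a * ?b)) \<le> norm (?a^2) + norm (?b^2) + norm (of_real ?c * (?a * ?b))"
    by (intro norm_triangle_le add_mono norm_triangle_ineq order_refl)
  also have "\<dots> \<le> B + B + ?c * B"
    using assms(2,3) ab c0 unfolding norm_mult[of "of_real ?c"] norm_of_real norm_power
    by (intro add_mono mult_mono) auto
  also have "\<dots> = (2 + ?c) * B" by (simp add: algebra_simps)
  finally have "norm (minorant_term lam n z) \<le> minorant_coeff lam n * ((2 + ?c) * B)"
    unfolding minorant_term_def norm_mult[of "of_real (minorant_coeff lam n)"]
    by (simp add: minorant_coeff_def mult_left_mono)
  thus ?thesis by (simp add: minorant_weight_def mult.assoc)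
qed

lemma norm_minorant_term_le_exp:
  assumes "lam > 0"
  shows "norm (minorant_term lam n z) \<le> minorant_weight lam n * exp (2 * pi * \<bar>Im z\<bar>)"
proof (rule norm_minorant_term_le[OF assms])
  have "norm (sinc_pi w) ^ 2 \<le> exp (2 * pi * \<bar>Im z\<bar>)" if "Im w = Im z" for w
  proof -
    have "norm (sinc_pi w) ^ 2 \<le> exp (pi * \<bar>Im w\<bar>) ^ 2"
      by (intro power_mono norm_sinc_pi_le) simp
    thus ?thesis using that by (simp add: exp_double[symmetric] mult.assoc)
  qed
  thus "norm (sinc_pi (z - of_real (half_int n))) ^ 2 \<le> exp (2 * pi * \<bar>Im z\<bar>)"
    "norm (sinc_pi (z + of_real (half_int n))) ^ 2 \<le> exp (2 * pi * \<bar>Im z\<bar>)" by simp_all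
qed

lemma norm_sinc_pi_shift_decay:
  "norm (sinc_pi (of_real (x + h))) ^ 2 \<le> 4 * (1 + h^2) / (1 + x^2)"
proof -
  have "norm (sinc_pi (of_real (x + h))) ^ 2 \<le> 2 / (1 + (x + h)^2)"
    using norm_sinc_pi_power2_le[of "of_real (x + h)"] by (simp del: of_real_add)
  also have "\<dots> \<le> 4 * (1 + h^2) / (1 + x^2)"
  proof -
    have "4 * (1 + h^2) * (1 + (x + h)^2) - 2 * (1 + x^2) = 2 * (x + 2 * h)^2 + 2 + 4 * h^2 * (x + h)^2"
      by (simp add: power2_eq_square algebra_simps)
    moreover have "2 * (x + 2 * h)^2 + 2 + 4 * h^2 * (x + h)^2 \<ge> 0" by (intro add_nonneg_nonneg) auto
    ultimately have "2 * (1 + x^2) \<le> 4 * (1 + h^2) * (1 + (x + h)^2)" by linarith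
    thus ?thesis by (simp add: frac_le_eq divide_simps add_pos_nonneg)
  qed
  finally show ?thesis .
qed

lemma norm_minorant_term_le_decay:
  assumes "lam > 0"
  shows "norm (minorant_term lam n (of_real x)) \<le> minorant_weight lam n * (1 + half_int n ^ 2) * (4 / (1 + x^2))"
proof -
  have "norm (minorant_term lam n (of_real x)) \<le> minorant_weight lam n * (4 * (1 + half_int n ^ 2) / (1 + x^2))"
  proof (rule norm_minorant_term_le[OF assms])
    from norm_sinc_pi_shift_decay[of x "- half_int n"] norm_sinc_pi_shift_decay[of x "half_int n"]
    show "norm (sinc_pi (of_real x - of_real (half_int n))) ^ 2 \<le> 4 * (1 + half_int n ^ 2) / (1 + x^2)"
      "norm (sinc_pi (of_real x + of_real (half_int n))) ^ 2 \<le> 4 * (1 + half_int n ^ 2) / (1 + x^2)"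
      by simp_all
  qed
  thus ?thesis by (simp add: mult_ac)
qed

lemma summable_minorant_term: "lam > 0 \<Longrightarrow> summable (\<lambda>n. minorant_term lam n z)"
  using summable_comparison_test'[OF summable_mult2[OF summable_minorant_weight] norm_minorant_term_le_exp] by blast

lemma holomorphic_minorant_series:
  assumes "lam > 0"
  shows "minorant_series lam holomorphic_on UNIV"
proof (rule holomorphic_uniform_sequence[OF open_UNIV])
  show "(\<lambda>z. \<Sum>n<N. minorant_term lam n z) holomorphic_on UNIV" for N
    unfolding minorant_term_def by (intro holomorphic_intros)
  fix z :: complex
  have "uniform_limit (cball z 1) (\<lambda>N z. \<Sum>n<N. minorant_term lam n z) (minorant_series lam) sequentially"
    unfolding minorant_series_def[abs_def]
  proof (rule Weierstrass_m_test)
    fix n w assume "w \<in> cball z 1"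
    hence "\<bar>Im w\<bar> \<le> \<bar>Im z\<bar> + 1" using abs_Im_le_cmod[of "z - w"] by (simp add: dist_norm)
    hence "minorant_weight lam n * exp (2 * pi * \<bar>Im w\<bar>) \<le> minorant_weight lam n * exp (2 * pi * (\<bar>Im z\<bar> + 1))"
      using minorant_weight_nonneg[OF assms] by (intro mult_left_mono) auto
    thus "norm (minorant_term lam n w) \<le> minorant_weight lam n * exp (2 * pi * (\<bar>Im z\<bar> + 1))"
      using norm_minorant_term_le_exp[OF assms, of n w] by linarith
  next
    show "summable (\<lambda>n. minorant_weight lam n * exp (2 * pi * (\<bar>Im z\<bar> + 1)))"
      by (rule summable_mult2[OF summable_minorant_weight[OF assms]])
  qed
  thus "\<exists>d>0. cball z d \<subseteq> UNIV \<and> uniform_limit (cball z d) (\<lambda>N z. \<Sum>n<N. minorant_term lam n z) (minorant_series lam) sequentially"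
    by (intro exI[of _ 1]) auto
qed

lemma norm_minorant_series_le:
  assumes "lam > 0"
  shows "norm (minorant_series lam z) \<le> suminf (minorant_weight lam) * exp (2 * pi * \<bar>Im z\<bar>)"
proof -
  have "norm (minorant_series lam z) \<le> (\<Sum>n. minorant_weight lam n * exp (2 * pi * \<bar>Im z\<bar>))"
    unfolding minorant_series_def
    by (intro norm_suminf_le norm_minorant_term_le_exp assms summable_mult2 summable_minorant_weight)
  thus ?thesis using suminf_mult2[OF summable_minorant_weight[OF assms]] by simp
qed

lemma norm_minorant_series_of_real_le:
  assumes "lam > 0"
  shows "norm (minorant_series lam (of_real x)) \<le> (4 * (\<Sum>n. minorant_weight lam n * (1 + half_int n ^ 2))) / (1 + x^2)"
proof -
  have "norm (minorant_series lam (of_real x)) \<le> (\<Sum>n. minorant_weight lam n * (1 + half_int n ^ 2) * (4 / (1 + x^2)))"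
    unfolding minorant_series_def
    by (intro norm_suminf_le norm_minorant_term_le_decay assms summable_mult2 summable_minorant_weight_moment)
  also have "\<dots> = (\<Sum>n. minorant_weight lam n * (1 + half_int n ^ 2)) * (4 / (1 + x^2))"
    by (rule suminf_mult2[OF summable_minorant_weight_moment[OF assms], symmetric])
  finally show ?thesis by (simp add: mult.commute)
qed

lemma minorant_term_at_half_int:
  "minorant_term lam n (of_real (half_int k)) = (if n = k then of_real (minorant_coeff lam k) else 0)"
proof -
  have a: "of_real (half_int k) - of_real (half_int n) = (of_int (int k - int n) :: complex)"
    by (simp add: half_int_def)
  have b: "of_real (half_int k) + of_real (half_int n) = (of_int (int k + int n + 1) :: complex)"
    by (simp add: half_int_def)
  have "sinc_pi (of_int (int k + int n + 1)) = 0" by (rule sinc_pi_of_int) simp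
  moreover have "sinc_pi (of_int (int k - int n)) = (if n = k then 1 else 0)"
    using sinc_pi_of_int[of "int k - int n"] by (auto simp: sinc_pi_def)
  ultimately show ?thesis unfolding minorant_term_def a b by simp
qed

lemma minorant_term_minus: "minorant_term lam n (- z) = minorant_term lam n z"
proof -
  have "sinc_pi (- z - of_real (half_int n)) = sinc_pi (z + of_real (half_int n))"
    "sinc_pi (- z + of_real (half_int n)) = sinc_pi (z - of_real (half_int n))"
    using sinc_pi_minus[of "z + of_real (half_int n)"] sinc_pi_minus[of "z - of_real (half_int n)"] by simp_all
  thus ?thesis by (simp add: minorant_term_def mult_ac add_ac)
qed

lemma minorant_series_at_half_int:
  "minorant_series lam (of_real (half_int k)) = gaussian lam (of_real (half_int k))"
  "minorant_series lam (of_real (- half_int k)) = gaussian lam (of_real (- half_int k))"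
proof -
  have s: "(\<lambda>n. minorant_term lam n (of_real (half_int k))) sums of_real (minorant_coeff lam k)"
    unfolding minorant_term_at_half_int
    using sums_single[of k "\<lambda>k. complex_of_real (minorant_coeff lam k)"] by (simp add: eq_commute[of _ k] cong: if_cong)
  thus "minorant_series lam (of_real (half_int k)) = gaussian lam (of_real (half_int k))"
    unfolding minorant_series_def gaussian_of_real by (simp add: sums_iff minorant_coeff_def)
  thus "minorant_series lam (of_real (- half_int k)) = gaussian lam (of_real (- half_int k))"
    by (simp add: minorant_series_def minorant_term_minus gaussian_minus)
qed

lemma half_int_ge_separated:
  fixes z :: complex
  assumes "n \<ge> nat \<lceil>2 * norm z + 1\<rceil>"
  shows "norm (z - of_real (half_int n)) \<ge> 1 \<and> norm (z + of_real (half_int n)) \<ge> 1 \<and>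
         1 + half_int n ^ 2 \<le> 4 * norm (z - of_real (half_int n))^2 \<and>
         1 + half_int n ^ 2 \<le> 4 * norm (z + of_real (half_int n))^2"
proof -
  let ?x = "half_int n"
  have x: "2 * norm z + 1 \<le> ?x" using assms unfolding half_int_def by linarith
  have n: "norm (of_real ?x :: complex) = ?x" using half_int_pos[of n] by simp
  have 1: "norm (z - of_real ?x) \<ge> ?x - norm z" "norm (z + of_real ?x) \<ge> ?x - norm z"
    using norm_triangle_ineq2[of "of_real ?x" z] norm_triangle_ineq2[of "of_real ?x" "- z"] n
    by (simp_all add: norm_minus_commute add.commute)
  have 2: "?x - norm z \<ge> (?x + 1) / 2" using x by simp
  have 4: "?x - norm z \<ge> 1" using x norm_ge_zero[of z] by linarith
  have 3: "1 + ?x^2 \<le> 4 * ((?x + 1) / 2)^2"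
    using half_int_pos[of n] by (simp add: power2_eq_square field_simps)
  have "((?x + 1) / 2)^2 \<le> norm (z - of_real ?x)^2" "((?x + 1) / 2)^2 \<le> norm (z + of_real ?x)^2"
    using 1 2 half_int_pos[of n] by (auto intro!: power_mono)
  thus ?thesis using 1 4 3 by linarith
qed

lemma not_half_int_iff:
  fixes z :: complex
  shows
  "(\<forall>m::int. z \<noteq> of_int m + 1/2) \<longleftrightarrow> (\<forall>n. z \<noteq> of_real (half_int n) \<and> z \<noteq> - of_real (half_int n))"
proof
  assume *: "\<forall>m::int. z \<noteq> of_int m + 1/2"
  have "of_real (half_int n) = of_int (int n) + (1/2 :: complex)"
    "- of_real (half_int n) = of_int (- int n - 1) + (1/2 :: complex)" for n
    by (simp_all add: half_int_def)
  thus "\<forall>n. z \<noteq> of_real (half_int n) \<and> z \<noteq> - of_real (half_int n)" using * by metis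
next
  assume *: "\<forall>n. z \<noteq> of_real (half_int n) \<and> z \<noteq> - of_real (half_int n)"
  show "\<forall>m::int. z \<noteq> of_int m + 1/2"
  proof
    fix m :: int
    show "z \<noteq> of_int m + 1/2"
    proof (cases "m \<ge> 0")
      case True
      hence "of_int m + 1/2 = (of_real (half_int (nat m)) :: complex)" by (simp add: half_int_def)
      thus ?thesis using * by metis
    next
      case False
      hence "of_int m + 1/2 = (- of_real (half_int (nat (- m - 1))) :: complex)" by (simp add: half_int_def)
      thus ?thesis using * by metis
    qed
  qed
qed

lemma deriv_gaussian: "deriv (gaussian lam) z = - 2 * of_real (pi * lam) * z * gaussian lam z"
  unfolding gaussian_def by (rule DERIV_imp_deriv) (auto intro!: derivative_eq_intros)

text \<open>
  Off the half-integers both sums over the integers converge absolutely, so that the integers \<open>n\<close> and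
  \<open>- n - 1\<close> can be paired.
\<close>

lemma minorant_formula_eq_series:
  assumes lam: "lam > 0" and z: "\<forall>m::int. z \<noteq> of_int m + 1/2"
  shows "(cos (of_real pi * z) / of_real pi)\<^sup>2 *
     ((\<Sum>\<^sub>\<infinity>m::int. gaussian lam (of_int m + 1/2) / (z - of_int m - 1/2)\<^sup>2) +
      (\<Sum>\<^sub>\<infinity>n::int. deriv (gaussian lam) (of_int n + 1/2) / (z - of_int n - 1/2))) = minorant_series lam z"
proof -
  define h where "h = half_int"
  note z' = z[unfolded not_half_int_iff, folded h_def]
  define A where "A = (\<lambda>m::int. gaussian lam (of_int m + 1/2) / (z - of_int m - 1/2)\<^sup>2)"
  define B where "B = (\<lambda>n::int. deriv (gaussian lam) (of_int n + 1/2) / (z - of_int n - 1/2))"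
  have p: "of_int (int n) + 1/2 = (of_real (h n) :: complex)" "z - of_int (int n) - 1/2 = z - of_real (h n)"
    "of_int (- int n - 1) + 1/2 = (- of_real (h n) :: complex)" "z - of_int (- int n - 1) - 1/2 = z + of_real (h n)" for n
    by (simp_all add: h_def half_int_def)
  have g: "gaussian lam (of_real (h n)) = of_real (minorant_coeff lam n)" for n
    by (simp add: gaussian_of_real minorant_coeff_def h_def)
  have AB: "A (int n) = of_real (minorant_coeff lam n) / (z - of_real (h n))^2"
    "A (- int n - 1) = of_real (minorant_coeff lam n) / (z + of_real (h n))^2"
    "B (int n) = - of_real (2 * pi * lam * h n * minorant_coeff lam n) / (z - of_real (h n))"
    "B (- int n - 1) = of_real (2 * pi * lam * h n * minorant_coeff lam n) / (z + of_real (h n))" for n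
    unfolding A_def B_def p deriv_gaussian gaussian_minus g by simp_all
  have h0: "h n > 0" for n unfolding h_def by (rule half_int_pos)
  have cm: "minorant_coeff lam n \<ge> 0" for n by (simp add: minorant_coeff_def)
  have bound: "2 * pi * lam * h n * minorant_coeff lam n \<le> minorant_weight lam n * (1 + h n ^ 2)" for n
  proof -
    have "2 * h n \<le> 1 + h n ^ 2" using sum_squares_bound[of 1 "h n"] by simp
    hence "pi * lam * (2 * h n) \<le> pi * lam * (1 + h n ^ 2)" using lam by (intro mult_left_mono) auto
    also have "\<dots> \<le> (2 + 4 * pi * lam * h n ^ 2) * (1 + h n ^ 2)"
    proof (rule mult_right_mono)
      have "(1/2)^2 \<le> h n ^ 2" by (intro power_mono) (auto simp: h_def half_int_def)
      hence "pi * lam * 1 \<le> pi * lam * (4 * h n ^ 2)"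
        using lam by (intro mult_left_mono) (auto simp: power2_eq_square)
      moreover have "4 * pi * lam * h n ^ 2 = pi * lam * (4 * h n ^ 2)" by simp
      ultimately show "pi * lam \<le> 2 + 4 * pi * lam * h n ^ 2" by linarith
    qed simp
    finally have "(pi * lam * (2 * h n)) * minorant_coeff lam n \<le> ((2 + 4 * pi * lam * h n ^ 2) * (1 + h n ^ 2)) * minorant_coeff lam n"
      using cm by (rule mult_right_mono)
    thus ?thesis by (simp add: minorant_weight_def h_def mult_ac)
  qed
  define N where "N = nat \<lceil>2 * norm z + 1\<rceil>"
  have sep: "norm (z - of_real (h n)) \<ge> 1" "norm (z + of_real (h n)) \<ge> 1" if "n \<ge> N" for n
    using half_int_ge_separated[of z n] that unfolding N_def h_def by auto
  have quot: "norm (of_real x / w) \<le> y" if "0 \<le> x" "x \<le> y" "norm w \<ge> 1" for x y and w :: complex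
  proof -
    have "norm (of_real x / w) = x / norm w" using that by (simp add: norm_divide)
    also have "\<dots> \<le> x / 1" using that by (intro divide_left_mono) auto
    finally show ?thesis using that by simp
  qed
  have w2: "norm (w^2) \<ge> 1" if "norm w \<ge> 1" for w :: complex
    using that by (simp add: norm_power one_le_power)
  note sw = summable_minorant_weight[OF lam] and swm = summable_minorant_weight_moment[OF lam, folded h_def]
  have dn: "0 \<le> 2 * pi * lam * h n * minorant_coeff lam n" for n
    using lam h0[of n] cm[of n] by simp
  have cmp: "summable (\<lambda>n. norm (of_real (x n) / w n :: complex))"
    if "summable y" "\<And>n. 0 \<le> x n" "\<And>n. x n \<le> y n" "\<And>n. n \<ge> N \<Longrightarrow> norm (w n) \<ge> 1" for x y w
    by (rule summable_comparison_test'[OF that(1), of N]) (simp only: real_norm_def abs_norm_cancel quot that)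
  have sA: "summable (\<lambda>n. norm (A (int n)))" "summable (\<lambda>n. norm (A (- int n - 1)))"
    unfolding AB using cm minorant_coeff_le_weight[OF lam] w2 sep by (auto intro!: cmp[OF sw])
  have sB: "summable (\<lambda>n. norm (B (int n)))" "summable (\<lambda>n. norm (B (- int n - 1)))"
    unfolding AB minus_divide_left[symmetric] norm_minus_cancel
    by (rule cmp[OF swm dn bound], erule sep)+
  have iA: "(\<Sum>\<^sub>\<infinity>m. A m) = (\<Sum>n. A (int n) + A (- int n - 1))"
    by (rule infsumI[OF has_sum_int_pairs[OF sA]])
  have iB: "(\<Sum>\<^sub>\<infinity>m. B m) = (\<Sum>n. B (int n) + B (- int n - 1))"
    by (rule infsumI[OF has_sum_int_pairs[OF sB]])
  have sA': "summable (\<lambda>n. A (int n) + A (- int n - 1))" and sB': "summable (\<lambda>n. B (int n) + B (- int n - 1))"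
    using sA sB by (auto intro!: summable_add intro: summable_norm_cancel)
  let ?c = "(cos (of_real pi * z) / of_real pi)\<^sup>2"
  have "?c * ((\<Sum>\<^sub>\<infinity>m. A m) + (\<Sum>\<^sub>\<infinity>m. B m)) = (\<Sum>n. ?c * ((A (int n) + A (- int n - 1)) + (B (int n) + B (- int n - 1))))"
    unfolding iA iB by (simp only: suminf_add[OF sA' sB'] suminf_mult[OF summable_add[OF sA' sB']])
  also have "\<dots> = minorant_series lam z"
    unfolding minorant_series_def
  proof (rule suminf_cong)
    fix n
    define a b where "a = z - of_real (h n)" and "b = z + of_real (h n)"
    have ab: "a \<noteq> 0" "b \<noteq> 0" using z'[rule_format, of n] by (auto simp: a_def b_def eq_neg_iff_add_eq_0)
    have "1 / b - 1 / a = - (2 * of_real (h n)) / (a * b)"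
      using ab by (simp add: diff_frac_eq) (simp add: a_def b_def)
    hence "of_real (2 * pi * lam * h n * minorant_coeff lam n) * (1 / b - 1 / a) =
       of_real (2 * pi * lam * h n * minorant_coeff lam n) * (- (2 * of_real (h n)) / (a * b))" by simp
    hence "(A (int n) + A (- int n - 1)) + (B (int n) + B (- int n - 1)) =
       of_real (minorant_coeff lam n) * (1 / a^2 + 1 / b^2 - of_real (4 * pi * lam * h n ^ 2) / (a * b))"
      unfolding AB a_def[symmetric] b_def[symmetric] by (simp add: algebra_simps power2_eq_square)
    thus "?c * ((A (int n) + A (- int n - 1)) + (B (int n) + B (- int n - 1))) = minorant_term lam n z"
      using minorant_term_eq[of z n lam] z'[rule_format, of n] by (simp add: h_def a_def b_def)
  qed
  finally show ?thesis unfolding A_def B_def .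
qed

lemma eventually_not_half_int: "eventually (\<lambda>w. \<forall>m::int. w \<noteq> of_int m + 1/2) (at (z::complex))"
proof -
  define f where "f = (\<lambda>w::complex. 1 + exp (2 * of_real pi * \<i> * w))"
  have hol: "f holomorphic_on UNIV" unfolding f_def by (intro holomorphic_intros)
  have "eventually (\<lambda>w. f w \<noteq> 0) (at z)"
  proof (cases "f z = 0")
    case True
    have "f 0 \<noteq> 0" by (simp add: f_def)
    with True obtain r where "r > 0" "\<And>w. w \<in> ball z r - {z} \<Longrightarrow> f w \<noteq> 0"
      using isolated_zeros[OF hol open_UNIV connected_UNIV, of z 0] by auto
    thus ?thesis by (auto simp: eventually_at dist_commute intro!: exI[of _ r])
  next
    case False
    have "f \<midarrow>z\<rightarrow> f z"
      using holomorphic_on_imp_continuous_on[OF hol] by (simp add: continuous_on_def)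
    thus ?thesis using False by (rule tendsto_imp_eventually_ne)
  qed
  thus ?thesis by eventually_elim (auto simp: f_def exp_2pi_i_eq_minus_1_iff)
qed

theorem minorant_eq_series:
  assumes "lam > 0"
  shows "minorant lam z = minorant_series lam z"
  unfolding minorant_def
proof (rule remove_sings_eqI)
  have "isCont (minorant_series lam) z"
    using holomorphic_on_imp_continuous_on[OF holomorphic_minorant_series[OF assms]]
    by (simp add: continuous_on_eq_continuous_at)
  hence "minorant_series lam \<midarrow>z\<rightarrow> minorant_series lam z" by (simp add: isCont_def)
  thus "(\<lambda>z. (cos (of_real pi * z) / of_real pi)\<^sup>2 *
     ((\<Sum>\<^sub>\<infinity>m::int. gaussian lam (of_int m + 1/2) / (z - of_int m - 1/2)\<^sup>2) +
      (\<Sum>\<^sub>\<infinity>n::int. deriv (gaussian lam) (of_int n + 1/2) / (z - of_int n - 1/2)))) \<midarrow>z\<rightarrow> minorant_series lam z"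
    by (rule Lim_transform_eventually)
       (rule eventually_mono[OF eventually_not_half_int[of z] minorant_formula_eq_series[OF assms, symmetric]])
qed

section \<open>The interpolating function lies below the Gaussian\<close>

text \<open>
  The partial fraction series of \<open>(\<pi> / cos (\<pi> x))\<^sup>2\<close>. By Poisson summation the sum equals the integral
  of \<open>sinc_pi\<^sup>2\<close> for every \<open>x\<close>, and for \<open>x = 1/2\<close> only a single summand is different from 0.
\<close>

lemma sinc_pi_squares_sums_1:
  "(\<lambda>n. sinc_pi (of_real x - of_real (half_int n)) ^ 2 + sinc_pi (of_real x + of_real (half_int n)) ^ 2) sums 1"
proof -
  define J where "J = (LBINT u. sinc_pi (of_real u) ^ 2)"
  have J: "(\<lambda>n. sinc_pi (of_real x - of_real (half_int n)) ^ 2 + sinc_pi (of_real x + of_real (half_int n)) ^ 2) sums J" for x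
  proof -
    define f where "f = (\<lambda>z. sinc_pi (z - of_real x) ^ 2)"
    have "half_int_pair_sum f sums (LBINT u. f (of_real u))"
    proof (rule half_int_pair_sum_sums_integral)
      show "f holomorphic_on UNIV" unfolding f_def by (intro holomorphic_intros)
      show "norm (f z) \<le> 1 * exp (2 * pi * \<bar>Im z\<bar>)" for z
      proof -
        have "norm (f z) \<le> exp (pi * \<bar>Im (z - of_real x)\<bar>) ^ 2"
          unfolding f_def norm_power by (intro power_mono norm_sinc_pi_le) simp
        thus ?thesis by (simp add: exp_double[symmetric] mult.assoc)
      qed
      show "norm (f (of_real u)) \<le> 4 * (1 + x^2) / (1 + u^2)" for u
        using norm_sinc_pi_shift_decay[of u "- x"] by (simp add: f_def norm_power)
    qed
    also have "(LBINT u. f (of_real u)) = \<bar>1\<bar> *\<^sub>R (LBINT u. f (of_real (x + 1 * u)))"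
      by (rule lborel_integral_real_affine) simp
    also have "\<dots> = J" by (simp add: J_def f_def)
    also have "half_int_pair_sum f =
        (\<lambda>n. sinc_pi (of_real x - of_real (half_int n)) ^ 2 + sinc_pi (of_real x + of_real (half_int n)) ^ 2)"
    proof
      fix n
      show "half_int_pair_sum f n =
         sinc_pi (of_real x - of_real (half_int n)) ^ 2 + sinc_pi (of_real x + of_real (half_int n)) ^ 2"
      proof -
        have "of_real (half_int n) - of_real x = - (of_real x - of_real (half_int n) :: complex)"
          "of_real (- half_int n) - of_real x = - (of_real x + of_real (half_int n) :: complex)" by simp_all
        thus ?thesis unfolding half_int_pair_sum_def f_def by (simp only: sinc_pi_minus)
      qed
    qed
    finally show ?thesis .
  qed
  have "sinc_pi (of_real (1/2) - of_real (half_int n)) ^ 2 + sinc_pi (of_real (1/2) + of_real (half_int n)) ^ 2 = (if n = 0 then 1 else 0)" for n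
  proof -
    have "of_real (1/2) - of_real (half_int n) = (of_int (- int n) :: complex)"
      "of_real (1/2) + of_real (half_int n) = (of_int (int n + 1) :: complex)" by (simp_all add: half_int_def)
    moreover have "sinc_pi (of_int (int n + 1)) = 0" by (rule sinc_pi_of_int) simp
    moreover have "sinc_pi (of_int (- int n)) = (if n = 0 then 1 else 0)"
      using sinc_pi_of_int[of "- int n"] by (auto simp: sinc_pi_def)
    ultimately show ?thesis by simp
  qed
  hence "(\<lambda>n. if n = 0 then 1 else 0 :: complex) sums J" using J[of "1/2"] by simp
  moreover have "(\<lambda>n. if n = 0 then 1 else 0 :: complex) sums 1" by (rule sums_single)
  ultimately have "J = 1" by (rule sums_unique2)
  thus ?thesis using J by simp
qed

lemma minorant_series_real: "lam > 0 \<Longrightarrow> minorant_series lam (of_real x) = of_real (Re (minorant_series lam (of_real x)))"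
proof -
  assume lam: "lam > 0"
  have "Im (minorant_term lam n (of_real x)) = 0" for n
  proof -
    define a b where "a = Re (sinc_pi (of_real (x - half_int n)))" and "b = Re (sinc_pi (of_real (x + half_int n)))"
    have "sinc_pi (of_real x - of_real (half_int n)) = of_real a"
      "sinc_pi (of_real x + of_real (half_int n)) = of_real b"
      using sinc_pi_of_real[of "x - half_int n"] sinc_pi_of_real[of "x + half_int n"]
      by (simp_all add: a_def b_def)
    thus ?thesis by (simp add: minorant_term_def)
  qed
  hence "Im (minorant_series lam (of_real x)) = 0"
    using sums_Im[OF summable_sums[OF summable_minorant_term[OF lam, of "of_real x"]]]
    by (simp add: minorant_series_def sums_iff)
  thus ?thesis by (simp add: complex_eq_iff)
qed

text \<open>
  Off the half-integers, \<open>L x / G x = w * E lam\<close> with \<open>w = (cos (\<pi> x) / \<pi>)\<^sup>2\<close> and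
  \<open>E \<mu> = (\<Sum>n. t n \<mu>)\<close>. The derivative of \<open>E\<close> is a positive multiple of \<open>half_int_theta_defect\<close>, hence
  nonpositive, and \<open>E \<mu>\<close> tends to \<open>1 / w\<close> for \<open>\<mu> \<rightarrow> 0\<close>.
\<close>

theorem minorant_series_le_gaussian:
  assumes lam: "lam > 0"
  shows "Re (minorant_series lam (of_real x)) \<le> Re (gaussian lam (of_real x))"
proof (cases "\<exists>n. x = half_int n \<or> x = - half_int n")
  case True
  thus ?thesis using minorant_series_at_half_int by auto
next
  case False
  define h where "h = half_int"
  have ne: "x \<noteq> h n" "x \<noteq> - h n" for n using False by (auto simp: h_def)
  have ne2: "x - h n \<noteq> 0" "x + h n \<noteq> 0" "x^2 - h n ^ 2 \<noteq> 0" for n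
    using ne[of n] by (auto simp: power2_eq_iff)
  define p where "p = (\<lambda>n. 1 / (x - h n)^2 + 1 / (x + h n)^2)"
  define c where "c = (\<lambda>n. 4 * pi * h n ^ 2 / (h n ^ 2 - x^2))"
  define t where "t = (\<lambda>n \<mu>. exp (pi * \<mu> * (x^2 - h n ^ 2)) * (p n + \<mu> * c n))"
  define t' where "t' = (\<lambda>n \<mu>. 2 * pi * exp (pi * \<mu> * x^2) * (exp (- pi * \<mu> * h n ^ 2) * (1 - 2 * pi * \<mu> * h n ^ 2)))"
  define w where "w = (cos (pi * x) / pi)^2"
  have w0: "w \<ge> 0" by (simp add: w_def)
  have p0: "p n \<ge> 0" for n by (simp add: p_def)

  have "(\<lambda>n. w * p n) sums 1"
  proof -
    have "sinc_pi (of_real x - of_real (h n)) ^ 2 + sinc_pi (of_real x + of_real (h n)) ^ 2 = of_real (w * p n)" for n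
    proof -
      have m1: "((-1)^n * (-1)^n :: complex) = 1" by (simp flip: power_mult_distrib)
      have nz: "complex_of_real x \<noteq> of_real (h n)" "complex_of_real x \<noteq> - of_real (h n)"
        using ne[of n] by (simp_all flip: of_real_minus)
      have c: "cos (of_real pi * of_real x) = complex_of_real (cos (pi * x))"
        by (simp flip: cos_of_real)
      have sq: "(- (e * C) / (P * A))^2 = (e * e) * (C^2 / (P^2 * A^2))" "(e * C / (P * A))^2 = (e * e) * (C^2 / (P^2 * A^2))"
        for e C P A :: complex by (simp_all add: power2_eq_square mult_ac)
      have "sinc_pi (of_real x - of_real (h n)) ^ 2 = ((-1)^n * (-1)^n) * (of_real (cos (pi * x)) ^ 2 / (of_real pi ^ 2 * (of_real x - of_real (h n)) ^ 2))"
        unfolding h_def sinc_pi_shift_half_int(1)[OF nz(1)[unfolded h_def]] c by (rule sq)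
      moreover have "sinc_pi (of_real x + of_real (h n)) ^ 2 = ((-1)^n * (-1)^n) * (of_real (cos (pi * x)) ^ 2 / (of_real pi ^ 2 * (of_real x + of_real (h n)) ^ 2))"
        unfolding h_def sinc_pi_shift_half_int(2)[OF nz(2)[unfolded h_def]] c by (rule sq)
      ultimately show ?thesis unfolding m1 by (simp add: w_def p_def power_divide distrib_left)
    qed
    hence "(\<lambda>n. of_real (w * p n) :: complex) sums of_real 1"
      using sinc_pi_squares_sums_1[of x] by (simp add: h_def)
    thus ?thesis unfolding sums_of_real_iff .
  qed
  moreover have w_nz: "w \<noteq> 0" using calculation by (auto simp: sums_iff)
  ultimately have p_sums: "p sums (1 / w)" using sums_mult[of "\<lambda>n. w * p n" 1 "1 / w"] by simp

  \<comment> \<open>Each summand has a derivative in which \<open>x\<close> survives only in the common factor.\<close>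
  have deriv_t: "(t n has_real_derivative t' n \<mu>) (at \<mu> within A)" for n \<mu> A
  proof -
    have d: "(t n has_real_derivative (pi * (x^2 - h n ^ 2) * exp (pi * \<mu> * (x^2 - h n ^ 2))) * (p n + \<mu> * c n) + exp (pi * \<mu> * (x^2 - h n ^ 2)) * c n) (at \<mu> within A)"
      unfolding t_def by (auto intro!: derivative_eq_intros)
    have "p n = ((x + h n)^2 + (x - h n)^2) / ((x - h n)^2 * (x + h n)^2)"
      unfolding p_def using ne2[of n] by (simp add: add_frac_eq)
    also have "(x - h n)^2 * (x + h n)^2 = (x^2 - h n ^ 2)^2" by (simp add: power2_eq_square algebra_simps)
    finally have "(x^2 - h n ^ 2) * p n = (2 * x^2 + 2 * h n ^ 2) / (x^2 - h n ^ 2)"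
      using ne2(3)[of n] by (simp add: power2_eq_square) (simp add: algebra_simps)
    moreover have c_eq: "c n = - (4 * pi * h n ^ 2) / (x^2 - h n ^ 2)"
      unfolding c_def by (metis minus_diff_eq minus_divide_left minus_divide_right)
    hence "(x^2 - h n ^ 2) * c n = - (4 * pi * h n ^ 2)" using ne2(3)[of n] by simp
    ultimately have "pi * ((x^2 - h n ^ 2) * p n) + c n + pi * \<mu> * ((x^2 - h n ^ 2) * c n)
       = pi * ((2 * x^2 + 2 * h n ^ 2) / (x^2 - h n ^ 2)) - (4 * pi * h n ^ 2) / (x^2 - h n ^ 2) - pi * \<mu> * (4 * pi * h n ^ 2)"
      using c_eq by simp
    also have "\<dots> = 2 * pi * (x^2 - h n ^ 2) / (x^2 - h n ^ 2) - pi * \<mu> * (4 * pi * h n ^ 2)"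
      by (simp add: diff_divide_distrib add_divide_distrib algebra_simps)
    also have "\<dots> = 2 * pi * (1 - 2 * pi * \<mu> * h n ^ 2)"
      unfolding nonzero_mult_div_cancel_right[OF ne2(3)] by (simp add: algebra_simps)
    finally have core: "pi * ((x^2 - h n ^ 2) * p n) + c n + pi * \<mu> * ((x^2 - h n ^ 2) * c n) = 2 * pi * (1 - 2 * pi * \<mu> * h n ^ 2)" .
    have "(pi * (x^2 - h n ^ 2) * exp (pi * \<mu> * (x^2 - h n ^ 2))) * (p n + \<mu> * c n) + exp (pi * \<mu> * (x^2 - h n ^ 2)) * c n
       = exp (pi * \<mu> * (x^2 - h n ^ 2)) * (pi * ((x^2 - h n ^ 2) * p n) + c n + pi * \<mu> * ((x^2 - h n ^ 2) * c n))"
      by (simp add: algebra_simps)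
    also have "\<dots> = t' n \<mu>" unfolding core t'_def
    proof -
      have "exp (pi * \<mu> * (x^2 - h n ^ 2)) = exp (pi * \<mu> * x^2) * exp (- pi * \<mu> * h n ^ 2)"
        by (simp add: exp_add[symmetric] algebra_simps)
      thus "exp (pi * \<mu> * (x^2 - h n ^ 2)) * (2 * pi * (1 - 2 * pi * \<mu> * h n ^ 2)) =
        2 * pi * exp (pi * \<mu> * x^2) * (exp (- pi * \<mu> * h n ^ 2) * (1 - 2 * pi * \<mu> * h n ^ 2))" by simp
    qed
    finally show ?thesis using d by simp
  qed

  define N where "N = nat \<lceil>2 * norm (complex_of_real x) + 1\<rceil>"
  have sep: "1 + h n ^ 2 \<le> 4 * (x - h n)^2" "1 + h n ^ 2 \<le> 4 * (x + h n)^2" if "n \<ge> N" for n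
  proof -
    have "norm (complex_of_real x - of_real (h n))^2 = (x - h n)^2" "norm (complex_of_real x + of_real (h n))^2 = (x + h n)^2"
      by (simp_all flip: of_real_diff of_real_add)
    thus "1 + h n ^ 2 \<le> 4 * (x - h n)^2" "1 + h n ^ 2 \<le> 4 * (x + h n)^2"
      using half_int_ge_separated[of "of_real x" n] that unfolding N_def h_def by auto
  qed
  have "summable (\<lambda>n. 4 / \<bar>h n ^ 2 - x^2\<bar>)"
  proof (rule summable_comparison_test'[OF summable_half_int_quadratic[of 16], of N])
    fix n assume n: "n \<ge> N"
    have "(1 + h n ^ 2)^2 \<le> (4 * (x - h n)^2) * (4 * (x + h n)^2)"
      unfolding power2_eq_square[of "1 + h n ^ 2"] using sep[OF n] by (intro mult_mono) (auto simp: add_nonneg_nonneg)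
    also have "\<dots> = (4 * \<bar>h n ^ 2 - x^2\<bar>)^2" by (simp add: power2_eq_square algebra_simps)
    finally have "1 + h n ^ 2 \<le> 4 * \<bar>h n ^ 2 - x^2\<bar>" by (rule power2_le_imp_le) simp
    moreover have "\<bar>h n ^ 2 - x^2\<bar> > 0" using ne2(3)[of n] by auto
    ultimately show "norm (4 / \<bar>h n ^ 2 - x^2\<bar>) \<le> 16 / (1 + half_int n ^ 2)"
      unfolding h_def by (simp add: frac_le_eq divide_simps add_pos_nonneg)
  qed
  hence sB: "summable (\<lambda>n. exp (pi * lam * x^2) * (p n + 4 / \<bar>h n ^ 2 - x^2\<bar>))"
    using p_sums by (intro summable_mult summable_add) (auto simp: sums_iff)
  have t_bound: "\<bar>t n \<mu>\<bar> \<le> exp (pi * lam * x^2) * (p n + 4 / \<bar>h n ^ 2 - x^2\<bar>)" if "0 < \<mu>" "\<mu> \<le> lam" for n \<mu>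
  proof -
    define a where "a = pi * \<mu> * h n ^ 2"
    have a0: "a \<ge> 0" using that by (simp add: a_def)
    have e: "exp (pi * \<mu> * (x^2 - h n ^ 2)) = exp (pi * \<mu> * x^2) * exp (- a)"
      by (simp add: a_def exp_add[symmetric] algebra_simps)
    \<comment> \<open>This estimate makes the domination uniform down to \<open>\<mu> = 0\<close>: the factor \<open>\<mu>\<close> compensates \<open>h n ^ 2\<close>.\<close>
    have "a \<le> exp a" using exp_ge_add_one_self[of a] by linarith
    hence "a * exp (- a) \<le> 1" by (simp add: exp_minus field_simps)
    hence "4 * (a * exp (- a)) / \<bar>h n ^ 2 - x^2\<bar> \<le> 4 / \<bar>h n ^ 2 - x^2\<bar>" by (intro divide_right_mono) auto
    moreover have "\<mu> * \<bar>c n\<bar> = 4 * a / \<bar>h n ^ 2 - x^2\<bar>" using that by (simp add: c_def a_def abs_mult)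
    ultimately have "exp (- a) * (\<mu> * \<bar>c n\<bar>) \<le> 4 / \<bar>h n ^ 2 - x^2\<bar>" by (simp add: mult_ac)
    moreover have "exp (- a) * p n \<le> 1 * p n" using a0 p0 by (intro mult_right_mono) auto
    ultimately have "exp (- a) * (p n + \<mu> * \<bar>c n\<bar>) \<le> p n + 4 / \<bar>h n ^ 2 - x^2\<bar>" by (simp add: distrib_left)
    moreover have "pi * \<mu> * x^2 \<le> pi * lam * x^2" using that by (intro mult_right_mono mult_left_mono) auto
    ultimately have "exp (pi * \<mu> * x^2) * (exp (- a) * (p n + \<mu> * \<bar>c n\<bar>)) \<le> exp (pi * lam * x^2) * (p n + 4 / \<bar>h n ^ 2 - x^2\<bar>)"
      using that p0 by (intro mult_mono) auto
    moreover have "\<bar>t n \<mu>\<bar> \<le> exp (pi * \<mu> * x^2) * (exp (- a) * (p n + \<mu> * \<bar>c n\<bar>))"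
    proof -
      have "\<bar>p n + \<mu> * c n\<bar> \<le> p n + \<mu> * \<bar>c n\<bar>"
        using abs_triangle_ineq[of "p n" "\<mu> * c n"] p0[of n] that by (simp add: abs_mult)
      thus ?thesis unfolding t_def e by (simp add: abs_mult mult_left_mono mult.assoc)
    qed
    ultimately show ?thesis by linarith
  qed
  have t_summable: "summable (\<lambda>n. t n \<mu>)" if "0 < \<mu>" "\<mu> \<le> lam" for \<mu>
    by (rule summable_comparison_test'[OF sB]) (use t_bound[OF that] in simp)

  define E where "E = (\<lambda>\<mu>. \<Sum>n. t n \<mu>)"
  have deriv_E: "\<exists>y. (E has_real_derivative y) (at \<mu>) \<and> y \<le> 0" if mu: "0 < \<mu>" "\<mu> \<le> lam" for \<mu>
  proof (intro exI conjI)
    let ?S = "{\<mu> / 2..2 * \<mu>}"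
    show "(E has_real_derivative (\<Sum>n. t' n \<mu>)) (at \<mu>)"
      unfolding E_def
    proof (rule has_field_derivative_series'(2)[where S = ?S and ?x0.0 = \<mu>])
      show "uniformly_convergent_on ?S (\<lambda>n x. \<Sum>i<n. t' i x)"
      proof (rule Weierstrass_m_test')
        fix n y assume y: "y \<in> ?S"
        have "pi * (\<mu> / 2) * h n ^ 2 \<le> pi * y * h n ^ 2" using y by (intro mult_right_mono mult_left_mono) auto
        hence e1: "exp (- pi * y * h n ^ 2) \<le> exp (- pi * (\<mu> / 2) * h n ^ 2)" by simp
        have "pi * y * x^2 \<le> pi * (2 * \<mu>) * x^2" using y by (intro mult_right_mono mult_left_mono) auto
        hence e2: "2 * pi * exp (pi * y * x^2) \<le> 2 * pi * exp (pi * (2 * \<mu>) * x^2)" by simp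
        have "\<bar>1 - 2 * pi * y * h n ^ 2\<bar> \<le> 1 + 2 * pi * y * h n ^ 2"
          using y mu by (simp add: abs_if)
        also have "\<dots> \<le> 1 + 2 * pi * (2 * \<mu>) * h n ^ 2"
          using y by (intro add_left_mono mult_right_mono mult_left_mono) auto
        finally have e3: "\<bar>1 - 2 * pi * y * h n ^ 2\<bar> \<le> 1 + 2 * pi * (2 * \<mu>) * h n ^ 2" .
        have "norm (t' n y) = 2 * pi * exp (pi * y * x^2) * (exp (- pi * y * h n ^ 2) * \<bar>1 - 2 * pi * y * h n ^ 2\<bar>)"
          by (simp add: t'_def abs_mult)
        also have "\<dots> \<le> 2 * pi * exp (pi * (2 * \<mu>) * x^2) * (exp (- pi * (\<mu> / 2) * h n ^ 2) * (1 + 2 * pi * (2 * \<mu>) * h n ^ 2))"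
          using e1 e2 e3 by (intro mult_mono[OF e2] mult_mono[OF e1]) auto
        finally show "norm (t' n y) \<le> 2 * pi * exp (pi * (2 * \<mu>) * x^2) * (exp (- pi * (\<mu> / 2) * h n ^ 2) * (1 + 2 * pi * (2 * \<mu>) * h n ^ 2))" .
      next
        have m: "\<mu> / 2 > 0" using mu by simp
        have "summable (\<lambda>n. 2 * pi * exp (pi * (2 * \<mu>) * x^2) * (exp (- pi * (\<mu> / 2) * h n ^ 2) + 2 * pi * (2 * \<mu>) * (h n ^ 2 * exp (- pi * (\<mu> / 2) * h n ^ 2))))"
          unfolding h_def
          by (intro summable_mult summable_add summable_half_int_theta[OF m] summable_half_int_theta_moment[OF m])
        thus "summable (\<lambda>n. 2 * pi * exp (pi * (2 * \<mu>) * x^2) * (exp (- pi * (\<mu> / 2) * h n ^ 2) * (1 + 2 * pi * (2 * \<mu>) * h n ^ 2)))"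
          by (simp add: algebra_simps)
      qed
      show "\<mu> \<in> interior ?S" using mu by simp
    qed (use mu deriv_t t_summable in auto)
    have "(\<Sum>n. t' n \<mu>) = 2 * pi * exp (pi * \<mu> * x^2) * half_int_theta_defect \<mu>"
      unfolding t'_def h_def half_int_theta_defect_def
      by (rule suminf_mult[OF summable_half_int_theta_defect[OF mu(1)]])
    thus "(\<Sum>n. t' n \<mu>) \<le> 0"
      using half_int_theta_defect_nonpos[OF mu(1)] by (simp add: mult_nonneg_nonpos)
  qed

  define d where "d = (\<lambda>k. lam / real (Suc k))"
  have d: "0 < d k" "d k \<le> lam" for k using lam by (auto simp: d_def field_simps)
  have E_le: "E lam \<le> E (d k)" for k
    by (rule DERIV_nonpos_imp_nonincreasing[OF d(2)]) (use deriv_E d(1)[of k] in force)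
  have d0: "d \<longlonglongrightarrow> 0" unfolding d_def by real_asymp
  have tl: "(\<lambda>k. t n (d k)) \<longlonglongrightarrow> p n" for n
  proof -
    have "(\<lambda>k. t n (d k)) \<longlonglongrightarrow> exp (pi * 0 * (x^2 - h n ^ 2)) * (p n + 0 * c n)"
      unfolding t_def by (intro tendsto_intros d0)
    thus ?thesis by simp
  qed
  have "(\<lambda>k. E (d k)) \<longlonglongrightarrow> suminf p"
    unfolding E_def by (rule sequential_tannery(2)[OF tl _ sB]) (use t_bound d in simp)
  hence "E lam \<le> suminf p" by (rule LIMSEQ_le_const) (use E_le in blast)
  hence "w * E lam \<le> w * suminf p" using w0 by (rule mult_left_mono)
  also have "w * suminf p = 1" using w_nz unfolding sums_unique[OF p_sums, symmetric] by simp
  finally have E1: "w * E lam \<le> 1" .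

  have "Re (minorant_series lam (of_real x)) = exp (- pi * lam * x^2) * (w * E lam)"
  proof -
    have trm: "minorant_term lam n (of_real x) = of_real (exp (- pi * lam * x^2) * w * t n lam)" for n
    proof -
      have nz: "complex_of_real x \<noteq> of_real (half_int n)" "complex_of_real x \<noteq> - of_real (half_int n)"
        using ne[of n] by (simp_all add: h_def flip: of_real_minus)
      have cs: "cos (of_real pi * of_real x) = complex_of_real (cos (pi * x))"
        by (simp flip: cos_of_real)
      have "minorant_term lam n (of_real x) = of_real (w * (minorant_coeff lam n * (1 / (x - h n)^2 + 1 / (x + h n)^2 - 4 * pi * lam * h n ^ 2 / ((x - h n) * (x + h n)))))"
        unfolding minorant_term_eq[OF nz] cs by (simp add: w_def h_def)
      also have "1 / (x - h n)^2 + 1 / (x + h n)^2 - 4 * pi * lam * h n ^ 2 / ((x - h n) * (x + h n)) = p n + lam * c n"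
      proof -
        have "(x - h n) * (x + h n) = - (h n ^ 2 - x^2)" by (simp add: power2_eq_square algebra_simps)
        thus ?thesis by (simp only: p_def c_def divide_minus_right diff_minus_eq_add) simp
      qed
      also have "minorant_coeff lam n = exp (- pi * lam * x^2) * exp (pi * lam * (x^2 - h n ^ 2))"
        by (simp add: minorant_coeff_def h_def exp_add[symmetric] algebra_simps)
      also have "w * (exp (- pi * lam * x^2) * exp (pi * lam * (x^2 - h n ^ 2)) * (p n + lam * c n)) = exp (- pi * lam * x^2) * w * t n lam"
        by (simp add: t_def)
      finally show ?thesis .
    qed
    have "(\<lambda>n. exp (- pi * lam * x^2) * w * t n lam) sums (exp (- pi * lam * x^2) * w * E lam)"
      unfolding E_def by (intro sums_mult summable_sums t_summable lam order_refl)
    hence "(\<lambda>n. minorant_term lam n (of_real x)) sums of_real (exp (- pi * lam * x^2) * w * E lam)"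
      unfolding trm by (rule sums_of_real)
    thus ?thesis unfolding minorant_series_def by (simp add: sums_iff)
  qed
  also have "\<dots> \<le> exp (- pi * lam * x^2) * 1" using E1 by (intro mult_left_mono) auto
  finally show ?thesis by (simp add: gaussian_of_real)
qed

section \<open>Uniqueness and the extremal problem\<close>

lemma integral_minorant_series:
  assumes "lam > 0"
  shows "integrable lborel (\<lambda>x. minorant_series lam (of_real x))"
    and "(LBINT x. minorant_series lam (of_real x)) = of_real (\<Sum>n. 2 * exp (- pi * lam * half_int n ^ 2))"
proof -
  let ?L = "minorant_series lam"
  have cont: "continuous_on UNIV ?L" by (rule holomorphic_on_imp_continuous_on[OF holomorphic_minorant_series[OF assms]])
  have "(\<lambda>x. ?L (of_real x)) \<in> borel_measurable borel"
    by (intro borel_measurable_continuous_onI continuous_on_compose2[OF cont] continuous_intros) auto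
  thus "integrable lborel (\<lambda>x. ?L (of_real x))"
    using norm_minorant_series_of_real_le[OF assms] by (rule integrable_quadratic_decay)
  have "half_int_pair_sum ?L sums (LBINT x. ?L (of_real x))"
    by (rule half_int_pair_sum_sums_integral[OF holomorphic_minorant_series[OF assms]
          norm_minorant_series_le[OF assms] norm_minorant_series_of_real_le[OF assms]])
  moreover have "half_int_pair_sum ?L n = of_real (2 * exp (- pi * lam * half_int n ^ 2))" for n
    unfolding half_int_pair_sum_def minorant_series_at_half_int gaussian_of_real by simp
  moreover have "(\<lambda>n. complex_of_real (2 * exp (- pi * lam * half_int n ^ 2))) sums
      of_real (\<Sum>n. 2 * exp (- pi * lam * half_int n ^ 2))"
    by (intro sums_of_real summable_sums summable_mult summable_half_int_theta assms)
  ultimately show "(LBINT x. ?L (of_real x)) = of_real (\<Sum>n. 2 * exp (- pi * lam * half_int n ^ 2))"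
    by (metis (no_types, lifting) sums_cong sums_unique2)
qed

lemma cos_pi_eq_0_iff: "cos (of_real pi * z) = 0 \<longleftrightarrow> (\<exists>m::int. z = of_int m + 1/2)" for z :: complex
proof -
  have eq: "cos (of_real pi * z) = exp (- (\<i> * (of_real pi * z))) * (1 + exp (2 * of_real pi * \<i> * z)) / 2"
    by (simp add: cos_exp_eq distrib_left exp_add[symmetric] mult_ac)
  have "cos (of_real pi * z) = 0 \<longleftrightarrow> 1 + exp (2 * of_real pi * \<i> * z) = 0" unfolding eq by simp
  thus ?thesis unfolding exp_2pi_i_eq_minus_1_iff .
qed

lemma cos_pi_eq_0_iff_half_int:
  "cos (of_real pi * z) = 0 \<longleftrightarrow> (\<exists>n. z = of_real (half_int n) \<or> z = of_real (- half_int n))" for z :: complex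
  using not_half_int_iff[of z] unfolding cos_pi_eq_0_iff by auto

text \<open>
  If \<open>\<bar>Im z\<bar> \<ge> 1/8\<close>, the hyperbolic sine in \<open>\<bar>cos (\<pi> z)\<bar>\<^sup>2 = cos (\<pi> Re z)\<^sup>2 + sinh (\<pi> Im z)\<^sup>2\<close> has the
  required size. Otherwise \<open>Re z\<close> has distance at least \<open>1/6\<close> from the half-integers, so that
  \<open>\<bar>cos (\<pi> Re z)\<bar> \<ge> 1/2\<close>, while \<open>exp (2 \<pi> \<bar>Im z\<bar>)\<close> is bounded.
\<close>

lemma norm_cos_pi_lower_bound:
  fixes z :: complex
  assumes far: "\<And>m::int. norm (z - (of_int m + 1/2)) \<ge> 1/4"
  shows "exp (2 * pi * \<bar>Im z\<bar>) \<le> 64 * norm (cos (of_real pi * z)) ^ 2"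
proof -
  define y where "y = \<bar>Im z\<bar>"
  define s where "s = (exp (pi * Im z) - inverse (exp (pi * Im z)))^2 / 4"
  have n: "norm (cos (of_real pi * z)) ^ 2 = cos (pi * Re z) ^ 2 + s"
    using norm_cos_squared[of "of_real pi * z"] by (simp add: s_def)
  have s0: "s \<ge> 0" by (simp add: s_def)
  show ?thesis
  proof (cases "y \<ge> 1/8")
    case True
    have s_eq: "s = (exp (pi * y) - exp (- (pi * y)))^2 / 4"
      unfolding s_def y_def exp_minus[symmetric] by (cases "Im z \<ge> 0") (auto simp: power2_commute)
    have "1 + pi / 4 \<le> exp (pi / 4)" by (rule exp_ge_add_one_self)
    hence "7/4 \<le> exp (pi / 4)" using pi_gt3 by linarith
    also have "exp (pi / 4) \<le> exp (2 * (pi * y))" using True by simp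
    finally have "exp (2 * (pi * y)) \<ge> 7/4" .
    hence "exp (- (2 * (pi * y))) \<le> 4/7" by (simp add: exp_minus field_simps)
    hence "exp (pi * y) * (3/7) \<le> exp (pi * y) * (1 - exp (- (2 * (pi * y))))" by (intro mult_left_mono) auto
    also have "\<dots> = exp (pi * y) - exp (- (pi * y))" by (simp add: right_diff_distrib exp_add[symmetric])
    finally have "(exp (pi * y) * (3/7))^2 \<le> (exp (pi * y) - exp (- (pi * y)))^2" by (intro power_mono) auto
    hence "exp (pi * y)^2 * (9/49) \<le> 4 * s" unfolding s_eq by (simp add: power_mult_distrib power2_eq_square)
    moreover have "exp (2 * pi * y) = exp (pi * y)^2" by (simp add: exp_double[symmetric] mult.assoc)
    ultimately have "exp (2 * pi * y) \<le> 64 * s" using zero_le_power2[of "exp (pi * y)"] by linarith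
    thus ?thesis unfolding n y_def using zero_le_power2[of "cos (pi * Re z)"] by (simp only: distrib_left)
  next
    case False
    define m where "m = \<lfloor>Re z\<rfloor>"
    define u where "u = Re z - (of_int m + 1/2)"
    have u: "\<bar>u\<bar> \<le> 1/2" unfolding u_def m_def by linarith
    have "norm (z - (of_int m + 1/2)) ^ 2 = u^2 + y^2"
      by (simp add: cmod_power2 u_def y_def)
    moreover have "(1/4)^2 \<le> norm (z - (of_int m + 1/2)) ^ 2" using far[of m] by (intro power_mono) auto
    moreover have "y^2 \<le> (1/8)^2" using False by (intro power_mono) (auto simp: y_def)
    ultimately have "(1/6)^2 \<le> u^2" by (simp add: power2_eq_square)
    hence "1/6 \<le> \<bar>u\<bar>" using abs_le_square_iff[of "1/6" u] by simp
    hence "sin (pi / 6) \<le> sin (pi * \<bar>u\<bar>)" using u by (intro sin_monotone_2pi_le) auto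
    hence half: "1/2 \<le> sin (pi * \<bar>u\<bar>)" by (simp add: sin_30)
    have "cos (pi * Re z) ^ 2 = sin (pi * \<bar>u\<bar>) ^ 2"
    proof -
      have e: "pi * Re z = pi * of_int m + (pi / 2 + pi * u)" by (simp add: u_def algebra_simps)
      have "cos (pi * of_int m)^2 = 1" using sin_cos_squared_add[of "pi * of_int m"] by simp
      hence "cos (pi * Re z) ^ 2 = sin (pi * u) ^ 2"
        unfolding e cos_add[of "pi * of_int m"] by (simp add: cos_add power_mult_distrib)
      also have "\<dots> = sin (pi * \<bar>u\<bar>) ^ 2" by (cases "u \<ge> 0") auto
      finally show ?thesis .
    qed
    moreover have "(1/2)^2 \<le> sin (pi * \<bar>u\<bar>) ^ 2" using half by (intro power_mono) auto
    ultimately have c: "cos (pi * Re z) ^ 2 \<ge> 1/4" by (simp add: power2_eq_square)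
    have "2 * pi * y \<le> 1" using False pi_less_4 mult_mono[of pi 4 y "1/8"] by (simp add: y_def)
    hence "exp (2 * pi * y) \<le> exp 1" by simp
    also have "\<dots> \<le> 3" by (rule exp_le)
    finally show ?thesis unfolding n y_def using c s0 by simp
  qed
qed

lemma double_zero_factor:
  fixes K :: "complex \<Rightarrow> complex"
  assumes hol: "K holomorphic_on UNIV" and "K p = 0" "deriv K p = 0"
  obtains k where "k holomorphic_on UNIV" "\<And>z. K z = (z - p)^2 * k z"
proof -
  define a where "a = (\<lambda>z. if z = p then deriv K p else (K z - K p) / (z - p))"
  have a: "a holomorphic_on UNIV" unfolding a_def by (rule pole_lemma[OF hol]) simp
  have Ka: "K z = (z - p) * a z" for z using assms(2) by (simp add: a_def)
  have ap: "a p = 0" using assms(3) by (simp add: a_def)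
  define b where "b = (\<lambda>z. if z = p then deriv a p else (a z - a p) / (z - p))"
  have b: "b holomorphic_on UNIV" unfolding b_def by (rule pole_lemma[OF a]) simp
  have "a z = (z - p) * b z" for z using ap by (simp add: b_def)
  hence "K z = (z - p)^2 * b z" for z using Ka by (simp add: power2_eq_square mult.assoc)
  thus ?thesis using b that by blast
qed

text \<open>
  The quotient \<open>Q\<close> of \<open>K\<close> by \<open>cos (\<pi> z)\<^sup>2\<close> is entire. At distance at least \<open>1/4\<close> from the zeros of
  the cosine it is bounded because \<open>cos (\<pi> z)\<^sup>2\<close> is comparable with \<open>exp (2 \<pi> \<bar>Im z\<bar>)\<close>, and the maximum
  principle extends the bound to the remaining discs. Liouville's theorem applies.
\<close>

theorem multiple_of_cos_squared:
  fixes K :: "complex \<Rightarrow> complex"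
  assumes hol: "K holomorphic_on UNIV" and bound: "\<And>z. norm (K z) \<le> M * exp (2 * pi * \<bar>Im z\<bar>)"
    and zeros: "\<And>z. cos (of_real pi * z) = 0 \<Longrightarrow> K z = 0 \<and> deriv K z = 0"
  obtains c where "\<And>z. K z = c * cos (of_real pi * z) ^ 2"
proof -
  define cs where "cs = (\<lambda>z::complex. cos (of_real pi * z))"
  have M0: "M \<ge> 0" using order_trans[OF norm_ge_zero bound[of 0]] by simp
  have "\<exists>k. k holomorphic_on UNIV \<and> (\<forall>z. K z = (z - p)^2 * k z)" if "cs p = 0" for p
    using double_zero_factor[OF hol, of p] zeros[of p] that unfolding cs_def by metis
  then obtain k where k: "\<And>p. cs p = 0 \<Longrightarrow> k p holomorphic_on UNIV" "\<And>p z. cs p = 0 \<Longrightarrow> K z = (z - p)^2 * k p z"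
    by metis
  \<comment> \<open>The value at a zero \<open>p\<close> is the limit: \<open>k p\<close> is \<open>K\<close> divided by \<open>(z - p)\<^sup>2\<close>, and the squared cosine
    behaves like \<open>\<pi>\<^sup>2 (z - p)\<^sup>2\<close>.\<close>
  define Q where "Q = (\<lambda>z. if cs z = 0 then k z z / of_real pi ^ 2 else K z / cs z ^ 2)"
  have cs0: "cs z = 0 \<longleftrightarrow> (\<exists>m::int. z = of_int m + 1/2)" for z unfolding cs_def by (rule cos_pi_eq_0_iff)
  have apart: "norm (p - q) \<ge> 1" if pq: "cs p = 0" "cs q = 0" "p \<noteq> q" for p q
  proof -
    obtain m m' :: int where m: "p = of_int m + 1/2" "q = of_int m' + 1/2" using pq(1,2) unfolding cs0 by blast
    have "norm (p - q) = norm (of_int (m - m') :: complex)" by (simp add: m)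
    also have "\<dots> = of_int \<bar>m - m'\<bar>" by (simp only: norm_of_int of_int_abs)
    moreover have "\<bar>m - m'\<bar> \<ge> 1" using pq(3) m by auto
    hence "real_of_int \<bar>m - m'\<bar> \<ge> of_int 1" unfolding of_int_le_iff .
    ultimately show ?thesis by simp
  qed
  have Q_near: "Q z = k p z / (of_real pi ^ 2 * sinc_pi (z - p) ^ 2) \<and> sinc_pi (z - p) \<noteq> 0"
    if p: "cs p = 0" and z: "z \<in> ball p 1" for p z
  proof (cases "z = p")
    case True
    thus ?thesis using p by (simp add: Q_def sinc_pi_def)
  next
    case False
    have nz: "cs z \<noteq> 0" using apart[OF _ p False] z by (auto simp: dist_norm norm_minus_commute)
    have "cs z ^ 2 = sin (of_real pi * (z - p)) ^ 2"
    proof -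
      obtain n where "p = of_real (half_int n) \<or> p = - of_real (half_int n)"
        using p unfolding cs_def cos_pi_eq_0_iff_half_int by auto
      thus ?thesis using sin_pi_shift_half_int[of z n]
        by (auto simp: cs_def power_mult_distrib simp flip: power_mult)
    qed
    hence c2: "cs z ^ 2 = of_real pi ^ 2 * (z - p) ^ 2 * sinc_pi (z - p) ^ 2"
      unfolding sinc_pi_mult[symmetric] by (simp add: power_mult_distrib)
    hence "sinc_pi (z - p) \<noteq> 0" using nz by auto
    moreover have "Q z = (z - p)^2 * k p z / (of_real pi ^ 2 * (z - p) ^ 2 * sinc_pi (z - p) ^ 2)"
      using nz k(2)[OF p, of z] c2 by (simp add: Q_def)
    ultimately show ?thesis using False by simp
  qed
  have hol_near: "Q holomorphic_on ball p 1" if p: "cs p = 0" for p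
  proof -
    have "(\<lambda>z. k p z / (of_real pi ^ 2 * sinc_pi (z - p) ^ 2)) holomorphic_on ball p 1"
      using Q_near[OF p] by (intro holomorphic_intros holomorphic_on_subset[OF k(1)[OF p]]) auto
    thus ?thesis using Q_near[OF p] by (subst holomorphic_cong[OF refl]) auto
  qed
  have hol_cs: "cs holomorphic_on A" for A unfolding cs_def by (intro holomorphic_intros)
  have open_nz: "open {z. cs z \<noteq> 0}"
    using holomorphic_on_imp_continuous_on[OF hol_cs[of UNIV]] by (intro open_Collect_neq) auto
  have hol_far: "Q holomorphic_on {z. cs z \<noteq> 0}"
  proof -
    have "(\<lambda>z. K z / cs z ^ 2) holomorphic_on {z. cs z \<noteq> 0}"
      by (intro holomorphic_intros hol_cs holomorphic_on_subset[OF hol]) auto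
    thus ?thesis by (subst holomorphic_cong[OF refl]) (auto simp: Q_def)
  qed
  have holQ: "Q holomorphic_on UNIV"
  proof -
    have "Q field_differentiable at z" for z
    proof (cases "cs z = 0")
      case True
      show ?thesis by (rule holomorphic_on_imp_differentiable_at[OF hol_near[OF True]]) auto
    next
      case False
      show ?thesis by (rule holomorphic_on_imp_differentiable_at[OF hol_far open_nz]) (use False in auto)
    qed
    thus ?thesis by (simp add: holomorphic_on_def field_differentiable_at_within)
  qed
  have far: "norm (Q z) \<le> 64 * M" if "\<And>p. cs p = 0 \<Longrightarrow> norm (z - p) \<ge> 1/4" for z
  proof -
    have "exp (2 * pi * \<bar>Im z\<bar>) \<le> 64 * norm (cs z) ^ 2"
      unfolding cs_def by (rule norm_cos_pi_lower_bound) (use that cs0 in blast)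
    hence "M * exp (2 * pi * \<bar>Im z\<bar>) \<le> M * (64 * norm (cs z) ^ 2)" using M0 by (rule mult_left_mono)
    hence "norm (K z) \<le> 64 * M * norm (cs z) ^ 2" using bound[of z] by simp
    moreover have nz: "cs z \<noteq> 0" using that[of z] by auto
    hence "norm (cs z) ^ 2 > 0" by simp
    ultimately show ?thesis using nz by (simp add: Q_def norm_divide norm_power pos_divide_le_eq)
  qed
  have "norm (Q z) \<le> 64 * M" for z
  proof (cases "\<exists>p. cs p = 0 \<and> norm (z - p) < 1/4")
    case False
    thus ?thesis by (intro far) (meson not_less)
  next
    case True
    then obtain p where p: "cs p = 0" "norm (z - p) < 1/4" by blast
    show ?thesis
    proof (rule maximum_modulus_frontier[of Q "ball p (1/4)"])
      show "Q holomorphic_on interior (ball p (1/4))" using holQ by (rule holomorphic_on_subset) simp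
      show "continuous_on (closure (ball p (1/4))) Q"
        using holomorphic_on_imp_continuous_on[OF holQ] by (rule continuous_on_subset) simp
      show "z \<in> ball p (1/4)" using p by (simp add: dist_norm norm_minus_commute)
      fix w assume "w \<in> frontier (ball p (1/4))"
      hence w: "norm (w - p) = 1/4" by (simp add: dist_norm norm_minus_commute)
      show "norm (Q w) \<le> 64 * M"
      proof (rule far)
        fix q assume q: "cs q = 0"
        show "norm (w - q) \<ge> 1/4"
        proof (cases "q = p")
          case True thus ?thesis using w by simp
        next
          case False
          have "norm (q - p) \<le> norm (w - q) + norm (w - p)"
            using norm_triangle_ineq4[of "w - p" "w - q"] by simp
          thus ?thesis using apart[OF q p(1) False] w by simp
        qed
      qed
    qed auto
  qed
  hence "bounded (range Q)" by (auto simp: bounded_iff)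
  then obtain c where c: "\<And>z. Q z = c"
    using Liouville_theorem[OF holQ] unfolding constant_on_def by blast
  have "K z = c * cs z ^ 2" for z
  proof (cases "cs z = 0")
    case True
    thus ?thesis using zeros[of z] by (simp add: cs_def)
  next
    case False
    thus ?thesis using c[of z] by (simp add: Q_def field_simps)
  qed
  thus ?thesis using that unfolding cs_def by blast
qed

text \<open>
  The difference \<open>g - Re X\<close> has a minimum at \<open>t\<close>, which determines the real part of the derivative; the
  imaginary part is 0 because \<open>X\<close> is real on the real line.
\<close>

lemma deriv_at_touching_point:
  fixes X :: "complex \<Rightarrow> complex" and g :: "real \<Rightarrow> real"
  assumes hol: "X holomorphic_on UNIV" and real: "\<And>t. Im (X (of_real t)) = 0"
    and le: "\<And>t. Re (X (of_real t)) \<le> g t" and touch: "Re (X (of_real t)) = g t"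
    and g: "(g has_real_derivative g') (at t)"
  shows "deriv X (of_real t) = of_real g'"
proof -
  have X: "(X has_field_derivative deriv X (of_real t)) (at (of_real t))"
    by (rule holomorphic_derivI[OF hol]) auto
  have v: "((\<lambda>t. X (of_real t)) has_vector_derivative deriv X (of_real t)) (at t)"
    by (rule has_vector_derivative_real_field[OF X])
  have re: "((\<lambda>t. Re (X (of_real t))) has_real_derivative Re (deriv X (of_real t))) (at t)"
    using bounded_linear.has_vector_derivative[OF bounded_linear_Re v]
    by (simp add: has_real_derivative_iff_has_vector_derivative)
  have im: "((\<lambda>t. Im (X (of_real t))) has_real_derivative Im (deriv X (of_real t))) (at t)"
    using bounded_linear.has_vector_derivative[OF bounded_linear_Im v]
    by (simp add: has_real_derivative_iff_has_vector_derivative)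
  have "((\<lambda>t. g t - Re (X (of_real t))) has_real_derivative g' - Re (deriv X (of_real t))) (at t)"
    by (rule DERIV_diff[OF g re])
  hence "g' - Re (deriv X (of_real t)) = 0"
    by (rule DERIV_local_min[of _ _ _ 1]) (use le touch in \<open>auto simp: algebra_simps\<close>)
  moreover have "Im (deriv X (of_real t)) = 0"
    using im unfolding real by (rule DERIV_unique) simp
  ultimately show ?thesis by (simp add: complex_eq_iff)
qed

lemma integral_cos_squared_multiple_eq_0_imp:
  fixes c :: real
  assumes "integrable lborel (\<lambda>x. c * cos (pi * x) ^ 2)" and "(LBINT x. c * cos (pi * x) ^ 2) = 0"
  shows "c = 0"
proof (rule ccontr)
  assume "c \<noteq> 0"
  have "integrable lborel (\<lambda>x. (1 / c) * (c * cos (pi * x) ^ 2))" by (intro integrable_mult_right assms(1))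
  hence i: "integrable lborel (\<lambda>x. cos (pi * x) ^ 2)" using \<open>c \<noteq> 0\<close> by simp
  have z: "(LBINT x. cos (pi * x) ^ 2) = 0" using assms(2) \<open>c \<noteq> 0\<close> by simp
  have "(LBINT x. indicat_real {0..1/4::real} x *\<^sub>R (1/2)) \<le> (LBINT x. cos (pi * x) ^ 2)"
  proof (rule integral_mono)
    show "integrable lborel (\<lambda>x. cos (pi * x) ^ 2)" by (rule i)
    show "integrable lborel (\<lambda>x. indicat_real {0..1/4::real} x *\<^sub>R (1/2 :: real))"
      by (intro integrable_scaleR_left) simp
    fix x :: real
    show "indicat_real {0..1/4} x *\<^sub>R (1/2) \<le> cos (pi * x) ^ 2"
    proof (cases "x \<in> {0..1/4}")
      case True
      hence "cos (pi / 4) \<le> cos (pi * x)" by (intro cos_monotone_0_pi_le) auto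
      hence "(sqrt 2 / 2)^2 \<le> cos (pi * x) ^ 2" by (intro power_mono) (auto simp: cos_45)
      thus ?thesis using True by (simp add: power_divide)
    qed auto
  qed
  thus False using z by simp
qed

lemma ext_integral_eq_integral:
  assumes "integrable lborel f"
  shows "ext_integral f = ereal (LBINT x. f x)"
proof -
  have fin: "(\<integral>\<^sup>+x. ennreal (f x) \<partial>lborel) \<noteq> \<infinity>" "(\<integral>\<^sup>+x. ennreal (- f x) \<partial>lborel) \<noteq> \<infinity>"
    using assms by (simp_all add: real_integrable_def)
  have e: "enn2ereal X = ereal (enn2real X)" if "X \<noteq> \<infinity>" for X
    using that by (cases X) (auto simp: enn2ereal_ennreal)
  show ?thesis
    unfolding ext_integral_def real_lebesgue_integral_def[OF assms] e[OF fin(1)] e[OF fin(2)] by simp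
qed

lemma ext_integral_eq_minus_infinity:
  assumes "f \<in> borel_measurable lborel" "\<not> integrable lborel f" "integrable lborel g" "\<And>x. f x \<le> g x"
  shows "ext_integral f = - \<infinity>"
proof -
  have "(\<integral>\<^sup>+x. ennreal (f x) \<partial>lborel) \<le> (\<integral>\<^sup>+x. ennreal (g x) \<partial>lborel)"
    using assms(4) by (intro nn_integral_mono ennreal_leI)
  also have "\<dots> < \<infinity>" using assms(3) by (simp add: real_integrable_def less_top)
  finally have fin: "(\<integral>\<^sup>+x. ennreal (f x) \<partial>lborel) \<noteq> \<infinity>" by simp
  hence "(\<integral>\<^sup>+x. ennreal (- f x) \<partial>lborel) = \<infinity>"
    using assms(1,2) by (auto simp: real_integrable_def)
  moreover have "enn2ereal X = ereal (enn2real X)" if "X \<noteq> \<infinity>" for X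
    using that by (cases X) (auto simp: enn2ereal_ennreal)
  ultimately show ?thesis unfolding ext_integral_def using fin by simp
qed

theorem theorem2:
  fixes lam :: real and F :: "complex \<Rightarrow> complex"
  assumes "lam > 0"
    and "real_entire F"
    and "exponential_type_at_most (2 * pi) F"
    and "\<And>x::real. Re (F (of_real x)) \<le> Re (gaussian lam (of_real x))"
  shows "ext_integral (\<lambda>x. Re (F (of_real x)))
           \<le> ereal (lam powr (-1/2) * Re (theta2 0 (\<i> * of_real (1 / lam)))) \<and>
         (ext_integral (\<lambda>x. Re (F (of_real x)))
           = ereal (lam powr (-1/2) * Re (theta2 0 (\<i> * of_real (1 / lam)))) \<longleftrightarrow>
          (\<forall>z. F z = minorant lam z))"
proof -
  let ?L = "minorant_series lam"
  define f where "f = (\<lambda>x. Re (F (of_real x)))"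
  define g where "g = (\<lambda>x::real. exp (- pi * lam * x^2))"
  define S where "S = (\<Sum>n. 2 * g (half_int n))"
  have S: "lam powr (-1/2) * Re (theta2 0 (\<i> * of_real (1 / lam))) = S"
    unfolding S_def g_def by (rule half_int_gaussian_sum_eq_theta2[OF assms(1), symmetric])
  have hol: "F holomorphic_on UNIV" and Im_F: "Im (F (of_real x)) = 0" for x
    using assms(2) by (auto simp: real_entire_def complex_is_Real_iff)
  have F_real: "F (of_real x) = of_real (f x)" for x
    using Im_F[of x] by (simp add: f_def complex_eq_iff)
  have G: "Re (gaussian lam (of_real x)) = g x" for x by (simp add: gaussian_of_real g_def)
  have le: "f x \<le> g x" for x using assms(4)[of x] by (simp add: f_def G)
  have cont: "continuous_on UNIV f" unfolding f_def
    by (intro continuous_intros continuous_on_compose2[OF holomorphic_on_imp_continuous_on[OF hol]]) auto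
  have int_g: "integrable lborel g"
  proof (rule integrable_quadratic_decay[where C = "1 + 1 / (pi * lam)"])
    show "g \<in> borel_measurable borel" unfolding g_def by measurable
    show "norm (g x) \<le> (1 + 1 / (pi * lam)) / (1 + x^2)" for x
      using exp_neg_square_le[of "pi * lam" x] assms(1) by (simp add: g_def)
  qed
  have int_L: "integrable lborel (\<lambda>x. ?L (of_real x))" and ev_L: "(LBINT x. ?L (of_real x)) = of_real S"
    using integral_minorant_series[OF assms(1)] by (simp_all add: S_def g_def)
  have int_ReL: "integrable lborel (\<lambda>x. Re (?L (of_real x)))" by (rule integrable_Re[OF int_L])
  have ev_ReL: "(LBINT x. Re (?L (of_real x))) = S" using integral_Re[OF int_L] ev_L by simp

  have "ext_integral f \<le> ereal S \<and> (ext_integral f = ereal S \<longleftrightarrow> (\<forall>z. F z = ?L z))"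
  proof (cases "integrable lborel f")
    case False
    have "ext_integral f = - \<infinity>"
      by (rule ext_integral_eq_minus_infinity[OF _ False int_g le]) (use borel_measurable_continuous_onI[OF cont] in simp)
    moreover have "\<not> (\<forall>z. F z = ?L z)"
    proof
      assume "\<forall>z. F z = ?L z"
      hence "f = (\<lambda>x. Re (?L (of_real x)))" by (simp add: f_def)
      thus False using False int_ReL by simp
    qed
    ultimately show ?thesis by simp
  next
    case True
    have ext: "ext_integral f = ereal (LBINT x. f x)" by (rule ext_integral_eq_integral[OF True])
    have int_F: "integrable lborel (\<lambda>x. F (of_real x))" unfolding F_real using True by (rule integrable_of_real)
    have Re_int: "Re (LBINT x. F (of_real x)) = (LBINT x. f x)" using integral_Re[OF int_F] by (simp add: f_def)
    obtain M where M: "\<And>z. norm (F z) \<le> M * exp (2 * pi * \<bar>Im z\<bar>)"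
      using integrable_real_axis_imp_bounded[OF hol assms(3) _ int_F] by auto
    have defect: "(\<Sum>n<N. g (half_int n) + g (- half_int n) - Re (half_int_pair_sum F n)) \<le> S - (LBINT x. f x)" for N
    proof -
      have "(\<Sum>n<N. g (half_int n) + g (- half_int n) - Re (half_int_pair_sum F n))
          \<le> (\<Sum>n. g (half_int n) + g (- half_int n)) - Re (LBINT x. F (of_real x))"
      proof (rule half_int_majorant_defect_le[OF hol M int_F])
        show "Re (F (of_real x)) \<le> g x" for x using le[of x] by (simp add: f_def)
        show "continuous_on UNIV g" unfolding g_def by (intro continuous_intros)
        show "g x \<ge> 0" for x by (simp add: g_def)
        show "g (r * half_int n) + g (- (r * half_int n)) \<le> 2 * exp (- pi * (lam / 4) * half_int n ^ 2)"
          if "1/2 \<le> r" for r n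
        proof -
          have "(1/2)^2 \<le> r^2" using that by (intro power_mono) auto
          hence "pi * lam * half_int n ^ 2 * (1/4) \<le> pi * lam * half_int n ^ 2 * r^2"
            using assms(1) by (intro mult_left_mono) (auto simp: power2_eq_square)
          hence "g (r * half_int n) \<le> exp (- pi * (lam / 4) * half_int n ^ 2)"
            unfolding g_def by (simp add: power_mult_distrib mult_ac)
          moreover have "g (- (r * half_int n)) = g (r * half_int n)" by (simp add: g_def)
          ultimately show ?thesis by simp
        qed
        show "summable (\<lambda>n. 2 * exp (- pi * (lam / 4) * half_int n ^ 2))"
          using assms(1) by (intro summable_mult summable_half_int_theta) simp
      qed
      thus ?thesis by (simp add: S_def g_def Re_int)
    qed
    have upper: "(LBINT x. f x) \<le> S" using defect[of 0] by simp
    have "(LBINT x. f x) = S \<longleftrightarrow> (\<forall>z. F z = ?L z)"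
    proof
      assume "\<forall>z. F z = ?L z"
      thus "(LBINT x. f x) = S" using ev_ReL by (simp add: f_def)
    next
      assume eq: "(LBINT x. f x) = S"
      have interp: "f (half_int n) = g (half_int n) \<and> f (- half_int n) = g (- half_int n)" for n
      proof -
        define a where "a = (\<lambda>n. g (half_int n) + g (- half_int n) - Re (half_int_pair_sum F n))"
        have a: "a n = (g (half_int n) - f (half_int n)) + (g (- half_int n) - f (- half_int n))" for n
          by (simp add: a_def half_int_pair_sum_def f_def)
        have "a n \<ge> 0" for n unfolding a using le[of "half_int n"] le[of "- half_int n"] by simp
        hence "a n \<le> (\<Sum>n<Suc n. a n)" by (intro member_le_sum) auto
        also have "\<dots> \<le> 0" using defect[of "Suc n"] eq by (simp add: a_def)
        finally show ?thesis unfolding a using le[of "half_int n"] le[of "- half_int n"] by linarith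
      qed
      define K where "K = (\<lambda>z. F z - ?L z)"
      have hol_L: "?L holomorphic_on UNIV" by (rule holomorphic_minorant_series[OF assms(1)])
      have Im_L: "Im (?L (of_real x)) = 0" for x using minorant_series_real[OF assms(1), of x] by (metis Im_complex_of_real)
      have le_L: "Re (?L (of_real x)) \<le> g x" for x using minorant_series_le_gaussian[OF assms(1), of x] by (simp add: G)
      have touch: "K (of_real t) = 0 \<and> deriv K (of_real t) = 0"
        if "f t = g t" "?L (of_real t) = gaussian lam (of_real t)" for t
      proof
        have L_t: "Re (?L (of_real t)) = g t" using that(2) G by simp
        show "K (of_real t) = 0"
          using that by (simp add: K_def F_real gaussian_of_real g_def)
        have dg: "(g has_real_derivative - 2 * pi * lam * t * g t) (at t)"
          unfolding g_def by (auto intro!: derivative_eq_intros)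
        have "deriv F (of_real t) = of_real (- 2 * pi * lam * t * g t)"
          by (rule deriv_at_touching_point[OF hol Im_F _ _ dg]) (use le that(1) in \<open>auto simp: f_def\<close>)
        moreover have "deriv ?L (of_real t) = of_real (- 2 * pi * lam * t * g t)"
          by (rule deriv_at_touching_point[OF hol_L Im_L le_L L_t dg])
        moreover have "deriv K (of_real t) = deriv F (of_real t) - deriv ?L (of_real t)"
          unfolding K_def
          by (intro deriv_diff holomorphic_on_imp_differentiable_at[OF hol] holomorphic_on_imp_differentiable_at[OF hol_L]) auto
        ultimately show "deriv K (of_real t) = 0" by simp
      qed
      have hol_K: "K holomorphic_on UNIV" unfolding K_def by (intro holomorphic_intros hol hol_L)
      have bound_K: "norm (K z) \<le> (M + suminf (minorant_weight lam)) * exp (2 * pi * \<bar>Im z\<bar>)" for z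
        using norm_triangle_ineq4[of "F z" "?L z"] M[of z] norm_minorant_series_le[OF assms(1), of z]
        by (simp add: K_def distrib_right)
      have zeros_K: "K z = 0 \<and> deriv K z = 0" if cz: "cos (of_real pi * z) = 0" for z
      proof -
        obtain n where "z = of_real (half_int n) \<or> z = of_real (- half_int n)"
          using cz unfolding cos_pi_eq_0_iff_half_int by blast
        thus ?thesis using touch interp minorant_series_at_half_int by metis
      qed
      obtain c where c: "\<And>z. K z = c * cos (of_real pi * z) ^ 2"
        using multiple_of_cos_squared[OF hol_K bound_K zeros_K] by blast
      have K_Re: "Re c * cos (pi * x) ^ 2 = f x - Re (?L (of_real x))" for x
      proof -
        have "cos (of_real pi * of_real x) = complex_of_real (cos (pi * x))"
          by (simp flip: cos_of_real)
        hence "K (of_real x) = c * complex_of_real (cos (pi * x) ^ 2)" using c[of "of_real x"] by simp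
        hence "Re (K (of_real x)) = Re c * cos (pi * x) ^ 2" by simp
        thus ?thesis by (simp add: K_def f_def)
      qed
      have "Re c = 0"
      proof (rule integral_cos_squared_multiple_eq_0_imp)
        show "integrable lborel (\<lambda>x. Re c * cos (pi * x) ^ 2)"
          unfolding K_Re by (intro Bochner_Integration.integrable_diff True int_ReL)
        show "(LBINT x. Re c * cos (pi * x) ^ 2) = 0"
          unfolding K_Re using Bochner_Integration.integral_diff[OF True int_ReL] eq ev_ReL by simp
      qed
      moreover have "Im c = 0"
      proof -
        have "c = K (of_real 0)" using c[of 0] by simp
        thus ?thesis using Im_F[of 0] Im_L[of 0] by (simp add: K_def)
      qed
      ultimately have "c = 0" by (simp add: complex_eq_iff)
      thus "\<forall>z. F z = ?L z" using c by (simp add: K_def)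
    qed
    thus ?thesis using ext upper by simp
  qed
  thus ?thesis unfolding S f_def minorant_eq_series[OF assms(1)] .
qed

end
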